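(* Let $n\ge3$. Let $U\subset\mathcal S^{n\times n}$ be a convex open set and $F\in C^1(U)\cap C^0(\overline U)$ satisfy: (1) $O^{-1}UO=U$ for all $O\in O(n)$; (2) $M\in U$ and $N\in\mathcal S^{n\times n}_+$ imply $M+N\in U$; (3) $M\in U$ implies $aM\in U$ for all constants $a>0$; (4) $\{aI : a>0\}\cap\partial U=\emptyset$; (5) $F(O^{-1}MO)=F(M)$ for all $M\in U$, $O\in O(n)$; (6) the matrix $(F_{ij}(M))$ is positive definite for all $M\in U$, where $F_{ij}(M)=\frac{\partial F}{\partial M_{ij}}(M)$; (7) $F>0$ in $U$ and $F=0$ on $\partial U$. Assume that a positive function $u\in C^{1,1}(\mathbb R^n)$ satisfies $\Delta u\le0$ in $\mathbb R^n$ in the distribution sense and $$F(A^u)=0,\ \text{ or equivalently } A^u\in\partial U,\ \text{ almost everywhere in }\mathbb R^n .$$ Then $u\equiv u(0)$ in $\mathbb R^n$.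
   Context: $\mathcal S^{n\times n}$ is the set of $n\times n$ real symmetric matrices, $\mathcal S^{n\times n}_+$ the subset of positive definite matrices, $O(n)$ the set of $n\times n$ real orthogonal matrices, $I$ the identity matrix. For a positive function $u$, at points where $u$ is twice differentiable, $$A^u=-\frac{2}{n-2}u^{-\frac{n+2}{n-2}}\nabla^2u+\frac{2n}{(n-2)^2}u^{-\frac{2n}{n-2}}\nabla u\otimes\nabla u-\frac{2}{(n-2)^2}u^{-\frac{2n}{n-2}}|\nabla u|^2I .$$ For an open set $O$, $C^{1,1}(O)$ denotes the $C^1$ functions on $O$ whose gradient is locally Lipschitz; for such $u$ the Hessian, hence $A^u$, exists almost everywhere. *)

theory Defs
  imports "HOL-Analysis.Analysis"
begin

definition dir_deriv :: "('a::real_vector \<Rightarrow> real) \<Rightarrow> 'a \<Rightarrow> 'a \<Rightarrow> real" where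
  "dir_deriv f v x = deriv (\<lambda>t. f (x + t *\<^sub>R v)) 0"

definition partial :: "'n \<Rightarrow> (real^'n::finite \<Rightarrow> real) \<Rightarrow> real^'n \<Rightarrow> real" where
  "partial i f = dir_deriv f (axis i 1)"

definition grad :: "(real^'n::finite \<Rightarrow> real) \<Rightarrow> real^'n \<Rightarrow> real^'n" where
  "grad f x = (\<chi> i. partial i f x)"

definition hessian :: "(real^'n::finite \<Rightarrow> real) \<Rightarrow> real^'n \<Rightarrow> real^'n^'n" where
  "hessian f x = (\<chi> i j. partial i (partial j f) x)"

definition laplacian :: "(real^'n::finite \<Rightarrow> real) \<Rightarrow> real^'n \<Rightarrow> real" where
  "laplacian f x = (\<Sum>i\<in>UNIV. partial i (partial i f) x)"

definition outer_prod :: "real^'n \<Rightarrow> real^'n \<Rightarrow> real^'n^'n" where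
  "outer_prod v w = (\<chi> i j. v $ i * w $ j)"

text \<open>The value of \<open>conf_hessian u x\<close> is meaningful only where \<open>u\<close> is twice differentiable; elsewhere
  it is unspecified. It is only used under an almost-everywhere quantifier.\<close>
definition conf_hessian :: "(real^'n::finite \<Rightarrow> real) \<Rightarrow> real^'n \<Rightarrow> real^'n^'n" where
  "conf_hessian u x =
    (let n = real CARD('n) in
       (- (2 / (n - 2)) * u x powr (- ((n + 2) / (n - 2)))) *\<^sub>R hessian u x
     + (2 * n / (n - 2)\<^sup>2 * u x powr (- (2 * n / (n - 2)))) *\<^sub>R outer_prod (grad u x) (grad u x)
     - (2 / (n - 2)\<^sup>2 * u x powr (- (2 * n / (n - 2))) * (norm (grad u x))\<^sup>2) *\<^sub>R mat 1)"

definition C11_on :: "(real^'n::finite) set \<Rightarrow> (real^'n \<Rightarrow> real) \<Rightarrow> bool" where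
  "C11_on S u \<longleftrightarrow>
     (\<forall>x\<in>S. u differentiable (at x)) \<and>
     continuous_on S (grad u) \<and>
     (\<forall>x\<in>S. \<exists>e>0. \<exists>L. ball x e \<subseteq> S \<and> L-lipschitz_on (ball x e) (grad u))"

text \<open>\<open>\<phi>\<close> is \<open>C\<^sup>\<infinity>\<close> iff all its iterated partial derivatives are (totally) differentiable everywhere.\<close>
definition smooth :: "(real^'n::finite \<Rightarrow> real) \<Rightarrow> bool" where
  "smooth \<phi> \<longleftrightarrow> (\<forall>is x. (foldr partial is \<phi>) differentiable (at x))"

definition test_function :: "(real^'n::finite \<Rightarrow> real) \<Rightarrow> bool" where
  "test_function \<phi> \<longleftrightarrow> smooth \<phi> \<and> compact (closure {x. \<phi> x \<noteq> 0})"

text \<open>\<open>\<Delta>u \<le> 0\<close> in the sense of distributions on the whole space (for \<open>u\<close> locally integrable).\<close>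
definition laplacian_le_0_distr :: "(real^'n::finite \<Rightarrow> real) \<Rightarrow> bool" where
  "laplacian_le_0_distr u \<longleftrightarrow>
     (\<forall>\<phi>. test_function \<phi> \<and> (\<forall>x. \<phi> x \<ge> 0) \<longrightarrow> (LINT x|lebesgue. u x * laplacian \<phi> x) \<le> 0)"

definition sym_matrices :: "(real^'n^'n) set" where
  "sym_matrices = {M. transpose M = M}"

definition posdef :: "real^'n^'n::finite \<Rightarrow> bool" where
  "posdef M \<longleftrightarrow> M \<in> sym_matrices \<and> (\<forall>x. x \<noteq> 0 \<longrightarrow> x \<bullet> (M *v x) > 0)"

text \<open>Topological notions for \<open>U\<close> (open, closure, boundary) are relative to the space of symmetric
  matrices; as a subset of all matrices \<open>U\<close> would have empty interior.\<close>
abbreviation sym_top :: "(real^'n^'n::finite) topology" where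
  "sym_top \<equiv> top_of_set sym_matrices"

definition sym_unit :: "'n \<Rightarrow> 'n \<Rightarrow> real^'n^'n::finite" where
  "sym_unit i j =
     (1/2) *\<^sub>R ((\<chi> k l. if k = i \<and> l = j then 1 else 0) + (\<chi> k l. if k = j \<and> l = i then 1 else 0))"

text \<open>The matrix \<open>F\<^sub>i\<^sub>j = \<partial>F/\<partial>M\<^sub>i\<^sub>j\<close> of a function on symmetric matrices. Since \<open>F\<close> is defined only there,
  the entry is the derivative along the symmetrised unit matrix. This is the usual normalisation
  \<open>dF(M)(N) = \<Sum>\<^sub>i\<^sub>,\<^sub>j F\<^sub>i\<^sub>j(M) N\<^sub>i\<^sub>j\<close>; see \<open>has_derivative_sym_grad\<close> below.\<close>
definition sym_grad :: "(real^'n^'n \<Rightarrow> real) \<Rightarrow> real^'n^'n \<Rightarrow> real^'n^'n::finite" where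
  "sym_grad F M = (\<chi> i j. dir_deriv F (sym_unit i j) M)"

definition C1_on_sym :: "(real^'n^'n::finite) set \<Rightarrow> (real^'n^'n \<Rightarrow> real) \<Rightarrow> bool" where
  "C1_on_sym U F \<longleftrightarrow>
     (\<forall>M\<in>U. F differentiable (at M within sym_matrices)) \<and> continuous_on U (sym_grad F)"

lemma sym_matrices_iff: "M \<in> sym_matrices \<longleftrightarrow> (\<forall>i j. M $ i $ j = M $ j $ i)"
  unfolding sym_matrices_def transpose_def mem_Collect_eq vec_eq_iff vec_lambda_beta by metis

lemma sym_unit_nth:
  "sym_unit i j $ k $ l =
     (1/2) * (if k = i \<and> l = j then 1 else 0) + (1/2) * (if k = j \<and> l = i then 1 else 0)"
  unfolding sym_unit_def vector_scaleR_component vector_add_component vec_lambda_beta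
  by (simp only: real_scaleR_def distrib_left)

lemma sym_unit_in_sym: "sym_unit i j \<in> sym_matrices"
  unfolding sym_matrices_iff sym_unit_nth by (simp add: conj_commute)

lemma sym_matrices_expand:
  assumes "N \<in> sym_matrices"
  shows "N = (\<Sum>i\<in>UNIV. \<Sum>j\<in>UNIV. (N $ i $ j) *\<^sub>R sym_unit i j)"
proof -
  have s: "N $ l $ k = N $ k $ l" for k l
    using assms by (metis sym_matrices_iff)
  have d1: "(\<Sum>i\<in>UNIV. \<Sum>j\<in>UNIV. N $ i $ j * (if k = i \<and> l = j then 1 else 0)) = N $ k $ l" for k l
  proof -
    have "(\<Sum>i\<in>UNIV. \<Sum>j\<in>UNIV. N $ i $ j * (if k = i \<and> l = j then 1 else 0))
        = (\<Sum>i\<in>UNIV. if k = i then (\<Sum>j\<in>UNIV. if l = j then N $ i $ j else 0) else 0)"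
      by (intro sum.cong refl) (simp add: if_distrib[of "times _"] cong: if_cong)
    then show ?thesis by simp
  qed
  have d2: "(\<Sum>i\<in>UNIV. \<Sum>j\<in>UNIV. N $ i $ j * (if k = j \<and> l = i then 1 else 0)) = N $ k $ l" for k l
  proof -
    have "(\<Sum>i\<in>UNIV. \<Sum>j\<in>UNIV. N $ i $ j * (if k = j \<and> l = i then 1 else 0))
        = (\<Sum>i\<in>UNIV. if l = i then (\<Sum>j\<in>UNIV. if k = j then N $ i $ j else 0) else 0)"
      by (intro sum.cong refl) (simp add: if_distrib[of "times _"] cong: if_cong)
    then show ?thesis using s[of l k] by simp
  qed
  have "(\<Sum>i\<in>UNIV. \<Sum>j\<in>UNIV. (N $ i $ j) *\<^sub>R sym_unit i j) $ k $ l = N $ k $ l" for k l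
  proof -
    have "(\<Sum>i\<in>UNIV. \<Sum>j\<in>UNIV. (N $ i $ j) *\<^sub>R sym_unit i j) $ k $ l
      = (1/2) * (\<Sum>i\<in>UNIV. \<Sum>j\<in>UNIV. N $ i $ j * (if k = i \<and> l = j then 1 else 0))
      + (1/2) * (\<Sum>i\<in>UNIV. \<Sum>j\<in>UNIV. N $ i $ j * (if k = j \<and> l = i then 1 else 0))"
      unfolding sum_distrib_left sum.distrib[symmetric]
      by (simp only: sum_component vector_scaleR_component sym_unit_nth real_scaleR_def distrib_left
          mult.left_commute)
    then show ?thesis unfolding d1 d2 by simp
  qed
  then show ?thesis unfolding vec_eq_iff by metis
qed

lemma has_derivative_sym_grad:
  assumes D: "(F has_derivative D) (at M within sym_matrices)"
    and M: "M \<in> sym_matrices" and N: "N \<in> sym_matrices"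
  shows "D N = sym_grad F M \<bullet> N"
proof -
  have lin: "linear D" using D by (rule has_derivative_linear)
  have dd: "dir_deriv F (sym_unit i j) M = D (sym_unit i j)" for i j
  proof -
    let ?g = "\<lambda>t. M + t *\<^sub>R sym_unit i j"
    have g: "(?g has_derivative (\<lambda>t. t *\<^sub>R sym_unit i j)) (at 0)"
      by (auto intro!: derivative_eq_intros)
    have sub: "range ?g \<subseteq> sym_matrices"
      using M sym_unit_in_sym[of i j]
      unfolding sym_matrices_iff image_subset_iff vector_add_component vector_scaleR_component
      by simp
    have "(F has_derivative D) (at (?g 0) within range ?g)"
      using has_derivative_subset[OF D sub] by simp
    from diff_chain_within[OF g this]
    have "((\<lambda>t. F (?g t)) has_derivative (\<lambda>t. D (sym_unit i j) * t)) (at 0)"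
      by (simp add: o_def linear_cmul[OF lin] mult.commute)
    then have "((\<lambda>t. F (?g t)) has_field_derivative D (sym_unit i j)) (at 0)"
      by (simp add: has_field_derivative_def)
    then show ?thesis by (simp add: dir_deriv_def DERIV_imp_deriv)
  qed
  have "D N = D (\<Sum>i\<in>UNIV. \<Sum>j\<in>UNIV. (N $ i $ j) *\<^sub>R sym_unit i j)"
    by (rule arg_cong[OF sym_matrices_expand[OF N]])
  also have "\<dots> = (\<Sum>i\<in>UNIV. \<Sum>j\<in>UNIV. N $ i $ j * D (sym_unit i j))"
    by (simp add: linear_sum[OF lin] linear_cmul[OF lin])
  also have "\<dots> = sym_grad F M \<bullet> N"
    by (simp add: inner_vec_def sym_grad_def dd mult.commute)
  finally show ?thesis .
qed

end

theory Submission
  imports Defs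
begin

text \<open>
  Put \<open>n = CARD('n)\<close> and \<open>w = u powr (- 2/(n - 2))\<close>. In terms of \<open>w\<close> the matrix \<open>A\<^sup>u\<close> becomes the quadratic
  expression \<open>A(w) = w \<nabla>\<^sup>2w - 1/2 \<bar>\<nabla>w\<bar>\<^sup>2 I\<close> (\<open>conf_hessian_eq_schouten\<close>), and the equation says
  that \<open>A(w)\<close> lies almost everywhere in \<open>K - U\<close>, where \<open>K\<close> is the closure of \<open>U\<close>.
  Here \<open>K\<close> is a convex cone, invariant under reflections, whose elements have nonnegative trace, and
  adding a positive definite matrix to an element of \<open>K\<close> leads into \<open>U\<close>.

  The equation is degenerate, so there is no strong maximum principle to rely on. It is replaced by a comparison
  principle. Adding to \<open>w\<close> the bubble \<open>\<epsilon> (\<bar>x\<bar>\<^sup>2 + 1)\<close> changes \<open>A(w) \<in> K\<close> into an element of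
  \<open>K\<close> plus a positive multiple of \<open>I\<close>: the mixed terms of the quadratic expression \<open>A\<close> complete a square. Hence every
  subsolution is approximated by strict ones, and a strict subsolution cannot touch a solution from below
  (\<open>comparison\<close>). As the functions are only \<open>C\<^sup>1\<^sup>,\<^sup>1\<close>, touching is exploited on a set of points
  of positive measure near the contact point (\<open>local_max_hessian_AE\<close>), and the gradient is differentiable almost
  everywhere by Rademacher's theorem (\<open>lipschitz_AE_differentiable\<close>).

  The set of solutions is invariant under the inversions \<open>w \<mapsto> \<bar>y - x\<bar>\<^sup>2/l\<^sup>2 w(x + l\<^sup>2 (y - x)/\<bar>y - x\<bar>\<^sup>2)\<close>
  (\<open>schouten_AE_kelvin\<close>). Let \<open>\<gamma>\<close> be the upper limit of \<open>w(y)/\<bar>y\<bar>\<^sup>2\<close> at infinity; it is finite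
  because \<open>u\<close> is positive and superharmonic (\<open>growth_finite\<close>). Comparison on a punctured
  ball shows that the inversion of \<open>w\<close> in the sphere of centre \<open>x\<close> and radius \<open>l\<close> lies below \<open>w\<close> inside the ball as soon as
  \<open>\<gamma> l\<^sup>2 < w x\<close> (\<open>kelvin_le_inside\<close>); no sphere has to be moved.

  If \<open>\<gamma> = 0\<close>, all radii are allowed. Letting the spheres whose inversions exchange two points \<open>p\<close> and \<open>q\<close> degenerate
  to the hyperplane bisecting their segment gives \<open>w p \<le> w q\<close> (\<open>constant_if_no_growth\<close>).

  If \<open>\<gamma> > 0\<close>, the critical radius \<open>l\<^sup>2 = w x/\<gamma>\<close> yields, for every \<open>x\<close>, the bound
  \<open>w y \<le> \<gamma> \<bar>y\<bar>\<^sup>2 + (\<nabla>w x - 2 \<gamma> x) \<bullet> y + C\<close> near infinity (\<open>asymptotic_expansion_bound\<close>). Two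
  such bounds with different slopes would push the superharmonic function \<open>u\<close> above a comparison function
  that decays like \<open>(\<gamma> powr (-(n - 2)/2) + \<delta>) \<bar>y\<bar> powr (2 - n)\<close>, contradicting the choice of \<open>\<gamma>\<close>
  (\<open>asymptotic_slope_unique\<close>). So \<open>\<nabla>w x - 2 \<gamma> x\<close> is constant, \<open>w\<close> is a quadratic polynomial, \<open>A(w)\<close> is a positive
  multiple of \<open>I\<close> and hence in \<open>U\<close>, which is excluded (\<open>liouville\<close>).
\<close>

section \<open>Rademacher's theorem\<close>

text \<open>The derivative is produced as a Radon--Nikodym density. After adding a linear function, \<open>F\<close> becomes an
  increasing bi-Lipschitz bijection \<open>M\<close>; the image of Lebesgue measure under its inverse gives an interval \<open>[a,b]\<close> the mass \<open>M b - M a\<close>, and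
  it is absolutely continuous because \<open>M\<close> maps null sets to null sets.\<close>
lemma lipschitz_real_density:
  fixes F :: "real \<Rightarrow> real"
  assumes lip: "L-lipschitz_on UNIV F"
  obtains f where "\<And>a b. a \<le> b \<Longrightarrow> (f has_integral (F b - F a)) {a..b}"
proof -
  define K where "K = L + 1"
  have L0: "L \<ge> 0" using lip lipschitz_on_nonneg by blast
  have K: "K > 0" "\<And>x y. \<bar>F x - F y\<bar> \<le> K * \<bar>x - y\<bar>"
    using L0 lipschitz_onD[OF lip] unfolding K_def dist_real_def
    by (auto simp: distrib_right intro: add_increasing2)
  \<comment> \<open>the slope \<open>2 K\<close> makes \<open>M\<close> increase at rate at least \<open>K\<close>\<close>
  define M where "M x = F x + 2 * K * x" for x
  have M_low: "M y - M x \<ge> K * (y - x)" if "x \<le> y" for x y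
    using K(2)[of y x] that K(1) by (simp add: M_def algebra_simps)
  have M_lip: "\<bar>M x - M y\<bar> \<le> 3 * K * \<bar>x - y\<bar>" for x y
  proof -
    have "\<bar>M x - M y\<bar> \<le> \<bar>F x - F y\<bar> + \<bar>2 * K * (x - y)\<bar>"
      by (simp add: M_def algebra_simps)
    then show ?thesis using K(2)[of x y] K(1) by (simp add: abs_mult)
  qed
  have M_mono: "strict_mono M"
    unfolding strict_mono_def
  proof (intro allI impI)
    fix x y :: real assume "x < y"
    then have "K * (y - x) > 0" using K(1) by simp
    then show "M x < M y" using M_low[of x y] \<open>x < y\<close> by linarith
  qed
  have M_cont: "continuous_on UNIV M"
  proof -
    have "(3*K)-lipschitz_on UNIV M"
      using M_lip K(1) by (intro lipschitz_onI) (auto simp: dist_real_def)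
    then show ?thesis by (rule lipschitz_on_continuous_on)
  qed
  have M_surj: "\<exists>x. M x = y" for y
  proof -
    define b where "b = (\<bar>y\<bar> + \<bar>M 0\<bar>) / K"
    have b: "b \<ge> 0" "K * b = \<bar>y\<bar> + \<bar>M 0\<bar>" using K(1) by (auto simp: b_def)
    have "M b \<ge> y" using M_low[of 0 b] b by simp
    moreover have "M (-b) \<le> y" using M_low[of "-b" 0] b by simp
    moreover have "continuous_on {-b..b} M" using M_cont continuous_on_subset by blast
    ultimately show ?thesis using IVT'[of M "-b" y b] b by auto
  qed
  define \<phi> where "\<phi> = inv M"
  have M\<phi>: "M (\<phi> y) = y" for y using M_surj by (metis \<phi>_def f_inv_into_f rangeI)
  have \<phi>M: "\<phi> (M x) = x" for x
    using M_mono by (simp add: \<phi>_def strict_mono_imp_inj_on)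
  have le_iff: "M x \<le> M y \<longleftrightarrow> x \<le> y" for x y by (rule strict_mono_less_eq[OF M_mono])
  have "mono \<phi>" by (rule monoI) (metis M\<phi> le_iff)
  then have meas[measurable]: "\<phi> \<in> borel_measurable borel" by (rule borel_measurable_mono)
  define \<mu> where "\<mu> = distr lborel borel \<phi>"
  have vim: "\<phi> -` A = M ` A" for A by (auto simp: \<phi>M) (metis M\<phi> image_eqI)
  have ac: "absolutely_continuous lborel \<mu>"
    unfolding absolutely_continuous_def
  proof
    fix A :: "real set" assume A: "A \<in> null_sets lborel"
    then have "negligible A" by (simp add: negligible_iff_null_sets null_sets_completionI)
    have "negligible (M ` A)"
    proof (rule negligible_locally_Lipschitz_image[OF _ \<open>negligible A\<close>])
      fix x show "\<exists>T B. open T \<and> x \<in> T \<and> (\<forall>y\<in>A \<inter> T. norm (M y - M x) \<le> B * norm (y - x))"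
        using M_lip by (intro exI[of _ UNIV] exI[of _ "3*K"]) auto
    qed simp
    moreover have "M ` A \<in> sets lborel"
      using A measurable_sets[OF meas, of A] by (auto simp: vim[symmetric])
    ultimately have "M ` A \<in> null_sets lborel"
      by (metis negligible_iff_null_sets null_sets_completion_iff sets_lborel)
    moreover have "A \<in> sets borel" using A by auto
    ultimately show "A \<in> null_sets \<mu>"
      by (intro null_setsI) (simp_all add: \<mu>_def emeasure_distr vim null_setsD1)
  qed
  obtain f where f[measurable]: "f \<in> borel_measurable lborel" and d: "density lborel f = \<mu>"
    using sigma_finite_measure.Radon_Nikodym[OF sigma_finite_lborel ac] by (auto simp: \<mu>_def)
  define g where "g x = enn2real (f x)" for x
  have g: "(g has_integral (M b - M a)) {a..b}" if ab: "a \<le> b" for a b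
  proof -
    have I: "(\<integral>\<^sup>+x. f x * indicator {a..b} x \<partial>lborel) = ennreal (M b - M a)"
    proof -
      have "(\<integral>\<^sup>+x. f x * indicator {a..b} x \<partial>lborel) = emeasure \<mu> {a..b}"
        unfolding d[symmetric] by (simp add: emeasure_density)
      also have "\<dots> = emeasure lborel (M ` {a..b})"
        by (simp add: \<mu>_def emeasure_distr vim)
      also have "M ` {a..b} = {M a..M b}"
        by (auto simp: le_iff) (metis M\<phi> atLeastAtMost_iff image_eqI le_iff)
      finally show ?thesis using ab le_iff by simp
    qed
    have fin: "AE x in lborel. f x * indicator {a..b} x \<noteq> \<infinity>"
      by (rule nn_integral_noteq_infinite) (use I in auto)
    have J: "(\<integral>\<^sup>+x. ennreal (g x * indicator {a..b} x) \<partial>lborel) = ennreal (M b - M a)"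
      unfolding I[symmetric]
      by (rule nn_integral_cong_AE, rule AE_mp[OF fin], rule AE_I2)
        (auto simp: g_def indicator_def ennreal_enn2real_if)
    have "((\<lambda>x. g x * indicator {a..b} x) has_integral (M b - M a)) UNIV"
      by (rule nn_integral_has_integral) (use J ab le_iff in \<open>auto simp: g_def\<close>)
    moreover have "(\<lambda>x. g x * indicator {a..b} x) = (\<lambda>x. if x \<in> {a..b} then g x else 0)"
      by (auto simp: indicator_def)
    ultimately show ?thesis by (simp only: has_integral_restrict_UNIV)
  qed
  show ?thesis
  proof (rule that[of "\<lambda>x. g x - 2 * K"])
    fix a b :: real assume ab: "a \<le> b"
    have "((\<lambda>x. 2 * K) has_integral (2 * K * (b - a))) {a..b}"
      using has_integral_const_real[of "2*K" a b] ab by (simp add: mult.commute)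
    from has_integral_diff[OF g[OF ab] this]
    show "((\<lambda>x. g x - 2 * K) has_integral F b - F a) {a..b}"
      by (simp add: M_def algebra_simps)
  qed
qed

text \<open>Lebesgue's differentiation theorem for the density; as the averages in
  \<open>integrable_ccontinuous_explicit\<close> are taken to the right of the point, it is applied to the reflected density as well.\<close>
lemma lipschitz_real_AE_differentiable:
  fixes F :: "real \<Rightarrow> real"
  assumes lip: "L-lipschitz_on UNIV F"
  shows "negligible {x. \<not> F differentiable (at x)}"
proof -
  obtain f where f: "\<And>a b. a \<le> b \<Longrightarrow> (f has_integral (F b - F a)) {a..b}"
    using lipschitz_real_density[OF lip] by blast
  have i1: "f integrable_on cbox a b" for a b
    using f[of a b] by (cases "a \<le> b") (auto simp: has_integral_iff)
  have f2: "((\<lambda>x. f (-x)) has_integral (F (-a) - F (-b))) {a..b}" if "a \<le> b" for a b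
    using f[of "-b" "-a"] that by (subst has_integral_reflect_real[symmetric]) auto
  have i2: "(\<lambda>x. f (-x)) integrable_on cbox a b" for a b
    using f2[of a b] by (cases "a \<le> b") (auto simp: has_integral_iff)
  obtain N1 where N1: "negligible N1" "\<And>x e. \<lbrakk>x \<notin> N1; 0 < e\<rbrakk> \<Longrightarrow>
               \<exists>d>0. \<forall>h. 0 < h \<and> h < d \<longrightarrow> norm(integral (cbox x (x + h *\<^sub>R One)) f /\<^sub>R h ^ DIM(real) - f x) < e"
    using integrable_ccontinuous_explicit[OF i1] by blast
  obtain N2 where N2: "negligible N2" "\<And>x e. \<lbrakk>x \<notin> N2; 0 < e\<rbrakk> \<Longrightarrow>
               \<exists>d>0. \<forall>h. 0 < h \<and> h < d \<longrightarrow> norm(integral (cbox x (x + h *\<^sub>R One)) (\<lambda>x. f (-x)) /\<^sub>R h ^ DIM(real) - f (-x)) < e"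
    using integrable_ccontinuous_explicit[OF i2] by blast
  have "F differentiable (at x)" if x: "x \<notin> N1" "-x \<notin> N2" for x
  proof -
    have "((\<lambda>h. (F (x + h) - F x) / h) \<longlongrightarrow> f x) (at 0)"
    proof (rule tendstoI)
      fix e :: real assume e: "e > 0"
      obtain d1 where d1: "d1 > 0" "\<And>h. 0 < h \<and> h < d1 \<Longrightarrow> \<bar>(F (x+h) - F x) / h - f x\<bar> < e"
        using N1(2)[OF x(1) e] integral_unique[OF f] by (auto simp: field_simps)
      obtain d2 where d2: "d2 > 0" "\<And>h. 0 < h \<and> h < d2 \<Longrightarrow> \<bar>(F x - F (x - h)) / h - f x\<bar> < e"
        using N2(2)[OF x(2) e] integral_unique[OF f2] by (auto simp: field_simps)
      have "dist ((F (x + h) - F x) / h) (f x) < e" if h: "h \<noteq> 0" "\<bar>h\<bar> < min d1 d2" for h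
      proof (cases "h > 0")
        case True then show ?thesis using d1(2)[of h] h by (simp add: dist_real_def)
      next
        case False
        then have "\<bar>(F x - F (x - (-h))) / (-h) - f x\<bar> < e" using d2(2)[of "-h"] h by simp
        moreover have "(F x - F (x - (-h))) / (-h) = (F (x + h) - F x) / h"
          using h by (simp add: field_simps)
        ultimately show ?thesis by (simp add: dist_real_def)
      qed
      then show "\<forall>\<^sub>F h in at 0. dist ((F (x + h) - F x) / h) (f x) < e"
        unfolding eventually_at using d1(1) d2(1) by (intro exI[of _ "min d1 d2"]) auto
    qed
    then have "(F has_field_derivative f x) (at x)" by (simp add: DERIV_def)
    then show ?thesis using real_differentiable_def by blast
  qed
  then have "{x. \<not> F differentiable (at x)} \<subseteq> N1 \<union> uminus ` N2"
    by (auto simp: image_iff) (metis minus_minus)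
  moreover have "negligible (uminus ` N2)"
    by (rule negligible_differentiable_image_negligible[OF order_refl N2(1)])
      (auto simp: differentiable_on_def intro!: derivative_intros)
  ultimately show ?thesis using N1(1) by (meson negligible_Un negligible_subset)
qed

text \<open>Fubini's theorem for lines in an arbitrary direction: integrate the measure of the translates \<open>E - t v\<close> over
  \<open>t \<in> [0,1]\<close> and exchange the integrals.\<close>
lemma negligible_if_negligible_on_lines:
  fixes E :: "'a::euclidean_space set" and v :: 'a
  assumes E: "E \<in> sets borel"
    and lines: "\<And>x. negligible {t::real. x + t *\<^sub>R v \<in> E}"
  shows "negligible E"
proof -
  define f where "f t x = (indicator {0..1::real} t * indicator E (x + t *\<^sub>R v) :: ennreal)" for t x
  have [measurable]: "(\<lambda>(t, x). f t x) \<in> borel_measurable (lborel \<Otimes>\<^sub>M lborel)"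
    unfolding f_def using E by measurable
  have shift: "(\<integral>\<^sup>+x. indicator E (x + t *\<^sub>R v) \<partial>lborel) = emeasure lborel E" for t :: real
  proof -
    have "(\<integral>\<^sup>+x. indicator E (x + t *\<^sub>R v) \<partial>lborel)
        = (\<integral>\<^sup>+x. indicator E x \<partial>distr lborel borel (\<lambda>x. t *\<^sub>R v + x))"
      using E by (subst nn_integral_distr) (auto simp: add.commute)
    also have "distr lborel borel (\<lambda>x. t *\<^sub>R v + x) = (lborel :: 'a measure)"
      by (rule lborel_distr_plus)
    finally show ?thesis using E by simp
  qed
  have "emeasure lborel E = (\<integral>\<^sup>+t. indicator {0..1::real} t * emeasure lborel E \<partial>lborel)"
    by (simp add: nn_integral_multc)
  also have "\<dots> = (\<integral>\<^sup>+t. (\<integral>\<^sup>+x. f t x \<partial>lborel) \<partial>lborel)"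
    unfolding f_def using E by (subst nn_integral_cmult) (auto simp: shift)
  also have "\<dots> = (\<integral>\<^sup>+x. (\<integral>\<^sup>+t. f t x \<partial>lborel) \<partial>lborel)"
    by (rule lborel_pair.Fubini'[symmetric]) measurable
  also have "\<dots> = (\<integral>\<^sup>+(x::'a). 0 \<partial>lborel)"
  proof (rule nn_integral_cong)
    fix x :: 'a
    have "{t. x + t *\<^sub>R v \<in> E} \<in> sets lborel"
      using measurable_sets[of "\<lambda>t. x + t *\<^sub>R v" "borel :: real measure" borel E] E
      by (simp add: vimage_def)
    then have "{t. x + t *\<^sub>R v \<in> E} \<in> null_sets lborel"
      using lines[of x] by (metis negligible_iff_null_sets null_sets_completion_iff)
    then have "AE t in lborel. t \<notin> {t. x + t *\<^sub>R v \<in> E}" by (rule AE_not_in)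
    then have "(\<integral>\<^sup>+t. f t x \<partial>lborel) = (\<integral>\<^sup>+(t::real). 0 \<partial>lborel)"
      by (intro nn_integral_cong_AE) (auto simp: f_def)
    then show "(\<integral>\<^sup>+t. f t x \<partial>lborel) = 0" by simp
  qed
  finally have "emeasure lborel E = 0" by simp
  then have "E \<in> null_sets lborel" using E by (intro null_setsI) auto
  then show ?thesis by (simp add: negligible_iff_null_sets null_sets_completionI)
qed

text \<open>The reflections in coordinate hyperplanes carry the positive orthant to any other one.\<close>
definition flip :: "'a set \<Rightarrow> 'a::euclidean_space \<Rightarrow> 'a" where
  "flip B x = (\<Sum>i\<in>Basis. (if i \<in> B then - (x \<bullet> i) else x \<bullet> i) *\<^sub>R i)"

lemma flip_inner: "i \<in> Basis \<Longrightarrow> flip B x \<bullet> i = (if i \<in> B then - (x \<bullet> i) else x \<bullet> i)"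
  by (simp add: flip_def)

lemma flip_flip [simp]: "flip B (flip B x) = x"
  by (rule euclidean_eqI) (simp add: flip_inner)

lemma linear_flip: "linear (flip B)"
  by (rule linearI; rule euclidean_eqI) (simp_all add: flip_inner inner_add_left)

lemma norm_flip: "norm (flip B x) = norm x"
  by (simp add: norm_eq_sqrt_inner euclidean_inner[of x x] euclidean_inner[of "flip B x" "flip B x"] flip_inner)
    (intro sum.cong refl, auto)

lemma closed_flip_image: "closed S \<Longrightarrow> closed (flip B ` S)"
proof -
  assume "closed S"
  have "flip B ` S = flip B -` S" by force
  moreover have "continuous_on UNIV (flip B)" by (simp add: linear_continuous_on linear_flip linear_linear)
  ultimately show ?thesis using \<open>closed S\<close> by (simp add: continuous_closed_vimage linear_flip linear_linear linear_continuous_at)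
qed

text \<open>Almost every point of \<open>S\<close> is a density point with respect to cubes having it as lowest corner. If a cube of side
  \<open>\<eta> d\<close> contained in such a cube of side \<open>(1 + \<eta>) d\<close> missed \<open>S\<close>, the density at this scale would be bounded away from 1.\<close>
lemma corner_cube_hits_closed_set:
  fixes S :: "'a::euclidean_space set"
  assumes S: "closed S"
  obtains N where "negligible N"
    "\<And>x \<eta>. x \<in> S - N \<Longrightarrow> \<eta> > 0 \<Longrightarrow>
        \<exists>d0>0. \<forall>d y. 0 < d \<and> d < d0 \<and> y \<in> cbox x (x + d *\<^sub>R One) \<longrightarrow> S \<inter> cbox y (y + (\<eta> * d) *\<^sub>R One) \<noteq> {}"
proof -
  let ?f = "indicat_real S"
  have i: "?f integrable_on cbox a b" for a b
  proof -
    have "S \<inter> cbox a b \<in> lmeasurable" using S by (intro lmeasurable_compact) auto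
    then show ?thesis by (simp add: integrable_on_indicator)
  qed
  obtain N where N: "negligible N" "\<And>x e. \<lbrakk>x \<notin> N; 0 < e\<rbrakk> \<Longrightarrow>
      \<exists>d>0. \<forall>h. 0 < h \<and> h < d \<longrightarrow>
         norm(integral (cbox x (x + h *\<^sub>R One)) ?f /\<^sub>R h ^ DIM('a) - ?f x) < e"
    using integrable_ccontinuous_explicit[OF i] by blast
  have meas: "measure lborel (cbox z (z + r *\<^sub>R One)) = r ^ DIM('a)" if "r \<ge> 0" for z :: 'a and r
    using that content_cbox[of z "z + r *\<^sub>R One"] by (simp add: inner_add_left)
  show ?thesis
  proof (rule that[OF N(1)])
    fix x \<eta> assume x: "x \<in> S - N" and eta: "\<eta> > (0::real)"
    \<comment> \<open>the proportion of the volume of the large cube that the small one occupies\<close>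
    define e where "e = (\<eta> / (1 + \<eta>)) ^ DIM('a)"
    have e: "e > 0" using eta by (simp add: e_def)
    obtain d where d: "d > 0" "\<And>h. 0 < h \<and> h < d \<Longrightarrow>
         norm(integral (cbox x (x + h *\<^sub>R One)) ?f /\<^sub>R h ^ DIM('a) - ?f x) < e"
      using N(2)[of x e] x e by auto
    have "S \<inter> cbox y (y + (\<eta> * c) *\<^sub>R One) \<noteq> {}"
      if c: "0 < c" "c < d / (1 + \<eta>)" and y: "y \<in> cbox x (x + c *\<^sub>R One)" for c y
    proof
      assume empty: "S \<inter> cbox y (y + (\<eta> * c) *\<^sub>R One) = {}"
      define h where "h = (1 + \<eta>) * c"
      have h: "0 < h" "h < d" using c eta by (auto simp: h_def field_simps intro: add_pos_pos)
      let ?Q = "cbox x (x + h *\<^sub>R One)" and ?q = "cbox y (y + (\<eta> * c) *\<^sub>R One)"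
      have sub: "?q \<subseteq> ?Q"
        unfolding subset_box using y eta c
        by (auto simp: mem_box inner_add_left h_def algebra_simps)
      have "integral ?Q ?f \<le> integral ?Q (indicat_real (?Q - ?q))"
      proof (rule integral_le[OF i])
        have "?Q - ?q \<in> lmeasurable" by (intro fmeasurable.Diff) auto
        then show "indicat_real (?Q - ?q) integrable_on ?Q"
          using integrable_on_indicator[of "?Q - ?q" ?Q] by (simp add: Int_absorb2)
      qed (use empty in \<open>auto simp: indicator_def\<close>)
      also have "\<dots> = measure lebesgue (?Q - ?q)"
        using integral_indicator[of "?Q - ?q" ?Q] fmeasurable.Diff[of ?Q lebesgue ?q]
        by (simp add: Int_absorb2)
      also have "\<dots> = h ^ DIM('a) - (\<eta> * c) ^ DIM('a)"
        using sub h eta c by (subst measurable_measure_Diff) (auto simp: meas)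
      also have "\<eta> * c = \<eta> / (1 + \<eta>) * h" using eta by (simp add: h_def)
      also have "h ^ DIM('a) - \<dots> ^ DIM('a) = (1 - e) * h ^ DIM('a)"
        unfolding e_def power_mult_distrib left_diff_distrib by simp
      finally have "integral ?Q ?f /\<^sub>R h ^ DIM('a) \<le> 1 - e" using h by (simp add: field_simps)
      moreover have "\<bar>integral ?Q ?f /\<^sub>R h ^ DIM('a) - 1\<bar> < e" using d(2)[of h] h x by simp
      ultimately show False by linarith
    qed
    then show "\<exists>d0>0. \<forall>d y. 0 < d \<and> d < d0 \<and> y \<in> cbox x (x + d *\<^sub>R One) \<longrightarrow> S \<inter> cbox y (y + (\<eta> * d) *\<^sub>R One) \<noteq> {}"
      using d(1) eta by (intro exI[of _ "d / (1 + \<eta>)"]) auto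
  qed
qed

text \<open>Every point near \<open>x\<close> lies in one of the orthants with apex \<open>x\<close>, so the preceding lemma is applied to all images of \<open>S\<close>
  under coordinate reflections.\<close>
lemma closed_set_AE_not_porous:
  fixes S :: "'a::euclidean_space set"
  assumes S: "closed S"
  obtains N where "negligible N"
    "\<And>x \<eta>. x \<in> S - N \<Longrightarrow> \<eta> > 0 \<Longrightarrow>
        \<exists>d0>0. \<forall>y. dist x y < d0 \<longrightarrow> (\<exists>z\<in>S. dist y z \<le> \<eta> * dist x y)"
proof -
  have "\<exists>N. negligible N \<and> (\<forall>x \<eta>. x \<in> flip B ` S - N \<longrightarrow> \<eta> > 0 \<longrightarrow>
      (\<exists>d0>0. \<forall>d y. 0 < d \<and> d < d0 \<and> y \<in> cbox x (x + d *\<^sub>R One) \<longrightarrow> flip B ` S \<inter> cbox y (y + (\<eta> * d) *\<^sub>R One) \<noteq> {}))" for B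
    by (rule corner_cube_hits_closed_set[OF closed_flip_image[OF S, of B]]) metis
  then obtain N where N: "\<And>B. negligible (N B)"
    "\<And>B x \<eta>. x \<in> flip B ` S - N B \<Longrightarrow> \<eta> > 0 \<Longrightarrow>
      \<exists>d0>0. \<forall>d y. 0 < d \<and> d < d0 \<and> y \<in> cbox x (x + d *\<^sub>R One) \<longrightarrow> flip B ` S \<inter> cbox y (y + (\<eta> * d) *\<^sub>R One) \<noteq> {}"
    by metis
  define M where "M = (\<Union>B\<in>Pow Basis. flip B ` N B)"
  have negM: "negligible M"
    unfolding M_def
  proof (rule negligible_Union)
    fix T assume "T \<in> (\<lambda>B. flip B ` N B) ` Pow Basis"
    then obtain B where T: "T = flip B ` N B" by blast
    show "negligible T" unfolding T
      by (rule negligible_differentiable_image_negligible[OF order_refl N(1)])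
        (simp add: differentiable_on_def linear_imp_differentiable linear_flip differentiable_at_withinI)
  qed auto
  show ?thesis
  proof (rule that[OF negM])
    fix x and \<eta> :: real assume x: "x \<in> S - M" and eta: "\<eta> > 0"
    define n where "n = real DIM('a)"
    have n: "n > 0" by (simp add: n_def)
    have "\<exists>d0>0. \<forall>d y. 0 < d \<and> d < d0 \<and> y \<in> cbox (flip B x) (flip B x + d *\<^sub>R One) \<longrightarrow>
        flip B ` S \<inter> cbox y (y + (\<eta>/n * d) *\<^sub>R One) \<noteq> {}" if "B \<subseteq> Basis" for B
    proof (rule N(2))
      have "flip B x \<notin> N B" using x that by (force simp: M_def intro: rev_image_eqI)
      then show "flip B x \<in> flip B ` S - N B" using x by auto
    qed (use eta n in auto)
    then obtain D where D: "\<And>B. B \<subseteq> Basis \<Longrightarrow> D B > 0"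
      "\<And>B d y. \<lbrakk>B \<subseteq> Basis; 0 < d; d < D B; y \<in> cbox (flip B x) (flip B x + d *\<^sub>R One)\<rbrakk> \<Longrightarrow>
        flip B ` S \<inter> cbox y (y + (\<eta>/n * d) *\<^sub>R One) \<noteq> {}"
      by metis
    define d0 where "d0 = Min (D ` Pow Basis)"
    have d0: "d0 > 0" "\<And>B. B \<subseteq> Basis \<Longrightarrow> d0 \<le> D B"
      using D(1) unfolding d0_def by (subst Min_gr_iff) (auto intro!: Min_le)
    have "\<exists>z\<in>S. dist y z \<le> \<eta> * dist x y" if y: "dist x y < d0" for y
    proof (cases "y = x")
      case True then show ?thesis using x by auto
    next
      case False
      define d where "d = dist x y"
      have d: "0 < d" "d < d0" using y False by (auto simp: d_def)
      define B where "B = {i\<in>Basis. (y - x) \<bullet> i < 0}"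
      have B: "B \<subseteq> Basis" by (auto simp: B_def)
      have "flip B y \<in> cbox (flip B x) (flip B x + d *\<^sub>R One)"
      proof -
        have "\<bar>(y - x) \<bullet> i\<bar> \<le> d" if "i \<in> Basis" for i
          using Basis_le_norm[OF that, of "y - x"] by (simp add: d_def dist_norm norm_minus_commute)
        then show ?thesis
          unfolding mem_box by (auto simp: flip_inner B_def inner_add_left inner_diff_left split: if_splits) fastforce+
      qed
      then obtain z where z: "z \<in> S" "flip B z \<in> cbox (flip B y) (flip B y + (\<eta>/n * d) *\<^sub>R One)"
        using D(2)[OF B d(1)] d0(2)[OF B] d(2) by fastforce
      have "norm (z - y) = norm (flip B z - flip B y)"
        by (metis linear_diff linear_flip norm_flip)
      also have "\<dots> \<le> (\<Sum>i\<in>Basis. \<bar>(flip B z - flip B y) \<bullet> i\<bar>)" by (rule norm_le_l1)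
      also have "\<dots> \<le> (\<Sum>i\<in>(Basis::'a set). \<eta>/n * d)"
        using z(2) by (intro sum_mono) (auto simp: mem_box inner_diff_left inner_add_left)
      also have "\<dots> = \<eta> * d" using n by (simp add: n_def)
      finally show ?thesis using z(1) by (auto simp: d_def dist_norm norm_minus_commute)
    qed
    then show "\<exists>d0>0. \<forall>y. dist x y < d0 \<longrightarrow> (\<exists>z\<in>S. dist y z \<le> \<eta> * dist x y)"
      using d0(1) by blast
  qed
qed

text \<open>The linear forms belonging to the errors \<open>e = 1/(m + 1)\<close> form a Cauchy sequence, and its limit is the gradient.\<close>
lemma differentiable_if_approximately_linear:
  fixes f :: "'a::euclidean_space \<Rightarrow> real"
  assumes "\<And>e. e > 0 \<Longrightarrow> \<exists>v d. d > 0 \<and> (\<forall>h. norm h < d \<longrightarrow> \<bar>f (x + h) - f x - v \<bullet> h\<bar> \<le> e * norm h)"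
  shows "f differentiable (at x)"
proof -
  have "\<forall>m. \<exists>v d. d > 0 \<and> (\<forall>h. norm h < d \<longrightarrow> \<bar>f (x + h) - f x - v \<bullet> h\<bar> \<le> 1 / real (Suc m) * norm h)"
    by (intro allI assms) simp
  then obtain v d where d: "\<And>m. d m > 0"
    and v: "\<And>m h. norm h < d m \<Longrightarrow> \<bar>f (x + h) - f x - v m \<bullet> h\<bar> \<le> 1 / real (Suc m) * norm h"
    by metis
  have vv: "norm (v m - v l) \<le> 1 / real (Suc m) + 1 / real (Suc l)" for m l
  proof (cases "v m = v l")
    case False
    define z where "z = v m - v l"
    have z: "norm z > 0" using False by (simp add: z_def)
    define t where "t = min (d m) (d l) / (2 * norm z)"
    have t: "t > 0" "norm (t *\<^sub>R z) < d m" "norm (t *\<^sub>R z) < d l" using d[of m] d[of l] z by (auto simp: t_def)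
    have "\<bar>v m \<bullet> (t *\<^sub>R z) - v l \<bullet> (t *\<^sub>R z)\<bar> \<le> (1 / real (Suc m) + 1 / real (Suc l)) * norm (t *\<^sub>R z)"
      using v[OF t(2)] v[OF t(3)] unfolding distrib_right by linarith
    moreover have "v m = v l + z" by (simp add: z_def)
    then have "v m \<bullet> (t *\<^sub>R z) - v l \<bullet> (t *\<^sub>R z) = (t * norm z) * norm z"
      by (simp add: inner_add_left distrib_left power2_norm_eq_inner[symmetric] power2_eq_square)
    ultimately have "(t * norm z) * norm z \<le> (t * norm z) * (1 / real (Suc m) + 1 / real (Suc l))"
      using t(1) by (simp add: mult.commute)
    then show ?thesis using t(1) z by (simp add: z_def)
  qed auto
  have small: "1 / real (Suc m) \<le> 1 / real (Suc M)" if "M \<le> m" for m M using that by (simp add: frac_le)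
  have "Cauchy v"
  proof (rule metric_CauchyI)
    fix e :: real assume "e > 0"
    then obtain M where M: "1 / real (Suc M) < e / 2" by (meson half_gt_zero nat_approx_posE)
    have "dist (v m) (v l) < e" if "m \<ge> M" "l \<ge> M" for m l
      using vv[of m l] small[OF that(1)] small[OF that(2)] M unfolding dist_norm by linarith
    then show "\<exists>M. \<forall>m\<ge>M. \<forall>n\<ge>M. dist (v m) (v n) < e" by blast
  qed
  then obtain p where p: "v \<longlonglongrightarrow> p" using Cauchy_convergent convergent_def by blast
  have vp: "norm (v m - p) \<le> 2 / real (Suc m)" for m
  proof (rule tendsto_upperbound)
    show "(\<lambda>l. norm (v m - v l)) \<longlonglongrightarrow> norm (v m - p)" by (intro tendsto_intros p)
    show "\<forall>\<^sub>F l in sequentially. norm (v m - v l) \<le> 2 / real (Suc m)"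
      unfolding eventually_sequentially
    proof (intro exI[of _ m] allI impI)
      fix l assume "m \<le> l"
      from vv[of m l] small[OF this] show "norm (v m - v l) \<le> 2 / real (Suc m)" by simp
    qed
  qed auto
  have "(f has_derivative (\<lambda>h. p \<bullet> h)) (at x)"
    unfolding has_derivative_at_alt
  proof (intro conjI allI impI bounded_linear_inner_right)
    fix e :: real assume "e > 0"
    then obtain m where m: "1 / real (Suc m) < e / 3" by (meson divide_pos_pos nat_approx_posE zero_less_numeral)
    have "\<bar>f (x + h) - f x - p \<bullet> h\<bar> \<le> e * norm h" if h: "norm h < d m" for h
    proof -
      have "\<bar>(v m - p) \<bullet> h\<bar> \<le> 2 / real (Suc m) * norm h"
        by (rule order_trans[OF Cauchy_Schwarz_ineq2 mult_right_mono[OF vp norm_ge_zero]])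
      then have "\<bar>f (x + h) - f x - p \<bullet> h\<bar> \<le> 1 / real (Suc m) * norm h + 2 / real (Suc m) * norm h"
        using v[OF h] unfolding inner_diff_left by linarith
      also have "\<dots> = 3 * (1 / real (Suc m)) * norm h" by simp
      also have "\<dots> \<le> e * norm h" using m by (intro mult_right_mono) auto
      finally show ?thesis .
    qed
    from this[of "_ - x"] show "\<exists>d>0. \<forall>y. norm (y - x) < d \<longrightarrow> norm (f y - f x - p \<bullet> (y - x)) \<le> e * norm (y - x)"
      using d[of m] by (intro exI[of _ "d m"]) auto
  qed
  then show ?thesis by (rule differentiableI)
qed

text \<open>Rademacher's theorem. Almost everywhere the partial derivatives exist. Sort the points into countably many closed sets on which
  all partial difference quotients are, up to a common scale, close to those of a fixed linear form. At a point where such a set is not porous, an increment \<open>h\<close>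
  can be performed one coordinate at a time, each step starting, up to an error \<open>o(\<bar>h\<bar>)\<close>, from a point
  of the same set, where the increment is controlled.\<close>
lemma lipschitz_AE_differentiable:
  fixes f :: "'a::euclidean_space \<Rightarrow> real"
  assumes lip: "L-lipschitz_on UNIV f"
  shows "negligible {x. \<not> f differentiable (at x)}"
proof -
  have L: "L \<ge> 0" and fl: "\<And>x y. \<bar>f x - f y\<bar> \<le> L * dist x y"
    using lip lipschitz_on_nonneg lipschitz_onD[OF lip] by (auto simp: dist_real_def)
  have fc: "continuous_on UNIV f" by (rule lipschitz_on_continuous_on[OF lip])
  obtain V :: "'a set" where V: "countable V" "\<And>X. open X \<Longrightarrow> X \<noteq> {} \<Longrightarrow> \<exists>d\<in>V. d \<in> X"
    using countable_dense_setE by metis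
  \<comment> \<open>points where, up to the scale \<open>1/(k + 1)\<close>, the increments in direction \<open>i\<close> are \<open>1/(m + 1)\<close>-close to those of the linear form \<open>v\<close>\<close>
  define S1 where "S1 i v k m = {x. \<forall>t. \<bar>t\<bar> \<le> 1 / real (Suc k) \<longrightarrow>
      \<bar>f (x + t *\<^sub>R i) - f x - t * (v \<bullet> i)\<bar> \<le> \<bar>t\<bar> / real (Suc m)}" for i v :: 'a and k m :: nat
  define S where "S v k m = (\<Inter>i\<in>Basis. S1 i v k m)" for v k m
  have cl1: "closed (S1 i v k m)" for i v k m
  proof -
    have "S1 i v k m = (\<Inter>t\<in>{t. \<bar>t\<bar> \<le> 1 / real (Suc k)}.
        {x. \<bar>f (x + t *\<^sub>R i) - f x - t * (v \<bullet> i)\<bar> \<le> \<bar>t\<bar> / real (Suc m)})"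
      by (auto simp: S1_def)
    also have "closed \<dots>"
      using fc by (intro closed_INT ballI closed_Collect_le continuous_intros)
        (auto intro!: continuous_intros continuous_on_compose2[OF fc])
    finally show ?thesis .
  qed
  then have clS: "closed (S v k m)" for v k m unfolding S_def by auto
  have "\<exists>N. negligible N \<and> (\<forall>x \<eta>. x \<in> S v k m - N \<longrightarrow> \<eta> > 0 \<longrightarrow>
        (\<exists>d0>0. \<forall>y. dist x y < d0 \<longrightarrow> (\<exists>z\<in>S v k m. dist y z \<le> \<eta> * dist x y)))" for v k m
    by (rule closed_set_AE_not_porous[OF clS[of v k m]]) metis
  then obtain N where N: "\<And>v k m. negligible (N v k m)"
    "\<And>v k m x \<eta>. x \<in> S v k m - N v k m \<Longrightarrow> \<eta> > 0 \<Longrightarrow>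
        \<exists>d0>0. \<forall>y. dist x y < d0 \<longrightarrow> (\<exists>z\<in>S v k m. dist y z \<le> \<eta> * dist x y)"
    by metis
  \<comment> \<open>the complement contains all points where the partial derivative in direction \<open>i\<close> exists\<close>
  define E where "E i = - (\<Inter>m. \<Union>v\<in>V. \<Union>k. S1 i v k m)" for i
  have negE: "negligible (E i)" if i: "i \<in> Basis" for i
  proof (rule negligible_if_negligible_on_lines)
    have "(\<Inter>m. \<Union>v\<in>V. \<Union>k. S1 i v k m) \<in> sets borel"
      using V(1) cl1 by (intro sets.countable_INT sets.countable_UN' sets.countable_UN) (auto intro: borel_closed)
    then show "E i \<in> sets borel" unfolding E_def by (rule borel_comp)
    fix x
    have "L-lipschitz_on UNIV (\<lambda>t. f (x + t *\<^sub>R i))"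
      using fl[of "x + _ *\<^sub>R i" "x + _ *\<^sub>R i"] L i
      by (intro lipschitz_onI) (auto simp: dist_real_def dist_norm scaleR_left_diff_distrib[symmetric])
    then have "negligible {t. \<not> (\<lambda>t. f (x + t *\<^sub>R i)) differentiable (at t)}"
      by (rule lipschitz_real_AE_differentiable)
    moreover have "x + s *\<^sub>R i \<notin> E i" if df: "(\<lambda>t. f (x + t *\<^sub>R i)) differentiable (at s)" for s
    proof -
      obtain p where "((\<lambda>t. f (x + t *\<^sub>R i)) has_real_derivative p) (at s)"
        using df unfolding real_differentiable_def by blast
      then have p: "((\<lambda>t. f (x + t *\<^sub>R i)) has_derivative (\<lambda>h. h * p)) (at s)"
        by (simp only: has_field_derivative_def mult_commute_abs)
      have "\<exists>v\<in>V. \<exists>k. x + s *\<^sub>R i \<in> S1 i v k m" for m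
      proof -
        define e where "e = 1 / (2 * real (Suc m))"
        have e: "e > 0" "e + e = 1 / real (Suc m)" by (auto simp: e_def field_simps)
        obtain v where v: "v \<in> V" "dist (p *\<^sub>R i) v < e"
          using V(2)[of "ball (p *\<^sub>R i) e"] e by (auto simp: mem_ball)
        have vp: "\<bar>p - v \<bullet> i\<bar> \<le> e"
          using Basis_le_norm[OF i, of "p *\<^sub>R i - v"] v(2) i by (simp add: dist_norm inner_diff_left)
        obtain d where d: "d > 0" "\<And>y. \<bar>y - s\<bar> < d \<Longrightarrow> \<bar>f (x + y *\<^sub>R i) - f (x + s *\<^sub>R i) - (y - s) * p\<bar> \<le> e * \<bar>y - s\<bar>"
          using p e unfolding has_derivative_at_alt by auto
        obtain k where k: "1 / real (Suc k) < d" using d(1) by (meson nat_approx_posE)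
        have "\<bar>f (x + s *\<^sub>R i + t *\<^sub>R i) - f (x + s *\<^sub>R i) - t * (v \<bullet> i)\<bar> \<le> \<bar>t\<bar> / real (Suc m)"
          if "\<bar>t\<bar> \<le> 1 / real (Suc k)" for t
        proof -
          have "\<bar>f (x + s *\<^sub>R i + t *\<^sub>R i) - f (x + s *\<^sub>R i) - t * p\<bar> \<le> e * \<bar>t\<bar>"
            using d(2)[of "s + t"] k that by (simp add: scaleR_add_left add.assoc)
          moreover have "\<bar>t * p - t * (v \<bullet> i)\<bar> \<le> e * \<bar>t\<bar>"
            using mult_right_mono[OF vp abs_ge_zero[of t]] by (metis abs_mult mult.commute right_diff_distrib)
          moreover have "e * \<bar>t\<bar> + e * \<bar>t\<bar> = \<bar>t\<bar> / real (Suc m)" unfolding distrib_right[symmetric] e(2) by simp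
          ultimately show ?thesis by linarith
        qed
        then show ?thesis using v(1) by (auto simp: S1_def)
      qed
      then show ?thesis by (simp add: E_def)
    qed
    then have "{t. x + t *\<^sub>R i \<in> E i} \<subseteq> {t. \<not> (\<lambda>t. f (x + t *\<^sub>R i)) differentiable (at t)}" by blast
    ultimately show "negligible {t. x + t *\<^sub>R i \<in> E i}" by (rule negligible_subset)
  qed
  define Z where "Z = (\<Union>i\<in>Basis. E i) \<union> (\<Union>v\<in>V. \<Union>k. \<Union>m. N v k m)"
  have "negligible Z"
    unfolding Z_def
    by (intro negligible_Un negligible_Union negligible_countable_Union)
      (use negE V(1) N(1) in \<open>auto intro!: negligible_countable_Union\<close>)
  moreover have "f differentiable (at x)" if x: "x \<notin> Z" for x
  proof (rule differentiable_if_approximately_linear)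
    define n where "n = real DIM('a)"
    have n: "n > 0" by (simp add: n_def)
    fix e :: real assume e: "e > 0"
    have C: "n * (1 + 2 * L) > 0" using n L by (simp add: add_pos_nonneg)
    then obtain m where m: "1 / real (Suc m) < e / (n * (1 + 2 * L))" using e by (metis divide_pos_pos nat_approx_posE)
    define r where "r = 1 / real (Suc m)"
    have r: "r > 0" "n * (1 + 2 * L) * r \<le> e"
      using m C unfolding r_def by (simp_all add: pos_less_divide_eq mult.commute less_imp_le)
    have "\<exists>v\<in>V. \<exists>k. x \<in> S v k m"
    proof -
      have "\<forall>i\<in>Basis. x \<notin> E i" using x by (simp add: Z_def)
      then have "\<forall>i\<in>Basis. \<exists>v k. x \<in> S1 i v k (2 * m + 1)" unfolding E_def by blast
      then obtain vi ki where vk: "\<And>i. i \<in> Basis \<Longrightarrow> x \<in> S1 i (vi i) (ki i) (2 * m + 1)" by metis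
      define g where "g = (\<Sum>i\<in>Basis. (vi i \<bullet> i) *\<^sub>R i)"
      define k where "k = Max (ki ` Basis)"
      obtain v where v: "v \<in> V" "dist g v < r/2" using V(2)[of "ball g (r/2)"] r by (auto simp: mem_ball)
      have "x \<in> S1 i v k m" if i: "i \<in> Basis" for i
        unfolding S1_def
      proof clarify
        fix t :: real assume t: "\<bar>t\<bar> \<le> 1 / real (Suc k)"
        have "ki i \<le> k" using i by (simp add: k_def)
        then have "1 / real (Suc k) \<le> 1 / real (Suc (ki i))" by (simp add: frac_le)
        then have "\<bar>f (x + t *\<^sub>R i) - f x - t * (vi i \<bullet> i)\<bar> \<le> \<bar>t\<bar> / real (Suc (2 * m + 1))"
          using vk[OF i] t by (auto simp: S1_def)
        moreover have "real (Suc (2 * m + 1)) = 2 * real (Suc m)" by simp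
        then have "\<bar>t\<bar> / real (Suc (2 * m + 1)) = r/2 * \<bar>t\<bar>"
          unfolding r_def by (simp only:) (simp del: of_nat_Suc)
        moreover have vp: "\<bar>vi i \<bullet> i - v \<bullet> i\<bar> \<le> r/2"
          using Basis_le_norm[OF i, of "g - v"] v(2) i by (simp add: dist_norm inner_diff_left g_def)
        then have "\<bar>t * (vi i \<bullet> i) - t * (v \<bullet> i)\<bar> \<le> r/2 * \<bar>t\<bar>"
          using mult_right_mono[OF vp abs_ge_zero[of t]] by (metis abs_mult mult.commute right_diff_distrib)
        moreover have "r/2 * \<bar>t\<bar> + r/2 * \<bar>t\<bar> = \<bar>t\<bar> / real (Suc m)" by (simp add: r_def del: of_nat_Suc)
        ultimately show "\<bar>f (x + t *\<^sub>R i) - f x - t * (v \<bullet> i)\<bar> \<le> \<bar>t\<bar> / real (Suc m)" by linarith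
      qed
      then show ?thesis using v(1) by (auto simp: S_def)
    qed
    then obtain v k where v: "v \<in> V" and xS: "x \<in> S v k m" by blast
    have "x \<in> S v k m - N v k m" using x v xS by (auto simp: Z_def)
    from N(2)[OF this r(1)] obtain d0 where d0: "d0 > 0"
      "\<And>y. dist x y < d0 \<Longrightarrow> \<exists>z\<in>S v k m. dist y z \<le> r * dist x y" by blast
    have Sd: "\<bar>f (z + t *\<^sub>R i) - f z - t * (v \<bullet> i)\<bar> \<le> r * \<bar>t\<bar>"
      if "z \<in> S v k m" "i \<in> Basis" "\<bar>t\<bar> \<le> 1 / real (Suc k)" for z t i
      using that by (auto simp: S_def S1_def r_def)
    have main: "\<bar>f (x + h) - f x - v \<bullet> h\<bar> \<le> e * norm h" if h: "norm h < min d0 (1 / real (Suc k))" for h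
    proof -
      define hA where "hA A = (\<Sum>i\<in>A. (h \<bullet> i) *\<^sub>R i)" for A
      have nh: "norm (hA A) \<le> norm h" if "A \<subseteq> Basis" for A
      proof -
        have "(norm (hA A))\<^sup>2 = (\<Sum>i\<in>A. (h \<bullet> i)\<^sup>2)"
          unfolding hA_def using that finite_subset[OF that]
          by (subst norm_sum_Pythagorean)
            (auto simp: pairwise_def orthogonal_def power2_eq_square intro!: sum.cong,
             metis inner_not_same_Basis subsetD)
        also have "\<dots> \<le> (\<Sum>i\<in>Basis. (h \<bullet> i)\<^sup>2)" using that by (intro sum_mono2) auto
        also have "\<dots> = (norm h)\<^sup>2"
          by (subst power2_norm_eq_inner, subst euclidean_inner[of h h]) (simp add: power2_eq_square)
        finally show ?thesis by (rule power2_le_imp_le) simp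
      qed
      have ind: "\<bar>f (x + hA A) - f x - v \<bullet> hA A\<bar> \<le> real (card A) * ((1 + 2 * L) * r * norm h)"
        if "finite A" "A \<subseteq> Basis" for A
        using that
      proof (induction A)
        case empty then show ?case by (simp add: hA_def)
      next
        case (insert j A)
        have j: "j \<in> Basis" and A: "A \<subseteq> Basis" using insert by auto
        define y where "y = x + hA A"
        have y: "dist x y \<le> norm h" using nh[OF A] by (simp add: y_def dist_norm)
        then obtain z where z: "z \<in> S v k m" "dist y z \<le> r * dist x y" using d0(2)[of y] h by auto
        have yz: "dist y z \<le> r * norm h" using z(2) y r(1) by (meson mult_left_mono less_imp_le order_trans)
        define t where "t = h \<bullet> j"
        have t: "\<bar>t\<bar> \<le> norm h" using Basis_le_norm[OF j, of h] by (simp add: t_def)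
        have "\<bar>f (z + t *\<^sub>R j) - f z - t * (v \<bullet> j)\<bar> \<le> r * \<bar>t\<bar>" using Sd[OF z(1) j, of t] t h by simp
        moreover have "r * \<bar>t\<bar> \<le> r * norm h" using t r by simp
        moreover have "\<bar>f y - f z\<bar> \<le> L * (r * norm h)"
          using fl[of y z] mult_left_mono[OF yz L] by linarith
        moreover have "\<bar>f (y + t *\<^sub>R j) - f (z + t *\<^sub>R j)\<bar> \<le> L * (r * norm h)"
          using fl[of "y + t *\<^sub>R j" "z + t *\<^sub>R j"] mult_left_mono[OF yz L] by simp
        moreover have "(1 + 2 * L) * r * norm h = r * norm h + 2 * (L * (r * norm h))"
          by (simp add: distrib_right)
        ultimately have "\<bar>f (y + t *\<^sub>R j) - f y - t * (v \<bullet> j)\<bar> \<le> (1 + 2 * L) * r * norm h"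
          by linarith
        moreover have "\<bar>f y - f x - v \<bullet> hA A\<bar> \<le> real (card A) * ((1 + 2 * L) * r * norm h)"
          using insert A by (simp add: y_def)
        moreover have "real (card (insert j A)) * ((1 + 2 * L) * r * norm h)
            = real (card A) * ((1 + 2 * L) * r * norm h) + (1 + 2 * L) * r * norm h"
          using insert(1,2) by (simp add: distrib_right)
        moreover have "f (x + hA (insert j A)) - f x - v \<bullet> hA (insert j A)
            = (f (y + t *\<^sub>R j) - f y - t * (v \<bullet> j)) + (f y - f x - v \<bullet> hA A)"
        proof -
          have "hA (insert j A) = t *\<^sub>R j + hA A" using insert by (simp add: hA_def t_def)
          then show ?thesis by (simp add: y_def inner_add_right add.assoc add.commute[of "hA A"])
        qed
        ultimately show ?case by linarith
      qed
      have hB: "hA Basis = h" by (simp add: hA_def euclidean_representation)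
      have "\<bar>f (x + h) - f x - v \<bullet> h\<bar> \<le> n * ((1 + 2 * L) * r * norm h)"
        using ind[of Basis] by (simp add: hB n_def)
      also have "\<dots> = n * (1 + 2 * L) * r * norm h" by (simp add: mult.assoc)
      also have "\<dots> \<le> e * norm h" using r(2) by (intro mult_right_mono) auto
      finally show ?thesis .
    qed
    then show "\<exists>v d. d > 0 \<and> (\<forall>h. norm h < d \<longrightarrow> \<bar>f (x + h) - f x - v \<bullet> h\<bar> \<le> e * norm h)"
      using d0(1) by (intro exI[of _ v] exI[of _ "min d0 (1 / real (Suc k))"]) auto
  qed
  ultimately show ?thesis by (metis (mono_tags, lifting) mem_Collect_eq negligible_subset subsetI)
qed

section \<open>Pointwise Lipschitz maps and contact points\<close>

text \<open>The estimate is required only between \<open>x\<close> and nearby points, not between two nearby points. In this form it follows from differentiability,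
  is stable under products and compositions, and still implies that null sets are mapped to null sets.\<close>
definition lip_at :: "('a::real_normed_vector \<Rightarrow> 'b::real_normed_vector) \<Rightarrow> 'a \<Rightarrow> bool" where
  "lip_at g x \<longleftrightarrow> (\<exists>B. \<forall>\<^sub>F y in nhds x. norm (g y - g x) \<le> B * norm (y - x))"

lemma lip_atE:
  assumes "lip_at g x"
  obtains B where "B \<ge> 0" "\<forall>\<^sub>F y in nhds x. norm (g y - g x) \<le> B * norm (y - x)"
proof -
  obtain B where B: "\<forall>\<^sub>F y in nhds x. norm (g y - g x) \<le> B * norm (y - x)"
    using assms by (auto simp: lip_at_def)
  have "\<forall>\<^sub>F y in nhds x. norm (g y - g x) \<le> max B 0 * norm (y - x)"
    using B by eventually_elim (erule order_trans, simp add: mult_right_mono)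
  then show ?thesis by (intro that[of "max B 0"]) auto
qed

lemma lip_at_isCont: assumes "lip_at g x" shows "isCont g x"
proof -
  obtain B where B: "B \<ge> 0" "\<forall>\<^sub>F y in nhds x. norm (g y - g x) \<le> B * norm (y - x)"
    using assms by (rule lip_atE)
  have "((\<lambda>y. B * norm (y - x)) \<longlongrightarrow> B * norm (x - x)) (nhds x)"
    by (intro tendsto_intros filterlim_ident)
  then have "((\<lambda>y. B * norm (y - x)) \<longlongrightarrow> 0) (nhds x)" by simp
  then have "((\<lambda>y. g y - g x) \<longlongrightarrow> 0) (nhds x)"
    by (rule Lim_null_comparison[OF B(2)])
  then have "(g \<longlongrightarrow> g x) (nhds x)" using Lim_null by blast
  then show ?thesis unfolding isCont_def by (simp only: tendsto_at_iff_tendsto_nhds)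
qed

lemma lip_at_tendsto: "lip_at g x \<Longrightarrow> (g \<longlongrightarrow> g x) (nhds x)"
  using lip_at_isCont[of g x] unfolding isCont_def by (simp only: tendsto_at_iff_tendsto_nhds)

lemma isCont_eventually_less:
  fixes f :: "'a::t2_space \<Rightarrow> real"
  shows "isCont f x \<Longrightarrow> f x < c \<Longrightarrow> \<forall>\<^sub>F y in nhds x. f y < c"
  using tendsto_at_iff_tendsto_nhds[of f x] unfolding isCont_def by (metis order_tendstoD(2))

lemma isCont_eventually_greater:
  fixes f :: "'a::t2_space \<Rightarrow> real"
  shows "isCont f x \<Longrightarrow> c < f x \<Longrightarrow> \<forall>\<^sub>F y in nhds x. c < f y"
  using tendsto_at_iff_tendsto_nhds[of f x] unfolding isCont_def by (metis order_tendstoD(1))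

lemma differentiable_imp_lip_at:
  assumes "g differentiable (at x)" shows "lip_at g x"
proof -
  obtain D where D: "(g has_derivative D) (at x)" using assms by (auto simp: differentiable_def)
  obtain K where K: "\<And>h. norm (D h) \<le> norm h * K"
    using bounded_linear.pos_bounded[OF has_derivative_bounded_linear[OF D]] by blast
  obtain d where d: "d > 0" "\<And>y. norm (y - x) < d \<Longrightarrow> norm (g y - g x - D (y - x)) \<le> 1 * norm (y - x)"
    using D unfolding has_derivative_at_alt by (meson zero_less_one)
  have "norm (g y - g x) \<le> (K + 1) * norm (y - x)" if "dist y x < d" for y
  proof -
    have "norm (g y - g x) \<le> norm (g y - g x - D (y - x)) + norm (D (y - x))"
      by (metis diff_add_cancel norm_triangle_ineq)
    also have "\<dots> \<le> (K + 1) * norm (y - x)"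
      using d(2)[of y] K[of "y - x"] that by (simp add: dist_norm algebra_simps)
    finally show ?thesis .
  qed
  then show ?thesis unfolding lip_at_def eventually_nhds_metric using d(1) by blast
qed

lemma lip_at_add: assumes "lip_at f x" "lip_at g x" shows "lip_at (\<lambda>y. f y + g y) x"
proof -
  obtain A where A: "\<forall>\<^sub>F y in nhds x. norm (f y - f x) \<le> A * norm (y - x)" using assms by (auto simp: lip_at_def)
  obtain B where B: "\<forall>\<^sub>F y in nhds x. norm (g y - g x) \<le> B * norm (y - x)" using assms by (auto simp: lip_at_def)
  have "\<forall>\<^sub>F y in nhds x. norm (f y + g y - (f x + g x)) \<le> (A + B) * norm (y - x)"
    using A B
  proof eventually_elim
    case (elim y)
    have "norm (f y + g y - (f x + g x)) \<le> norm (f y - f x) + norm (g y - g x)"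
      by (metis add_diff_add norm_triangle_ineq)
    then show ?case using elim by (simp add: distrib_right)
  qed
  then show ?thesis by (auto simp: lip_at_def)
qed

lemma (in bounded_bilinear) lip_at:
  assumes "lip_at f x" "lip_at g x" shows "lip_at (\<lambda>y. prod (f y) (g y)) x"
proof -
  obtain A where A: "A \<ge> 0" "\<forall>\<^sub>F y in nhds x. norm (f y - f x) \<le> A * norm (y - x)" using assms lip_atE by blast
  obtain B where B: "B \<ge> 0" "\<forall>\<^sub>F y in nhds x. norm (g y - g x) \<le> B * norm (y - x)" using assms lip_atE by blast
  obtain K where K: "K > 0" "\<And>a b. norm (prod a b) \<le> norm a * norm b * K" using pos_bounded by blast
  have "((\<lambda>y. norm (g y)) \<longlongrightarrow> norm (g x)) (nhds x)"
    by (intro tendsto_norm lip_at_tendsto assms(2))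
  then have bd: "\<forall>\<^sub>F y in nhds x. norm (g y) < norm (g x) + 1"
    by (rule order_tendstoD) simp
  define C where "C = (A * (norm (g x) + 1) + norm (f x) * B) * K"
  have "\<forall>\<^sub>F y in nhds x. norm (prod (f y) (g y) - prod (f x) (g x)) \<le> C * norm (y - x)"
    using A(2) B(2) bd
  proof eventually_elim
    case (elim y)
    have "norm (prod (f y) (g y) - prod (f x) (g x)) = norm (prod (f y - f x) (g y) + prod (f x) (g y - g x))"
      by (simp add: diff_left diff_right)
    also have "\<dots> \<le> norm (f y - f x) * norm (g y) * K + norm (f x) * norm (g y - g x) * K"
      by (rule order_trans[OF norm_triangle_ineq add_mono[OF K(2) K(2)]])
    also have "\<dots> \<le> (A * norm (y - x)) * (norm (g x) + 1) * K + norm (f x) * (B * norm (y - x)) * K"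
      using elim K(1) A(1) by (intro add_mono mult_right_mono mult_mono) auto
    also have "\<dots> = C * norm (y - x)" by (simp add: C_def algebra_simps)
    finally show ?case .
  qed
  then show ?thesis by (auto simp: lip_at_def)
qed

lemmas lip_at_scaleR = bounded_bilinear.lip_at[OF bounded_bilinear_scaleR]
lemmas lip_at_inner = bounded_bilinear.lip_at[OF bounded_bilinear_inner]
lemmas lip_at_mult = bounded_bilinear.lip_at[OF bounded_bilinear_mult]

lemma lip_at_compose:
  assumes f: "lip_at f x" and g: "lip_at g (f x)"
  shows "lip_at (\<lambda>y. g (f y)) x"
proof -
  obtain A where A: "A \<ge> 0" "\<forall>\<^sub>F y in nhds x. norm (f y - f x) \<le> A * norm (y - x)" using f lip_atE by blast
  obtain B where B: "B \<ge> 0" "\<forall>\<^sub>F z in nhds (f x). norm (g z - g (f x)) \<le> B * norm (z - f x)" using g lip_atE by blast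
  have "filterlim f (nhds (f x)) (nhds x)"
    by (rule lip_at_tendsto[OF f])
  then have "\<forall>\<^sub>F y in nhds x. norm (g (f y) - g (f x)) \<le> B * norm (f y - f x)"
    using B(2) by (rule eventually_compose_filterlim[rotated])
  with A(2) have "\<forall>\<^sub>F y in nhds x. norm (g (f y) - g (f x)) \<le> (B * A) * norm (y - x)"
  proof eventually_elim
    case (elim y)
    then show ?case using mult_left_mono[OF elim(1) B(1)] by (simp add: mult.assoc)
  qed
  then show ?thesis by (auto simp: lip_at_def)
qed

lemma negligible_lip_at_image:
  fixes f :: "'a::euclidean_space \<Rightarrow> 'a"
  assumes "negligible S" "\<And>x. x \<in> S \<Longrightarrow> lip_at f x"
  shows "negligible (f ` S)"
proof (rule negligible_locally_Lipschitz_image[OF order_refl assms(1)])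
  fix x assume "x \<in> S"
  then obtain B T where "open T" "x \<in> T" "\<forall>y\<in>T. norm (f y - f x) \<le> B * norm (y - x)"
    using assms(2) unfolding lip_at_def eventually_nhds by meson
  then show "\<exists>T B. open T \<and> x \<in> T \<and> (\<forall>y\<in>S \<inter> T. norm (f y - f x) \<le> B * norm (y - x))" by blast
qed

text \<open>Subtract \<open>\<epsilon>/2 \<bar>z - y\<^sub>0\<bar>\<^sup>2\<close> to make the maximum strict. Then each tilt by a small linear form \<open>p\<close>
  has an interior maximum, at which the perturbed gradient equals \<open>p\<close>. Hence this gradient maps the set of such contact points onto a ball; since it maps null sets to null sets,
  some contact point avoids \<open>N\<close>. There the second derivative test applies.\<close>
lemma local_max_hessian_AE:
  fixes \<phi> :: "'a::euclidean_space \<Rightarrow> real" and g :: "'a \<Rightarrow> 'a"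
  assumes r: "r > 0"
    and der: "\<And>x. x \<in> ball y0 r \<Longrightarrow> (\<phi> has_derivative (\<lambda>h. g x \<bullet> h)) (at x)"
    and lip: "\<And>x. x \<in> ball y0 r \<Longrightarrow> lip_at g x"
    and max: "\<And>x. x \<in> ball y0 r \<Longrightarrow> \<phi> x \<le> \<phi> y0"
    and N: "negligible N" and e: "\<epsilon> > 0"
  obtains z where "z \<in> ball y0 r" "z \<in> ball y0 \<epsilon>" "z \<notin> N"
    "\<And>H \<xi>. (g has_derivative H) (at z) \<Longrightarrow> \<xi> \<bullet> H \<xi> \<le> \<epsilon> * (\<xi> \<bullet> \<xi>)"
proof -
  define \<rho> where "\<rho> = min r \<epsilon> / 2"
  have rho: "\<rho> > 0" "\<rho> < r" "\<rho> < \<epsilon>" using r e by (auto simp: \<rho>_def)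
  have cb: "cball y0 \<rho> \<subseteq> ball y0 r" using rho by auto
  define \<psi> where "\<psi> z = \<phi> z - \<epsilon> / 2 * ((z - y0) \<bullet> (z - y0))" for z
  define G where "G z = g z - \<epsilon> *\<^sub>R (z - y0)" for z
  have d\<psi>: "(\<psi> has_derivative (\<lambda>h. G x \<bullet> h)) (at x)" if "x \<in> ball y0 r" for x
    unfolding \<psi>_def
    by (rule has_derivative_eq_rhs, rule has_derivative_diff[OF der[OF that]], (rule derivative_intros)+)
      (auto simp: G_def fun_eq_iff inner_diff_left inner_commute algebra_simps)
  define Kc where "Kc = {z \<in> ball y0 \<rho>. \<forall>z'\<in>cball y0 \<rho>. \<psi> z' - G z \<bullet> z' \<le> \<psi> z - G z \<bullet> z}"
  have onto: "p \<in> G ` Kc" if p: "p \<in> ball 0 (\<epsilon> * \<rho> / 4)" for p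
  proof -
    define q where "q z = \<psi> z - p \<bullet> z" for z
    have dq: "(q has_derivative (\<lambda>h. (G x - p) \<bullet> h)) (at x)" if "x \<in> ball y0 r" for x
      unfolding q_def by (rule has_derivative_eq_rhs, rule has_derivative_diff[OF d\<psi>[OF that]], (rule derivative_intros)+)
        (auto simp: inner_diff_left)
    have "continuous_on (cball y0 \<rho>) q"
      by (intro continuous_at_imp_continuous_on ballI) (meson cb dq has_derivative_continuous subsetD)
    then obtain z where z: "z \<in> cball y0 \<rho>" "\<And>z'. z' \<in> cball y0 \<rho> \<Longrightarrow> q z' \<le> q z"
      using continuous_attains_sup[of "cball y0 \<rho>" q] rho by auto
    have zb: "z \<in> ball y0 \<rho>"
    proof (rule ccontr)
      assume "z \<notin> ball y0 \<rho>"
      then have nz: "norm (z - y0) = \<rho>" using z(1) by (simp add: dist_norm norm_minus_commute)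
      have "\<phi> z \<le> \<phi> y0" using max z(1) cb by auto
      moreover have "(z - y0) \<bullet> (z - y0) = \<rho>\<^sup>2" by (simp add: power2_norm_eq_inner[symmetric] nz)
      moreover have "p \<bullet> (y0 - z) \<le> norm p * \<rho>"
        using norm_cauchy_schwarz[of p "y0 - z"] nz by (simp add: norm_minus_commute)
      moreover have "norm p * \<rho> \<le> \<epsilon> * \<rho> / 4 * \<rho>" using p rho by (intro mult_right_mono) auto
      moreover have "q y0 \<le> q z" using z(2)[of y0] rho by simp
      ultimately have "\<epsilon> / 2 * \<rho>\<^sup>2 \<le> \<epsilon> * \<rho> / 4 * \<rho>"
        by (simp add: q_def \<psi>_def inner_diff_right)
      moreover have "\<epsilon> * \<rho>\<^sup>2 > 0" using e rho by simp
      ultimately show False by (simp add: power2_eq_square)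
    qed
    have "(\<lambda>h. (G z - p) \<bullet> h) = (\<lambda>h. 0)"
    proof (rule differential_zero_maxmin[of z "ball y0 \<rho>" q])
      show "(q has_derivative (\<lambda>h. (G z - p) \<bullet> h)) (at z)" using dq zb rho by auto
    qed (use zb z in auto)
    then have "(G z - p) \<bullet> (G z - p) = 0" by meson
    then have "G z = p" by simp
    moreover have "z \<in> Kc" using zb z(2) \<open>G z = p\<close> by (auto simp: Kc_def q_def)
    ultimately show ?thesis by blast
  qed
  have "\<not> Kc \<subseteq> N"
  proof
    assume "Kc \<subseteq> N"
    then have "negligible Kc" using N negligible_subset by blast
    then have "negligible (G ` Kc)"
    proof (rule negligible_lip_at_image)
      fix x assume "x \<in> Kc"
      then have "lip_at g x" using lip rho by (auto simp: Kc_def)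
      moreover have "lip_at (\<lambda>z. - \<epsilon> *\<^sub>R (z - y0)) x"
        by (rule differentiable_imp_lip_at) (auto intro!: derivative_intros)
      ultimately have "lip_at (\<lambda>z. g z + - \<epsilon> *\<^sub>R (z - y0)) x" by (rule lip_at_add)
      then show "lip_at G x" by (simp add: G_def[abs_def])
    qed
    then have "negligible (ball (0::'a) (\<epsilon> * \<rho> / 4))" using onto negligible_subset by (meson subsetI)
    moreover have "\<epsilon> * \<rho> / 4 > 0" using e rho by simp
    ultimately show False by (metis open_ball open_not_negligible ball_eq_empty not_le)
  qed
  then obtain z where z: "z \<in> Kc" "z \<notin> N" by blast
  have zr: "z \<in> ball y0 \<rho>" and zmax: "\<And>z'. z' \<in> cball y0 \<rho> \<Longrightarrow> \<psi> z' - G z \<bullet> z' \<le> \<psi> z - G z \<bullet> z"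
    using z(1) by (auto simp: Kc_def)
  show ?thesis
  proof (rule that[of z])
    fix H \<xi> assume H: "(g has_derivative H) (at z)"
    show "\<xi> \<bullet> H \<xi> \<le> \<epsilon> * (\<xi> \<bullet> \<xi>)"
    proof (rule ccontr)
      assume neg: "\<not> ?thesis"
      have linH: "linear H" using H by (rule has_derivative_linear)
      define k where "k t = (G (z + t *\<^sub>R \<xi>) - G z) \<bullet> \<xi>" for t
      have dG: "(G has_derivative (\<lambda>h. H h - \<epsilon> *\<^sub>R h)) (at z)"
        unfolding G_def by (rule has_derivative_eq_rhs, rule has_derivative_diff[OF H], (rule derivative_intros)+) auto
      have "((\<lambda>t. G (z + t *\<^sub>R \<xi>)) has_derivative (\<lambda>t. H (t *\<^sub>R \<xi>) - \<epsilon> *\<^sub>R (t *\<^sub>R \<xi>))) (at 0)"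
        by (rule has_derivative_compose[of "\<lambda>t. z + t *\<^sub>R \<xi>" "\<lambda>t. t *\<^sub>R \<xi>" 0 UNIV G])
          (auto intro!: derivative_eq_intros simp: dG)
      then have "(k has_derivative (\<lambda>t. (H (t *\<^sub>R \<xi>) - \<epsilon> *\<^sub>R (t *\<^sub>R \<xi>)) \<bullet> \<xi>)) (at 0)"
        unfolding k_def by (auto intro!: derivative_eq_intros)
      then have dk: "DERIV k 0 :> \<xi> \<bullet> H \<xi> - \<epsilon> * (\<xi> \<bullet> \<xi>)"
        unfolding has_field_derivative_def
        by (rule has_derivative_eq_rhs) (auto simp: linear_cmul[OF linH] inner_diff_left inner_commute algebra_simps)
      have "\<xi> \<bullet> H \<xi> - \<epsilon> * (\<xi> \<bullet> \<xi>) > 0" using neg by simp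
      from DERIV_pos_inc_right[OF dk this] obtain d where d: "d > 0" "\<And>h. 0 < h \<Longrightarrow> h < d \<Longrightarrow> k 0 < k h" by auto
      have k0: "k 0 = 0" by (simp add: k_def)
      obtain d2 where d2: "d2 > 0" "ball z d2 \<subseteq> ball y0 \<rho>" using zr by (meson open_ball open_contains_ball)
      define t where "t = min (d / 2) (d2 / (2 * (norm \<xi> + 1)))"
      have t: "0 < t" "t < d" using d(1) d2(1) by (auto simp: t_def add_nonneg_pos)
      have "t * norm \<xi> \<le> d2 / (2 * (norm \<xi> + 1)) * norm \<xi>" by (intro mult_right_mono) (auto simp: t_def)
      also have "\<dots> = d2 / 2 * (norm \<xi> / (norm \<xi> + 1))" by simp
      also have "\<dots> \<le> d2 / 2 * 1" using d2(1) by (intro mult_left_mono) (auto simp: divide_le_eq_1 add_nonneg_pos)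
      finally have tx: "t * norm \<xi> < d2" using d2(1) by simp
      have inb: "z + s *\<^sub>R \<xi> \<in> ball y0 \<rho>" if "0 \<le> s" "s \<le> t" for s
      proof -
        have "norm (s *\<^sub>R \<xi>) < d2" using that tx mult_right_mono[of s t "norm \<xi>"] by simp
        then have "z + s *\<^sub>R \<xi> \<in> ball z d2" by (simp add: dist_norm)
        then show ?thesis using d2(2) by blast
      qed
      define j where "j s = \<psi> (z + s *\<^sub>R \<xi>) - G z \<bullet> (z + s *\<^sub>R \<xi>)" for s
      have dj: "DERIV j s :> k s" if s: "0 \<le> s" "s \<le> t" for s
      proof -
        have "(\<psi> has_derivative (\<lambda>h. G (z + s *\<^sub>R \<xi>) \<bullet> h)) (at (z + s *\<^sub>R \<xi>))"
          using d\<psi> inb[OF s] rho by auto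
        then have "((\<lambda>s. \<psi> (z + s *\<^sub>R \<xi>)) has_derivative (\<lambda>h. G (z + s *\<^sub>R \<xi>) \<bullet> (h *\<^sub>R \<xi>))) (at s)"
          by (intro has_derivative_compose[of "\<lambda>t. z + t *\<^sub>R \<xi>" "\<lambda>t. t *\<^sub>R \<xi>" s UNIV \<psi>])
            (auto intro!: derivative_eq_intros)
        then have "(j has_derivative (\<lambda>h. G (z + s *\<^sub>R \<xi>) \<bullet> (h *\<^sub>R \<xi>) - G z \<bullet> (h *\<^sub>R \<xi>))) (at s)"
          unfolding j_def by (auto intro!: derivative_eq_intros)
        then show ?thesis unfolding has_field_derivative_def
          by (rule has_derivative_eq_rhs) (auto simp: k_def inner_diff_left algebra_simps)
      qed
      obtain s where s: "0 < s" "s < t" "j t - j 0 = (t - 0) * k s"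
        using MVT2[of 0 t j k] t(1) dj by auto
      have "k s > 0" using d(2)[of s] s t k0 by simp
      then have "(t - 0) * k s > 0" using t(1) by simp
      then have "j t > j 0" using s(3) by linarith
      moreover have "j t \<le> j 0" using zmax[of "z + t *\<^sub>R \<xi>"] inb[of t] t(1) by (simp add: j_def)
      ultimately show False by simp
    qed
  qed (use zr z rho in auto)
qed

section \<open>The comparison principle\<close>

text \<open>The function \<open>g\<close> is the gradient of \<open>w\<close>. It is carried along explicitly so that its derivative can be formed.\<close>
definition C1lip :: "(real^'n) set \<Rightarrow> (real^'n \<Rightarrow> real) \<Rightarrow> (real^'n \<Rightarrow> real^'n) \<Rightarrow> bool" where
  "C1lip \<Omega> w g \<longleftrightarrow> (\<forall>x\<in>\<Omega>. (w has_derivative (\<lambda>h. g x \<bullet> h)) (at x) \<and> lip_at g x)"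

text \<open>For \<open>a = w x\<close>, \<open>p = \<nabla>w x\<close>, \<open>H = \<nabla>\<^sup>2w x\<close> this is the Schouten tensor of the conformally flat
  metric \<open>w powr (-2) \<bar>dx\<bar>\<^sup>2\<close> in an orthonormal frame.\<close>
definition schouten :: "real \<Rightarrow> real^'n \<Rightarrow> real^'n^'n \<Rightarrow> real^'n^'n" where
  "schouten a p H = a *\<^sub>R H - ((p \<bullet> p) / 2) *\<^sub>R mat 1"

definition schouten_AE :: "(real^'n^'n) set \<Rightarrow> (real^'n) set \<Rightarrow> (real^'n \<Rightarrow> real) \<Rightarrow> (real^'n \<Rightarrow> real^'n) \<Rightarrow> bool" where
  "schouten_AE S \<Omega> w g \<longleftrightarrow>
     negligible {x\<in>\<Omega>. \<not> (\<exists>H. (g has_derivative (\<lambda>h. H *v h)) (at x) \<and> schouten (w x) (g x) H \<in> S)}"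

lemma C1lip_isCont: "C1lip \<Omega> w g \<Longrightarrow> x \<in> \<Omega> \<Longrightarrow> isCont w x" "C1lip \<Omega> w g \<Longrightarrow> x \<in> \<Omega> \<Longrightarrow> isCont g x"
  by (auto simp: C1lip_def lip_at_isCont intro: has_derivative_continuous)

lemma posdef_scaleR_mat_1: "c > 0 \<Longrightarrow> posdef (c *\<^sub>R (mat 1 :: real^'n::finite^'n))"
  by (auto simp: posdef_def sym_matrices_def transpose_scalar scaleR_matrix_vector_assoc[symmetric] transpose_mat)

text \<open>The set \<open>K\<close> plays the role of the closure of \<open>U\<close>: a subsolution has its tensor in \<open>K\<close>, a solution in \<open>K - U\<close>.\<close>
locale elliptic_cone =
  fixes U K :: "(real^'n::finite^'n) set"
  assumes K_sym: "K \<subseteq> sym_matrices"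
    and K_scale: "\<And>M c. M \<in> K \<Longrightarrow> c > 0 \<Longrightarrow> c *\<^sub>R M \<in> K"
    and K_add: "\<And>M P. M \<in> K \<Longrightarrow> posdef P \<Longrightarrow> M + P \<in> U"
    and U_scale: "\<And>M c. M \<in> U \<Longrightarrow> c > 0 \<Longrightarrow> c *\<^sub>R M \<in> U"
begin

lemma schouten_sym: "schouten a p H \<in> K \<Longrightarrow> a > 0 \<Longrightarrow> H \<in> sym_matrices"
proof -
  assume S: "schouten a p H \<in> K" and a: "a > 0"
  then have "schouten a p H \<in> sym_matrices" using K_sym by auto
  then have "a * H $ i $ j = a * H $ j $ i" for i j
  proof -
    have "schouten a p H $ i $ j = schouten a p H $ j $ i"
      using \<open>schouten a p H \<in> sym_matrices\<close> unfolding sym_matrices_iff by blast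
    then show ?thesis by (cases "i = j") (simp_all add: schouten_def mat_def)
  qed
  then show ?thesis using a by (simp add: sym_matrices_iff)
qed

text \<open>If \<open>m w\<close> is touched from below by \<open>v + \<epsilon> h\<close>, its Hessian dominates that of \<open>v\<close> plus a multiple \<open>c\<close> of the identity.
  Expressing the latter by the tensor of \<open>v\<close>, one finds \<open>m A(w) = (w/v) A(v) + P\<close> with \<open>P\<close> positive definite when the gradient terms leave a positive remainder.\<close>
lemma touching_schouten:
  fixes Hv Hw :: "real^'n^'n"
  assumes pos: "v > 0" "w > 0" "m > 0"
    and v: "schouten v p Hv \<in> K" and w: "Hw \<in> sym_matrices"
    and hess: "\<And>\<xi>. \<xi> \<bullet> (Hv *v \<xi>) + c * (\<xi> \<bullet> \<xi>) \<le> m * (\<xi> \<bullet> (Hw *v \<xi>))"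
    and gain: "w / (2 * v) * (p \<bullet> p) + w * c - m / 2 * (q \<bullet> q) > 0"
  shows "schouten w q Hw \<in> U"
proof -
  define b where "b = w / (2 * v) * (p \<bullet> p) + w * c - m / 2 * (q \<bullet> q)"
  define P where "P = w *\<^sub>R (m *\<^sub>R Hw - Hv - c *\<^sub>R mat 1) + b *\<^sub>R mat 1"
  have symv: "Hv \<in> sym_matrices" using schouten_sym[OF v pos(1)] .
  have "posdef P"
    unfolding posdef_def
  proof (intro conjI allI impI)
    show "P \<in> sym_matrices" using symv w unfolding P_def sym_matrices_iff by (auto simp: mat_def)
    fix x :: "real^'n" assume x: "x \<noteq> 0"
    have "x \<bullet> (P *v x) = w * (m * (x \<bullet> (Hw *v x)) - x \<bullet> (Hv *v x) - c * (x \<bullet> x)) + b * (x \<bullet> x)"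
      unfolding P_def
      by (simp add: matrix_vector_mult_add_rdistrib matrix_vector_mult_diff_rdistrib
          scaleR_matrix_vector_assoc[symmetric] inner_add_right inner_diff_right)
    moreover have "w * (m * (x \<bullet> (Hw *v x)) - x \<bullet> (Hv *v x) - c * (x \<bullet> x)) \<ge> 0"
      using hess[of x] pos by simp
    moreover have "b * (x \<bullet> x) > 0" using gain x by (simp add: b_def)
    ultimately show "x \<bullet> (P *v x) > 0" by simp
  qed
  moreover have "(w / v) *\<^sub>R schouten v p Hv \<in> K" using K_scale[OF v] pos by simp
  ultimately have "(w / v) *\<^sub>R schouten v p Hv + P \<in> U" by (rule K_add[rotated])
  moreover have "(w / v) *\<^sub>R schouten v p Hv + P = m *\<^sub>R schouten w q Hw"
    using pos unfolding schouten_def P_def b_def by (simp add: algebra_simps)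
  ultimately have "m *\<^sub>R schouten w q Hw \<in> U" by simp
  from U_scale[OF this, of "1 / m"] show ?thesis using pos by simp
qed

text \<open>If \<open>v > w\<close> somewhere, the quotient of \<open>v + \<epsilon> (\<bar>x\<bar>\<^sup>2 + 1)\<close> and \<open>w\<close> has an interior maximum \<open>m > 1\<close>. At the
  maximum point the gain required by \<open>touching_schouten\<close> is strictly positive, because the terms linear in \<open>\<epsilon>\<close> are bounded below
  by \<open>\<epsilon>/v\<close> times the square of \<open>\<bar>\<nabla>v\<bar> \<bar>x\<bar> - 2 v\<close>. By continuity it remains positive near the maximum, and there the contact lemma supplies
  points at which both equations hold.\<close>
theorem comparison:
  assumes \<Omega>: "open \<Omega>" "bounded \<Omega>"
    and v: "C1lip \<Omega> v gv" "\<And>x. x \<in> \<Omega> \<Longrightarrow> v x > 0" "schouten_AE K \<Omega> v gv"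
    and w: "C1lip \<Omega> w gw" "schouten_AE (K - U) \<Omega> w gw"
    and low: "\<mu> > 0" "\<And>x. x \<in> \<Omega> \<Longrightarrow> w x \<ge> \<mu>"
    and bdry: "\<And>\<zeta> \<eta>. \<zeta> \<in> frontier \<Omega> \<Longrightarrow> \<eta> > 0 \<Longrightarrow> \<forall>\<^sub>F y in at \<zeta> within \<Omega>. v y \<le> (1 + \<eta>) * w y"
    and x: "x \<in> \<Omega>"
  shows "v x \<le> w x"
proof (rule ccontr)
  assume "\<not> v x \<le> w x"
  then have vw: "v x > w x" by simp
  have wpos: "w y > 0" if "y \<in> \<Omega>" for y using low that by force
  define s0 where "s0 = v x / w x"
  have s0: "s0 > 1" using vw wpos[OF x] by (simp add: s0_def)
  obtain R where R: "R > 0" "\<And>y. y \<in> \<Omega> \<Longrightarrow> norm y \<le> R" using \<Omega>(2) by (auto simp: bounded_pos)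
  \<comment> \<open>a bubble; the constant \<open>1\<close> makes the gain strict, by the term \<open>4 \<epsilon>\<^sup>2\<close> in the computation of \<open>Br0\<close> below\<close>
  define h where "h y = y \<bullet> y + 1" for y :: "real^'n"
  have h1: "h y \<ge> 1" for y by (simp add: h_def)
  have hR: "h y \<le> R\<^sup>2 + 1" if "y \<in> \<Omega>" for y
    using R(2)[OF that] by (simp add: h_def power2_norm_eq_inner[symmetric] power_mono)
  define \<eta> where "\<eta> = (s0 - 1) / 3"
  have eta: "\<eta> > 0" "1 + 2 * \<eta> < s0" using s0 by (auto simp: \<eta>_def field_simps)
  define \<epsilon> where "\<epsilon> = \<eta> * \<mu> / (R\<^sup>2 + 1)"
  have R21: "R\<^sup>2 + 1 > 0" by (simp add: add_nonneg_pos)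
  have eps: "\<epsilon> > 0" using eta low R21 by (simp add: \<epsilon>_def)
  have eh: "\<epsilon> * h y \<le> \<eta> * w y" if "y \<in> \<Omega>" for y
  proof -
    have "\<epsilon> * h y \<le> \<epsilon> * (R\<^sup>2 + 1)" using hR[OF that] eps by simp
    also have "\<dots> = \<eta> * \<mu>" using R21 by (simp add: \<epsilon>_def)
    also have "\<dots> \<le> \<eta> * w y" using low(2)[OF that] eta by simp
    finally show ?thesis .
  qed
  define ve where "ve y = v y + \<epsilon> * h y" for y
  define r where "r y = ve y / w y" for y
  have rc: "isCont r y" if "y \<in> \<Omega>" for y
    unfolding r_def ve_def h_def
    using C1lip_isCont(1)[OF v(1) that] C1lip_isCont(1)[OF w(1) that] wpos[OF that]
    by (intro continuous_intros) auto
  define C where "C = {y\<in>\<Omega>. r y \<ge> s0}"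
  have xC: "x \<in> C"
  proof -
    have "ve x \<ge> v x" using eps h1[of x] by (simp add: ve_def)
    then show ?thesis using x wpos[OF x] by (auto simp: C_def r_def s0_def divide_right_mono)
  qed
  have "closed C"
    unfolding closure_subset_eq[symmetric]
  proof
    fix z assume z: "z \<in> closure C"
    then have z\<Omega>: "z \<in> closure \<Omega>" using closure_mono[of C \<Omega>] by (auto simp: C_def)
    have cl: "\<exists>y\<in>C. y \<in> T" if "open T" "z \<in> T" for T
      using z that closure_iff_nhds_not_empty[of z C] by (meson disjoint_iff order_refl)
    have "z \<in> \<Omega> \<and> r z \<ge> s0"
    proof (cases "z \<in> \<Omega>")
      case True
      have "r z \<ge> s0"
      proof (rule ccontr)
        assume "\<not> r z \<ge> s0"
        then have "\<forall>\<^sub>F y in nhds z. r y < s0"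
          by (intro isCont_eventually_less rc[OF True]) simp
        then obtain T where T: "open T" "z \<in> T" "\<forall>y\<in>T. r y < s0" unfolding eventually_nhds by blast
        then show False using cl[OF T(1,2)] by (auto simp: C_def)
      qed
      then show ?thesis using True by simp
    next
      case False
      then have "z \<in> frontier \<Omega>" using z\<Omega> \<Omega>(1) by (simp add: frontier_def interior_open)
      from bdry[OF this eta(1)] obtain T where T: "open T" "z \<in> T"
          "\<And>y. y \<in> T \<Longrightarrow> y \<noteq> z \<Longrightarrow> y \<in> \<Omega> \<Longrightarrow> v y \<le> (1 + \<eta>) * w y"
        unfolding eventually_at_topological by blast
      obtain y where y: "y \<in> C" "y \<in> T" using cl[OF T(1,2)] by blast
      then have y\<Omega>: "y \<in> \<Omega>" by (auto simp: C_def)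
      then have "v y \<le> (1 + \<eta>) * w y" using T(3) y False by blast
      then have "ve y \<le> (1 + 2 * \<eta>) * w y" using eh[OF y\<Omega>] by (simp add: ve_def algebra_simps)
      then have "r y \<le> 1 + 2 * \<eta>" using wpos[OF y\<Omega>] by (simp add: r_def divide_le_eq)
      then show ?thesis using y(1) eta(2) by (simp add: C_def)
    qed
    then show "z \<in> C" by (simp add: C_def)
  qed
  moreover have "bounded C" by (rule bounded_subset[OF \<Omega>(2)]) (auto simp: C_def)
  ultimately have "compact C" by (simp add: compact_eq_bounded_closed)
  moreover have "continuous_on C r" by (intro continuous_at_imp_continuous_on ballI rc) (auto simp: C_def)
  ultimately obtain y0 where y0: "y0 \<in> C" "\<And>y. y \<in> C \<Longrightarrow> r y \<le> r y0"
    using continuous_attains_sup[of C r] xC by blast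
  define m where "m = r y0"
  have m: "m > 1" using y0(1) s0 by (simp add: m_def C_def)
  have y0\<Omega>: "y0 \<in> \<Omega>" using y0(1) by (simp add: C_def)
  have rm: "r y \<le> m" if "y \<in> \<Omega>" for y
    using y0 that by (cases "y \<in> C") (auto simp: m_def C_def)
  define \<phi> where "\<phi> y = v y + \<epsilon> * h y - m * w y" for y
  define g where "g y = gv y + (2 * \<epsilon>) *\<^sub>R y - m *\<^sub>R gw y" for y
  have phi0: "\<phi> y0 = 0" using wpos[OF y0\<Omega>] by (simp add: \<phi>_def m_def r_def ve_def)
  have phile: "\<phi> y \<le> 0" if "y \<in> \<Omega>" for y
    using rm[OF that] wpos[OF that] by (simp add: \<phi>_def r_def ve_def divide_le_eq)
  have dphi: "(\<phi> has_derivative (\<lambda>k. g y \<bullet> k)) (at y)" if "y \<in> \<Omega>" for y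
  proof -
    have "(v has_derivative (\<lambda>k. gv y \<bullet> k)) (at y)" "(w has_derivative (\<lambda>k. gw y \<bullet> k)) (at y)"
      using v(1) w(1) that by (auto simp: C1lip_def)
    then show ?thesis unfolding \<phi>_def h_def
      by (auto intro!: derivative_eq_intros simp: g_def fun_eq_iff inner_diff_left inner_add_left inner_commute algebra_simps)
  qed
  have lipg: "lip_at g y" if "y \<in> \<Omega>" for y
  proof -
    have "lip_at gv y" "lip_at gw y" using v(1) w(1) that by (auto simp: C1lip_def)
    moreover have "lip_at (\<lambda>y. (2 * \<epsilon>) *\<^sub>R y) y" "lip_at (\<lambda>y::real^'n. - m) y"
      by (auto intro!: differentiable_imp_lip_at derivative_intros)
    ultimately have "lip_at (\<lambda>y. gv y + (2 * \<epsilon>) *\<^sub>R y + (- m) *\<^sub>R gw y) y"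
      by (intro lip_at_add lip_at_scaleR[of "\<lambda>_. - m" y gw])
    then show ?thesis by (simp add: g_def[abs_def])
  qed
  have g0: "g y0 = 0"
  proof -
    have "(\<lambda>k. g y0 \<bullet> k) = (\<lambda>k. 0)"
      by (rule differential_zero_maxmin[OF y0\<Omega> \<Omega>(1) dphi[OF y0\<Omega>]]) (use phile phi0 in auto)
    then have "g y0 \<bullet> g y0 = 0" by meson
    then show ?thesis by simp
  qed
  \<comment> \<open>the gain in \<open>touching_schouten\<close> with \<open>c = 2 \<epsilon>\<close>, as the Hessian of \<open>\<epsilon> h\<close> is \<open>2 \<epsilon> I\<close>\<close>
  define Br where "Br y = w y / (2 * v y) * (gv y \<bullet> gv y) + 2 * \<epsilon> * w y - m / 2 * (gw y \<bullet> gw y)" for y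
  have Brc: "isCont Br y0"
    unfolding Br_def
    using C1lip_isCont[OF v(1) y0\<Omega>] C1lip_isCont[OF w(1) y0\<Omega>] v(2)[OF y0\<Omega>]
    by (intro continuous_intros) auto
  have Br0: "Br y0 > 0"
  proof -
    let ?V = "v y0" and ?p = "gv y0"
    have V: "?V > 0" by (rule v(2)[OF y0\<Omega>])
    have mw: "m * w y0 = ?V + \<epsilon> * h y0" using phi0 by (simp add: \<phi>_def)
    have mg: "m *\<^sub>R gw y0 = ?p + (2 * \<epsilon>) *\<^sub>R y0" using g0 by (simp add: g_def)
    have "2 * m * Br y0 = (m * w y0) / ?V * (?p \<bullet> ?p) + 4 * \<epsilon> * (m * w y0) - (m *\<^sub>R gw y0) \<bullet> (m *\<^sub>R gw y0)"
      by (simp add: Br_def algebra_simps add_divide_distrib)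
    also have "\<dots> = \<epsilon> * h y0 / ?V * (?p \<bullet> ?p) + 4 * \<epsilon> * ?V + 4 * \<epsilon>\<^sup>2 * h y0 - 4 * \<epsilon> * (?p \<bullet> y0) - 4 * \<epsilon>\<^sup>2 * (y0 \<bullet> y0)"
      unfolding mw mg using V by (simp add: inner_add_left inner_add_right inner_commute power2_eq_square field_simps)
    also have "\<dots> = \<epsilon> / ?V * (h y0 * (?p \<bullet> ?p) + 4 * ?V\<^sup>2 - 4 * ?V * (?p \<bullet> y0)) + 4 * \<epsilon>\<^sup>2"
      using V by (simp add: h_def field_simps power2_eq_square)
    finally have E: "2 * m * Br y0 = \<epsilon> / ?V * (h y0 * (?p \<bullet> ?p) + 4 * ?V\<^sup>2 - 4 * ?V * (?p \<bullet> y0)) + 4 * \<epsilon>\<^sup>2" .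
    have "?p \<bullet> y0 \<le> norm ?p * norm y0" by (rule norm_cauchy_schwarz)
    then have "4 * ?V * (?p \<bullet> y0) \<le> 4 * ?V * (norm ?p * norm y0)" using V by simp
    also have "\<dots> \<le> (norm ?p * norm y0)\<^sup>2 + 4 * ?V\<^sup>2"
      using zero_le_power2[of "norm ?p * norm y0 - 2 * ?V"] by (simp add: power2_diff algebra_simps power_mult_distrib)
    also have "(norm ?p * norm y0)\<^sup>2 = (y0 \<bullet> y0) * (?p \<bullet> ?p)"
      by (simp add: power_mult_distrib power2_norm_eq_inner)
    also have "\<dots> \<le> h y0 * (?p \<bullet> ?p)" by (intro mult_right_mono) (auto simp: h_def)
    finally have "h y0 * (?p \<bullet> ?p) + 4 * ?V\<^sup>2 - 4 * ?V * (?p \<bullet> y0) \<ge> 0" by simp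
    then have "\<epsilon> / ?V * (h y0 * (?p \<bullet> ?p) + 4 * ?V\<^sup>2 - 4 * ?V * (?p \<bullet> y0)) \<ge> 0"
      using eps V by (intro mult_nonneg_nonneg) auto
    moreover have "4 * \<epsilon>\<^sup>2 > 0" using eps by simp
    ultimately have "2 * m * Br y0 > 0" using E by linarith
    then show ?thesis using m by (simp add: zero_less_mult_iff)
  qed
  define c where "c = Br y0 / 2"
  have c: "c > 0" using Br0 by (simp add: c_def)
  have w0: "w y0 > 0" by (rule wpos[OF y0\<Omega>])
  have "\<forall>\<^sub>F y in nhds y0. Br y > c"
    using c by (intro isCont_eventually_greater[OF Brc]) (simp add: c_def)
  moreover have "\<forall>\<^sub>F y in nhds y0. w y < 2 * w y0"
    using w0 by (intro isCont_eventually_less[OF C1lip_isCont(1)[OF w(1) y0\<Omega>]]) simp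
  moreover have "\<forall>\<^sub>F y in nhds y0. y \<in> \<Omega>" using \<Omega>(1) y0\<Omega> by (rule eventually_nhds_in_open)
  ultimately have "\<forall>\<^sub>F y in nhds y0. Br y > c \<and> w y < 2 * w y0 \<and> y \<in> \<Omega>"
    by eventually_elim auto
  then obtain d where d: "d > 0" "\<And>y. dist y y0 < d \<Longrightarrow> Br y > c \<and> w y < 2 * w y0 \<and> y \<in> \<Omega>"
    unfolding eventually_nhds_metric by blast
  \<comment> \<open>the loss \<open>e\<close> in the Hessian at contact points is chosen so small that \<open>w z * e\<close> does not use up the gain\<close>
  define e where "e = c / (2 * w y0)"
  have e: "e > 0" using c w0 by (simp add: e_def)
  define N where "N = {x\<in>\<Omega>. \<not> (\<exists>H. (gv has_derivative (\<lambda>h. H *v h)) (at x) \<and> schouten (v x) (gv x) H \<in> K)}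
      \<union> {x\<in>\<Omega>. \<not> (\<exists>H. (gw has_derivative (\<lambda>h. H *v h)) (at x) \<and> schouten (w x) (gw x) H \<in> K - U)}"
  have N: "negligible N" using v(3) w(2) by (simp add: N_def schouten_AE_def)
  have b\<Omega>: "ball y0 d \<subseteq> \<Omega>" using d(2) by (auto simp: dist_commute)
  obtain z where z: "z \<in> ball y0 d" "z \<notin> N"
    and zH: "\<And>H \<xi>. (g has_derivative H) (at z) \<Longrightarrow> \<xi> \<bullet> H \<xi> \<le> e * (\<xi> \<bullet> \<xi>)"
    by (rule local_max_hessian_AE[OF d(1), of y0 \<phi> g N e])
      (use b\<Omega> dphi lipg phile phi0 N e in \<open>auto simp: subset_iff\<close>)
  have z\<Omega>: "z \<in> \<Omega>" using z b\<Omega> by auto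
  obtain Hv where Hv: "(gv has_derivative (\<lambda>h. Hv *v h)) (at z)" "schouten (v z) (gv z) Hv \<in> K"
    using z z\<Omega> by (auto simp: N_def)
  obtain Hw where Hw: "(gw has_derivative (\<lambda>h. Hw *v h)) (at z)" "schouten (w z) (gw z) Hw \<in> K - U"
    using z z\<Omega> by (auto simp: N_def)
  have dg: "(g has_derivative (\<lambda>h. Hv *v h + (2 * \<epsilon>) *\<^sub>R h - m *\<^sub>R (Hw *v h))) (at z)"
    unfolding g_def using Hv(1) Hw(1) by (auto intro!: derivative_eq_intros)
  have "schouten (w z) (gw z) Hw \<in> U"
  proof (rule touching_schouten[where m=m and c="2 * \<epsilon> - e", OF v(2)[OF z\<Omega>] wpos[OF z\<Omega>] _ Hv(2)])
    show "m > 0" using m by simp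
    show "Hw \<in> sym_matrices" using Hw(2) schouten_sym wpos[OF z\<Omega>] by blast
    fix \<xi> :: "real^'n"
    show "\<xi> \<bullet> (Hv *v \<xi>) + (2 * \<epsilon> - e) * (\<xi> \<bullet> \<xi>) \<le> m * (\<xi> \<bullet> (Hw *v \<xi>))"
      using zH[OF dg, of \<xi>] by (simp add: inner_diff_right inner_add_right algebra_simps)
  next
    have "Br z > c" "w z < 2 * w y0" using d(2)[of z] z by (auto simp: dist_commute)
    then have "w z * e < c" using e w0 mult_strict_right_mono[of "w z" "2 * w y0" e] by (simp add: e_def)
    then show "w z / (2 * v z) * (gv z \<bullet> gv z) + w z * (2 * \<epsilon> - e) - m / 2 * (gw z \<bullet> gw z) > 0"
      using \<open>Br z > c\<close> by (simp add: Br_def algebra_simps)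
  qed
  then show False using Hw(2) by simp
qed
end

section \<open>Inversions in spheres\<close>

text \<open>Up to the factor \<open>l\<^sup>2/\<bar>d\<bar>\<^sup>2\<close> this is the derivative at \<open>x + d\<close> of the inversion in the sphere of centre \<open>x\<close> and radius \<open>l\<close>.\<close>
definition reflect :: "real^'n \<Rightarrow> real^'n \<Rightarrow> real^'n" where
  "reflect d h = h - (2 * (d \<bullet> h) / (d \<bullet> d)) *\<^sub>R d"

definition reflect_matrix :: "real^'n \<Rightarrow> real^'n^'n" where
  "reflect_matrix d = mat 1 - (2 / (d \<bullet> d)) *\<^sub>R outer_prod d d"

definition inversion :: "real^'n \<Rightarrow> real \<Rightarrow> real^'n \<Rightarrow> real^'n" where
  "inversion x l y = x + (l\<^sup>2 / ((y - x) \<bullet> (y - x))) *\<^sub>R (y - x)"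

definition kelvin :: "real^'n \<Rightarrow> real \<Rightarrow> (real^'n \<Rightarrow> real) \<Rightarrow> real^'n \<Rightarrow> real" where
  "kelvin x l w y = ((y - x) \<bullet> (y - x)) / l\<^sup>2 * w (inversion x l y)"

definition kelvin_grad :: "real^'n \<Rightarrow> real \<Rightarrow> (real^'n \<Rightarrow> real) \<Rightarrow> (real^'n \<Rightarrow> real^'n) \<Rightarrow> real^'n \<Rightarrow> real^'n" where
  "kelvin_grad x l w g y =
     (2 / l\<^sup>2 * w (inversion x l y)) *\<^sub>R (y - x) + reflect (y - x) (g (inversion x l y))"

lemma outer_prod_mult_vec: "outer_prod v w *v h = (w \<bullet> h) *\<^sub>R v"
  by (simp add: vec_eq_iff matrix_vector_mult_def outer_prod_def inner_vec_def sum_distrib_left mult_ac)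

lemma reflect_matrix_mult_vec: "reflect_matrix d *v h = reflect d h"
  by (simp add: reflect_matrix_def reflect_def matrix_vector_mult_diff_rdistrib outer_prod_mult_vec
      scaleR_matrix_vector_assoc[symmetric])

lemma reflect_reflect: "reflect d (reflect d h) = h"
  by (cases "d = 0") (auto simp: reflect_def inner_diff_right algebra_simps)

lemma inner_reflect: "a \<bullet> reflect d b = reflect d a \<bullet> b"
  by (simp add: reflect_def inner_diff_left inner_diff_right inner_commute)

lemma reflect_inner_reflect: "reflect d a \<bullet> reflect d b = a \<bullet> b"
  by (simp add: inner_reflect reflect_reflect)

lemma reflect_self: "reflect d d = - d"
  by (cases "d = 0") (auto simp: reflect_def algebra_simps simp flip: scaleR_left.add scaleR_2)

lemma transpose_reflect_matrix: "transpose (reflect_matrix d) = reflect_matrix d"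
  by (simp add: vec_eq_iff transpose_def reflect_matrix_def outer_prod_def mat_def mult.commute)

lemma reflect_matrix_reflect_matrix: "reflect_matrix d ** reflect_matrix d = (mat 1 :: real^'n::finite^'n)"
proof -
  have "(reflect_matrix d ** reflect_matrix d) *v h = mat 1 *v h" for h :: "real^'n"
    by (simp add: matrix_vector_mul_assoc[symmetric] reflect_matrix_mult_vec reflect_reflect)
  then show ?thesis by (simp add: matrix_eq)
qed

lemma orthogonal_reflect_matrix: "orthogonal_matrix (reflect_matrix d :: real^'n::finite^'n)"
  by (simp add: orthogonal_matrix transpose_reflect_matrix reflect_matrix_reflect_matrix)

lemma inversion_ne: "l \<noteq> 0 \<Longrightarrow> y \<noteq> x \<Longrightarrow> inversion x l y \<noteq> x"
  by (simp add: inversion_def)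

lemma inversion_inner:
  assumes "l \<noteq> 0" "y \<noteq> x"
  shows "(inversion x l y - x) \<bullet> (inversion x l y - x) = l^4 / ((y - x) \<bullet> (y - x))"
  using assms by (simp add: inversion_def power4_eq_xxxx power2_eq_square)

lemma inversion_inversion:
  assumes "l \<noteq> 0" "y \<noteq> x" shows "inversion x l (inversion x l y) = y"
  using assms inversion_inner[OF assms]
  by (subst inversion_def) (simp add: inversion_def power4_eq_xxxx power2_eq_square)

lemma has_derivative_inversion:
  assumes "y \<noteq> x"
  shows "(inversion x l has_derivative (\<lambda>h. (l\<^sup>2 / ((y - x) \<bullet> (y - x))) *\<^sub>R reflect (y - x) h)) (at y)"
proof -
  define d where "d = y - x"
  have s: "(y - x) \<bullet> (y - x) \<noteq> 0" "d \<bullet> d \<noteq> 0" using assms by (simp_all add: d_def)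
  have q: "((\<lambda>y. l\<^sup>2 / ((y - x) \<bullet> (y - x))) has_derivative (\<lambda>h. - (2 * l\<^sup>2 * (d \<bullet> h)) / (d \<bullet> d)\<^sup>2)) (at y)"
    by (rule has_derivative_eq_rhs, (rule derivative_intros s)+)
      (use s in \<open>simp add: fun_eq_iff d_def[symmetric] inner_commute divide_simps power2_eq_square\<close>)
  have "((\<lambda>y. (l\<^sup>2 / ((y - x) \<bullet> (y - x))) *\<^sub>R (y - x)) has_derivative
      (\<lambda>h. (l\<^sup>2 / (d \<bullet> d)) *\<^sub>R reflect d h)) (at y)"
  proof (rule has_derivative_eq_rhs[OF has_derivative_scaleR[OF q has_derivative_diff[OF has_derivative_ident has_derivative_const]]], intro ext)
    fix h
    show "(l\<^sup>2 / ((y - x) \<bullet> (y - x))) *\<^sub>R (h - 0) + (- (2 * l\<^sup>2 * (d \<bullet> h)) / (d \<bullet> d)\<^sup>2) *\<^sub>R (y - x)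
        = (l\<^sup>2 / (d \<bullet> d)) *\<^sub>R reflect d h"
      by (simp add: reflect_def d_def[symmetric] scaleR_diff_right power2_eq_square mult_ac)
  qed
  from has_derivative_add[OF has_derivative_const this, of x] show ?thesis
    by (simp add: inversion_def[abs_def] d_def)
qed

lemma has_derivative_kelvin:
  assumes "l \<noteq> 0" "y \<noteq> x"
    and w: "(w has_derivative (\<lambda>h. g (inversion x l y) \<bullet> h)) (at (inversion x l y))"
  shows "(kelvin x l w has_derivative (\<lambda>h. kelvin_grad x l w g y \<bullet> h)) (at y)"
proof -
  have s: "(y - x) \<bullet> (y - x) \<noteq> 0" using assms by simp
  have l2: "l\<^sup>2 \<noteq> 0" using assms(1) by simp
  have f: "((\<lambda>y. w (inversion x l y)) has_derivative
      (\<lambda>h. g (inversion x l y) \<bullet> ((l\<^sup>2 / ((y - x) \<bullet> (y - x))) *\<^sub>R reflect (y - x) h))) (at y)"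
    by (rule has_derivative_compose[OF has_derivative_inversion[OF assms(2)] w])
  show ?thesis
    unfolding kelvin_def
  proof (rule has_derivative_eq_rhs, (rule f l2 derivative_intros)+, intro ext, goal_cases)
    case (1 h)
    define d where "d = y - x"
    have "d \<bullet> d \<noteq> 0" using s by (simp add: d_def)
    then show ?case
      using assms(1)
      by (simp add: kelvin_grad_def d_def[symmetric] inner_add_left inner_reflect[symmetric] inner_commute[of h] field_simps)
  qed
qed

lemma lip_at_kelvin_grad:
  assumes "l \<noteq> 0" "y \<noteq> x"
    and w: "(w has_derivative D) (at (inversion x l y))"
    and g: "lip_at g (inversion x l y)"
  shows "lip_at (kelvin_grad x l w g) y"
proof -
  have inv: "lip_at (inversion x l) y"
    using has_derivative_inversion[OF assms(2)] by (intro differentiable_imp_lip_at) (auto simp: differentiable_def)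
  have f: "lip_at (\<lambda>y. w (inversion x l y)) y"
    using w by (intro lip_at_compose[OF inv] differentiable_imp_lip_at) (auto simp: differentiable_def)
  have G: "lip_at (\<lambda>y. g (inversion x l y)) y" by (rule lip_at_compose[OF inv g])
  have d: "lip_at (\<lambda>y. y - x) y" "lip_at (\<lambda>y::real^'a. 2 / l\<^sup>2) y" "lip_at (\<lambda>y. -2 / ((y - x) \<bullet> (y - x))) y"
    using assms by (auto intro!: differentiable_imp_lip_at derivative_intros)
  have "lip_at (\<lambda>y. (2 / l\<^sup>2 * w (inversion x l y)) *\<^sub>R (y - x) + (g (inversion x l y)
      + (-2 / ((y - x) \<bullet> (y - x)) * ((y - x) \<bullet> g (inversion x l y))) *\<^sub>R (y - x))) y"
    by (intro lip_at_add lip_at_scaleR lip_at_mult lip_at_inner f G d)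
  then show ?thesis unfolding kelvin_grad_def[abs_def] reflect_def by simp
qed

text \<open>Conformal invariance. In the derivative of the transformed gradient all terms in the direction of \<open>y - x\<close> cancel except
  those combining to the reflected Hessian, and the remaining multiple of the identity is compensated by the change of \<open>\<bar>\<nabla>w\<bar>\<^sup>2\<close>.\<close>
lemma schouten_kelvin:
  fixes H :: "real^'n::finite^'n"
  assumes l: "l \<noteq> 0" and y: "y \<noteq> x"
    and w: "(w has_derivative (\<lambda>h. g (inversion x l y) \<bullet> h)) (at (inversion x l y))"
    and g: "(g has_derivative (\<lambda>h. H *v h)) (at (inversion x l y))"
  obtains H' where "(kelvin_grad x l w g has_derivative (\<lambda>h. H' *v h)) (at y)"
    "schouten (kelvin x l w y) (kelvin_grad x l w g y) H' =
      reflect_matrix (y - x) ** schouten (w (inversion x l y)) (g (inversion x l y)) H ** reflect_matrix (y - x)"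
proof -
  define d where "d = y - x"
  define s where "s = d \<bullet> d"
  define f where "f = w (inversion x l y)"
  define G where "G = g (inversion x l y)"
  define R where "R = reflect_matrix d"
  have s: "s \<noteq> 0" "(y - x) \<bullet> (y - x) \<noteq> 0" using y by (auto simp: s_def d_def)
  define H' where "H' = (2 * f / l\<^sup>2 - 2 * (d \<bullet> G) / s) *\<^sub>R mat 1 + (l\<^sup>2 / s) *\<^sub>R (R ** H ** R)"
  have df: "((\<lambda>y. w (inversion x l y)) has_derivative (\<lambda>h. G \<bullet> ((l\<^sup>2 / s) *\<^sub>R reflect d h))) (at y)"
    using has_derivative_compose[OF has_derivative_inversion[OF y] w] by (simp add: G_def s_def d_def)
  have dG: "((\<lambda>y. g (inversion x l y)) has_derivative (\<lambda>h. H *v ((l\<^sup>2 / s) *\<^sub>R reflect d h))) (at y)"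
    using has_derivative_compose[OF has_derivative_inversion[OF y] g] by (simp add: s_def d_def)
  have Hk: "H' *v h = (2 * f / l\<^sup>2 - 2 * (d \<bullet> G) / s) *\<^sub>R h + (l\<^sup>2 / s) *\<^sub>R reflect d (H *v reflect d h)" for h
    unfolding H'_def R_def
    by (simp add: matrix_vector_mult_add_rdistrib scaleR_matrix_vector_assoc[symmetric]
        matrix_vector_mul_assoc[symmetric] reflect_matrix_mult_vec)
  have 1: "(kelvin_grad x l w g has_derivative (\<lambda>h. H' *v h)) (at y)"
  proof -
    have "(kelvin_grad x l w g has_derivative (\<lambda>h.
        (2 / l\<^sup>2 * f) *\<^sub>R h + (2 / l\<^sup>2 * (G \<bullet> ((l\<^sup>2 / s) *\<^sub>R reflect d h))) *\<^sub>R d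
        + (H *v ((l\<^sup>2 / s) *\<^sub>R reflect d h)
          - ((2 * (d \<bullet> G) / s) *\<^sub>R h
            + (2 * (d \<bullet> (H *v ((l\<^sup>2 / s) *\<^sub>R reflect d h)) + h \<bullet> G) / s - 2 * (d \<bullet> G) * (2 * (d \<bullet> h)) / s\<^sup>2) *\<^sub>R d)))) (at y)"
      unfolding kelvin_grad_def reflect_def[of "_ - x"]
      by (rule has_derivative_eq_rhs, (rule df dG s derivative_intros)+)
        (use s in \<open>simp add: fun_eq_iff f_def[symmetric] G_def[symmetric] d_def[symmetric] s_def[symmetric] inner_commute power2_eq_square divide_simps\<close>)
    then show ?thesis
    proof (rule has_derivative_eq_rhs, intro ext)
      fix h
      define \<eta> where "\<eta> = H *v reflect d h"
      have e: "H *v ((l\<^sup>2 / s) *\<^sub>R reflect d h) = (l\<^sup>2 / s) *\<^sub>R \<eta>"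
        by (simp add: \<eta>_def matrix_vector_mult_scaleR)
      have Gr: "G \<bullet> ((l\<^sup>2 / s) *\<^sub>R reflect d h) = l\<^sup>2 / s * (G \<bullet> h - 2 * (d \<bullet> h) * (d \<bullet> G) / s)"
        by (simp add: reflect_def s_def inner_diff_right inner_commute)
      have r: "reflect d \<eta> = \<eta> - (2 * (d \<bullet> \<eta>) / s) *\<^sub>R d" by (simp add: reflect_def s_def)
      have c: "2 / l\<^sup>2 * (l\<^sup>2 / s * (G \<bullet> h - 2 * (d \<bullet> h) * (d \<bullet> G) / s))
          - (2 * (l\<^sup>2 / s * (d \<bullet> \<eta>) + h \<bullet> G) / s - 2 * (d \<bullet> G) * (2 * (d \<bullet> h)) / s\<^sup>2)
          = - (l\<^sup>2 / s * (2 * (d \<bullet> \<eta>) / s))"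
        using s(1) l by (simp add: inner_commute field_simps power2_eq_square)
      have "(2 / l\<^sup>2 * f) *\<^sub>R h + (2 / l\<^sup>2 * (G \<bullet> ((l\<^sup>2 / s) *\<^sub>R reflect d h))) *\<^sub>R d
        + (H *v ((l\<^sup>2 / s) *\<^sub>R reflect d h)
          - ((2 * (d \<bullet> G) / s) *\<^sub>R h
            + (2 * (d \<bullet> (H *v ((l\<^sup>2 / s) *\<^sub>R reflect d h)) + h \<bullet> G) / s - 2 * (d \<bullet> G) * (2 * (d \<bullet> h)) / s\<^sup>2) *\<^sub>R d))
        = (2 * f / l\<^sup>2 - 2 * (d \<bullet> G) / s) *\<^sub>R h + (l\<^sup>2 / s) *\<^sub>R \<eta>
        + (2 / l\<^sup>2 * (l\<^sup>2 / s * (G \<bullet> h - 2 * (d \<bullet> h) * (d \<bullet> G) / s))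
          - (2 * (l\<^sup>2 / s * (d \<bullet> \<eta>) + h \<bullet> G) / s - 2 * (d \<bullet> G) * (2 * (d \<bullet> h)) / s\<^sup>2)) *\<^sub>R d"
        unfolding e Gr by (simp add: scaleR_diff_left scaleR_add_left)
      also have "\<dots> = H' *v h" unfolding c Hk \<eta>_def[symmetric] r
        by (simp add: scaleR_diff_right)
      finally show "(2 / l\<^sup>2 * f) *\<^sub>R h + (2 / l\<^sup>2 * (G \<bullet> ((l\<^sup>2 / s) *\<^sub>R reflect d h))) *\<^sub>R d
        + (H *v ((l\<^sup>2 / s) *\<^sub>R reflect d h)
          - ((2 * (d \<bullet> G) / s) *\<^sub>R h
            + (2 * (d \<bullet> (H *v ((l\<^sup>2 / s) *\<^sub>R reflect d h)) + h \<bullet> G) / s - 2 * (d \<bullet> G) * (2 * (d \<bullet> h)) / s\<^sup>2) *\<^sub>R d)) = H' *v h" .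
    qed
  qed
  have kv: "kelvin x l w y = s / l\<^sup>2 * f" by (simp add: kelvin_def s_def d_def f_def)
  have kg: "kelvin_grad x l w g y = (2 / l\<^sup>2 * f) *\<^sub>R d + reflect d G" by (simp add: kelvin_grad_def d_def f_def G_def)
  have "kelvin_grad x l w g y \<bullet> kelvin_grad x l w g y = 4 * f\<^sup>2 * s / l^4 + G \<bullet> G - 4 * f / l\<^sup>2 * (d \<bullet> G)"
    unfolding kg
    by (simp add: inner_add_left inner_add_right reflect_inner_reflect inner_reflect[of d d G] inner_commute[of "reflect d G" d] reflect_self s_def[symmetric] power2_eq_square power4_eq_xxxx)
      (use l in \<open>simp add: field_simps\<close>)
  then have coef: "s / l\<^sup>2 * f * (2 * f / l\<^sup>2 - 2 * (d \<bullet> G) / s)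
      - kelvin_grad x l w g y \<bullet> kelvin_grad x l w g y / 2 = - (G \<bullet> G / 2)"
    using s(1) l by (simp only:) (simp add: field_simps power2_eq_square power4_eq_xxxx)
  have "schouten (kelvin x l w y) (kelvin_grad x l w g y) H'
      = (s / l\<^sup>2 * f * (2 * f / l\<^sup>2 - 2 * (d \<bullet> G) / s)
        - kelvin_grad x l w g y \<bullet> kelvin_grad x l w g y / 2) *\<^sub>R mat 1 + (s / l\<^sup>2 * f * (l\<^sup>2 / s)) *\<^sub>R (R ** H ** R)"
    unfolding schouten_def kv H'_def scaleR_add_right scaleR_scaleR
      scaleR_diff_left[of "s / l\<^sup>2 * f * (2 * f / l\<^sup>2 - 2 * (d \<bullet> G) / s)"]
    by (simp only: add_diff_eq diff_add_eq)
  also have "\<dots> = f *\<^sub>R (R ** H ** R) - ((G \<bullet> G) / 2) *\<^sub>R mat 1"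
    unfolding coef using s(1) l by simp
  also have "\<dots> = R ** schouten f G H ** R"
    unfolding schouten_def R_def
    by (simp add: matrix_eq matrix_vector_mult_diff_rdistrib scaleR_matrix_vector_assoc[symmetric]
        matrix_vector_mult_diff_distrib matrix_vector_mult_scaleR matrix_vector_mul_assoc[symmetric])
      (simp add: reflect_matrix_mult_vec reflect_reflect)
  finally have 2: "schouten (kelvin x l w y) (kelvin_grad x l w g y) H' = R ** schouten f G H ** R" .
  show ?thesis by (rule that[OF 1]) (use 2 in \<open>simp add: R_def d_def f_def G_def\<close>)
qed

lemma C1lip_kelvin:
  assumes "l \<noteq> 0" "C1lip UNIV w g"
  shows "C1lip (- {x}) (kelvin x l w) (kelvin_grad x l w g)"
  using assms unfolding C1lip_def by (auto intro!: has_derivative_kelvin lip_at_kelvin_grad)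

text \<open>The inversion is an involution that preserves null sets.\<close>
lemma schouten_AE_kelvin:
  fixes w :: "real^'n::finite \<Rightarrow> real"
  assumes l: "l \<noteq> 0" and w: "C1lip UNIV w g" and A: "schouten_AE S UNIV w g"
    and inv: "\<And>M d. M \<in> S \<Longrightarrow> reflect_matrix d ** M ** reflect_matrix d \<in> S"
  shows "schouten_AE S (- {x}) (kelvin x l w) (kelvin_grad x l w g)"
proof -
  define B where "B = {z. z \<noteq> x \<and> \<not> (\<exists>H. (g has_derivative (\<lambda>h. H *v h)) (at z) \<and> schouten (w z) (g z) H \<in> S)}"
  have "negligible B" by (rule negligible_subset[OF A[unfolded schouten_AE_def]]) (auto simp: B_def)
  then have "negligible (inversion x l ` B)"
  proof (rule negligible_lip_at_image)
    fix z assume "z \<in> B"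
    then show "lip_at (inversion x l) z"
      using has_derivative_inversion[of z x l] by (intro differentiable_imp_lip_at) (auto simp: differentiable_def B_def)
  qed
  moreover have "y \<in> inversion x l ` B"
    if y: "y \<noteq> x" "\<not> (\<exists>H. (kelvin_grad x l w g has_derivative (\<lambda>h. H *v h)) (at y) \<and>
      schouten (kelvin x l w y) (kelvin_grad x l w g y) H \<in> S)" for y
  proof -
    have "inversion x l y \<in> B"
    proof (rule ccontr)
      assume "inversion x l y \<notin> B"
      then obtain H where H: "(g has_derivative (\<lambda>h. H *v h)) (at (inversion x l y))"
        "schouten (w (inversion x l y)) (g (inversion x l y)) H \<in> S"
        using inversion_ne[OF l y(1)] by (auto simp: B_def)
      have "(w has_derivative (\<lambda>h. g (inversion x l y) \<bullet> h)) (at (inversion x l y))"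
        using w by (simp add: C1lip_def)
      from schouten_kelvin[OF l y(1) this H(1)] inv[OF H(2)] y(2) show False by metis
    qed
    then show ?thesis using inversion_inversion[OF l y(1)] by (metis image_eqI)
  qed
  ultimately show ?thesis unfolding schouten_AE_def by (auto intro: negligible_subset)
qed

section \<open>Comparing a solution with its inversions\<close>

lemma at_infinity_shift_iff:
  fixes x :: "'a::real_normed_vector"
  shows "(\<forall>\<^sub>F y in at_infinity. P y) \<longleftrightarrow> (\<exists>b>0. \<forall>y. norm (y - x) \<ge> b \<longrightarrow> P y)"
proof
  assume "\<forall>\<^sub>F y in at_infinity. P y"
  then obtain b where b: "\<And>y. norm y \<ge> b \<Longrightarrow> P y" by (auto simp: eventually_at_infinity)
  have "P y" if "norm (y - x) \<ge> \<bar>b\<bar> + norm x + 1" for y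
    using norm_triangle_ineq4[of y x] that by (intro b) linarith
  then show "\<exists>b>0. \<forall>y. norm (y - x) \<ge> b \<longrightarrow> P y"
    by (intro exI[of _ "\<bar>b\<bar> + norm x + 1"]) (auto simp: add_nonneg_pos)
next
  assume "\<exists>b>0. \<forall>y. norm (y - x) \<ge> b \<longrightarrow> P y"
  then obtain b where b: "\<And>y. norm (y - x) \<ge> b \<Longrightarrow> P y" by blast
  have "P y" if "norm y \<ge> b + norm x" for y
    using norm_triangle_ineq2[of y x] that by (intro b) linarith
  then show "\<forall>\<^sub>F y in at_infinity. P y" by (auto simp: eventually_at_infinity)
qed

text \<open>The infimum of all such \<open>b\<close> is the upper limit of \<open>w(y)/\<bar>y\<bar>\<^sup>2\<close> at infinity, if \<open>w\<close> is positive.\<close>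
definition quadratic_growth :: "('a::real_inner \<Rightarrow> real) \<Rightarrow> real \<Rightarrow> bool" where
  "quadratic_growth w b \<longleftrightarrow> (\<forall>\<^sub>F y in at_infinity. w y \<le> b * (y \<bullet> y))"

text \<open>Moving the centre costs only lower order terms, hence an arbitrarily small increase of the leading coefficient.\<close>
lemma quadratic_growth_recentre:
  fixes w :: "'a::real_inner \<Rightarrow> real"
  assumes "\<forall>\<^sub>F y in at_infinity. w y \<le> b * ((y - x) \<bullet> (y - x))" "b < c" "0 \<le> b"
  shows "\<forall>\<^sub>F y in at_infinity. w y \<le> c * ((y - z) \<bullet> (y - z))"
proof -
  obtain B where B: "\<And>y. norm (y - z) \<ge> B \<Longrightarrow> w y \<le> b * ((y - x) \<bullet> (y - x))"
    using assms(1) unfolding at_infinity_shift_iff[of _ z] by blast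
  define a where "a = norm (z - x)"
  \<comment> \<open>beyond this radius the lower order terms are dominated by \<open>(c - b) r\<^sup>2\<close>\<close>
  define D where "D = (2 * b * a + b * a\<^sup>2) / (c - b) + 1"
  have D: "D \<ge> 1" using assms by (simp add: D_def a_def)
  have "w y \<le> c * ((y - z) \<bullet> (y - z))" if y: "norm (y - z) \<ge> \<bar>B\<bar> + D" for y
  proof -
    define r where "r = norm (y - z)"
    have r: "r \<ge> D" "r \<ge> 1" using y D by (auto simp: r_def)
    have "norm (y - x) \<le> r + a" using norm_triangle_ineq[of "y - z" "z - x"] by (simp add: r_def a_def)
    then have "(norm (y - x))\<^sup>2 \<le> (r + a)\<^sup>2" by (intro power_mono) auto
    then have "b * (norm (y - x))\<^sup>2 \<le> b * (r + a)\<^sup>2" using assms(3) by (rule mult_left_mono)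
    also have "b * (r + a)\<^sup>2 = b * r\<^sup>2 + (2 * b * a * r + b * a\<^sup>2)" by (simp add: power2_sum algebra_simps)
    also have "2 * b * a * r + b * a\<^sup>2 \<le> (2 * b * a + b * a\<^sup>2) * r"
      using r(2) assms(3) mult_left_mono[of 1 r "b * a\<^sup>2"] by (simp add: algebra_simps)
    also have "\<dots> \<le> (c - b) * r * r"
    proof (rule mult_right_mono)
      have "(c - b) * D = 2 * b * a + b * a\<^sup>2 + (c - b)" using assms(2) by (simp add: D_def field_simps)
      then have "2 * b * a + b * a\<^sup>2 \<le> (c - b) * D" using assms(2) by linarith
      also have "\<dots> \<le> (c - b) * r" using r assms by simp
      finally show "2 * b * a + b * a\<^sup>2 \<le> (c - b) * r" .
    qed (use r in simp)
    finally have "b * (norm (y - x))\<^sup>2 \<le> c * r\<^sup>2" by (simp add: power2_eq_square algebra_simps)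
    moreover have "w y \<le> b * ((y - x) \<bullet> (y - x))" using B y D by auto
    ultimately show ?thesis by (simp add: r_def power2_norm_eq_inner)
  qed
  then show ?thesis using D unfolding at_infinity_shift_iff[of _ z] by (intro exI[of _ "\<bar>B\<bar> + D"]) auto
qed

lemma quadratic_upper_bound:
  fixes w :: "real^'n \<Rightarrow> real"
  assumes "C1lip UNIV w g"
  obtains B d where "B \<ge> 0" "d > 0" "\<And>h. norm h < d \<Longrightarrow> w (x + h) \<le> w x + g x \<bullet> h + B * (h \<bullet> h)"
proof -
  have "lip_at g x" using assms by (simp add: C1lip_def)
  then obtain B where B: "B \<ge> 0" "\<forall>\<^sub>F y in nhds x. norm (g y - g x) \<le> B * norm (y - x)" by (rule lip_atE)
  then obtain d where d: "d > 0" "\<And>y. dist y x < d \<Longrightarrow> norm (g y - g x) \<le> B * norm (y - x)"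
    unfolding eventually_nhds_metric by blast
  show ?thesis
  proof (rule that[OF B(1) d(1)])
    fix h :: "real^'n" assume h: "norm h < d"
    have der: "((\<lambda>t. w (x + t *\<^sub>R h)) has_real_derivative g (x + t *\<^sub>R h) \<bullet> h) (at t)" for t
    proof -
      have "(w has_derivative (\<lambda>k. g (x + t *\<^sub>R h) \<bullet> k)) (at (x + t *\<^sub>R h))"
        using assms by (simp add: C1lip_def)
      then have "((\<lambda>t. w (x + t *\<^sub>R h)) has_derivative (\<lambda>s. g (x + t *\<^sub>R h) \<bullet> (s *\<^sub>R h))) (at t)"
        by (intro has_derivative_compose[of "\<lambda>t. x + t *\<^sub>R h" "\<lambda>t. t *\<^sub>R h" t UNIV w])
          (auto intro!: derivative_eq_intros)
      then show ?thesis unfolding has_field_derivative_def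
        by (rule has_derivative_eq_rhs) (auto simp: fun_eq_iff)
    qed
    obtain t where t: "0 < t" "t < 1" "w (x + 1 *\<^sub>R h) - w (x + 0 *\<^sub>R h) = (1 - 0) * (g (x + t *\<^sub>R h) \<bullet> h)"
      using MVT2[of 0 1 "\<lambda>t. w (x + t *\<^sub>R h)" "\<lambda>t. g (x + t *\<^sub>R h) \<bullet> h"] der by auto
    have th: "norm (t *\<^sub>R h) \<le> norm h" using t mult_right_mono[of t 1 "norm h"] by simp
    have "norm (g (x + t *\<^sub>R h) - g x) \<le> B * norm (t *\<^sub>R h)"
      using d(2)[of "x + t *\<^sub>R h"] th h by (simp add: dist_norm)
    also have "\<dots> \<le> B * norm h" using th B(1) by (rule mult_left_mono)
    finally have "(g (x + t *\<^sub>R h) - g x) \<bullet> h \<le> B * norm h * norm h"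
      using norm_cauchy_schwarz[of "g (x + t *\<^sub>R h) - g x" h]
      by (meson mult_right_mono norm_ge_zero order_trans)
    then show "w (x + h) \<le> w x + g x \<bullet> h + B * (h \<bullet> h)"
      using t(3) by (simp add: inner_diff_left power2_norm_eq_inner[symmetric] power2_eq_square mult.assoc)
  qed
qed

locale entire_solution = elliptic_cone U K for U K :: "(real^'n::finite^'n) set" +
  fixes w :: "real^'n \<Rightarrow> real" and g :: "real^'n \<Rightarrow> real^'n"
  assumes K_reflect: "\<And>M d. M \<in> K \<Longrightarrow> reflect_matrix d ** M ** reflect_matrix d \<in> K"
    and w_pos: "\<And>x. w x > 0"
    and w_C1: "C1lip UNIV w g"
    and w_sol: "schouten_AE (K - U) UNIV w g"
begin

text \<open>On the sphere the inversion equals \<open>w\<close>, and near the centre it is bounded by \<open>b l\<^sup>2 < w x\<close>. So the comparison principle applies in the punctured ball.\<close>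
lemma kelvin_le_inside:
  assumes l: "l > 0" and b: "\<forall>\<^sub>F y in at_infinity. w y \<le> b * ((y - x) \<bullet> (y - x))" "b * l\<^sup>2 < w x"
    and y: "y \<noteq> x" "norm (y - x) < l"
  shows "kelvin x l w y \<le> w y"
proof -
  define \<Omega> where "\<Omega> = ball x l - {x}"
  have wc: "isCont w z" for z using C1lip_isCont(1)[OF w_C1] by simp
  have kC: "C1lip (- {x}) (kelvin x l w) (kelvin_grad x l w g)" using l w_C1 by (intro C1lip_kelvin) auto
  have kc: "isCont (kelvin x l w) z" if "z \<noteq> x" for z using C1lip_isCont(1)[OF kC] that by simp
  have "schouten_AE K UNIV w g"
    using w_sol unfolding schouten_AE_def by (rule negligible_subset) blast
  then have kA: "schouten_AE K (- {x}) (kelvin x l w) (kelvin_grad x l w g)"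
    using l w_C1 K_reflect by (intro schouten_AE_kelvin) auto
  have "continuous_on (cball x l) w" by (intro continuous_at_imp_continuous_on ballI wc)
  then obtain z0 where z0: "\<forall>z\<in>cball x l. w z0 \<le> w z"
    using continuous_attains_inf[of "cball x l" w] l by auto
  show ?thesis
  proof (rule comparison[of \<Omega> "kelvin x l w" "kelvin_grad x l w g" w g "w z0" y])
    show "open \<Omega>" unfolding \<Omega>_def by (intro open_Diff) auto
    show "bounded \<Omega>" unfolding \<Omega>_def by (rule bounded_subset[OF bounded_ball]) (rule Diff_subset)
    show "C1lip \<Omega> (kelvin x l w) (kelvin_grad x l w g)" using kC by (auto simp: C1lip_def \<Omega>_def)
    show "C1lip \<Omega> w g" using w_C1 by (auto simp: C1lip_def)
    show "schouten_AE K \<Omega> (kelvin x l w) (kelvin_grad x l w g)"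
      using kA unfolding schouten_AE_def \<Omega>_def by (rule negligible_subset) blast
    show "schouten_AE (K - U) \<Omega> w g" using w_sol unfolding schouten_AE_def by (rule negligible_subset) blast
    show "w z0 > 0" by (rule w_pos)
    show "y \<in> \<Omega>" using y by (auto simp: \<Omega>_def dist_norm norm_minus_commute)
  next
    fix z assume "z \<in> \<Omega>"
    then have "z \<noteq> x" "z \<in> cball x l" by (auto simp: \<Omega>_def)
    then show "kelvin x l w z > 0" "w z \<ge> w z0"
      using w_pos[of "inversion x l z"] l z0 by (simp_all add: kelvin_def)
  next
    fix \<zeta> and \<eta> :: real assume z: "\<zeta> \<in> frontier \<Omega>" and eta: "\<eta> > 0"
    show "\<forall>\<^sub>F y in at \<zeta> within \<Omega>. kelvin x l w y \<le> (1 + \<eta>) * w y"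
    proof (cases "\<zeta> = x")
      case True
      obtain B where B: "B > 0" "\<And>y. norm (y - x) \<ge> B \<Longrightarrow> w y \<le> b * ((y - x) \<bullet> (y - x))"
        using b(1) unfolding at_infinity_shift_iff[of _ x] by blast
      have "\<forall>\<^sub>F y in nhds x. b * l\<^sup>2 < w y" by (rule isCont_eventually_greater[OF wc b(2)])
      moreover have "\<forall>\<^sub>F y in nhds x. dist y x < l\<^sup>2 / B"
        using l B(1) unfolding eventually_nhds_metric by (intro exI[of _ "l\<^sup>2 / B"]) auto
      ultimately have "\<forall>\<^sub>F y in nhds x. y \<noteq> x \<longrightarrow> kelvin x l w y \<le> (1 + \<eta>) * w y"
      proof eventually_elim
        case (elim y)
        show ?case
        proof
          assume yx: "y \<noteq> x"
          define s where "s = (y - x) \<bullet> (y - x)"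
          have s: "s > 0" "sqrt s = norm (y - x)" using yx by (auto simp: s_def norm_eq_sqrt_inner)
          have in1: "(inversion x l y - x) \<bullet> (inversion x l y - x) = l^4 / s"
            using inversion_inner[of l y x] l yx by (simp add: s_def)
          have "norm (inversion x l y - x) = l\<^sup>2 / s * norm (y - x)"
            using s(1) by (simp add: inversion_def s_def[symmetric])
          also have "\<dots> = l\<^sup>2 / norm (y - x)"
            using yx by (simp add: s_def power2_norm_eq_inner[symmetric] power2_eq_square)
          finally have ni: "norm (inversion x l y - x) = l\<^sup>2 / norm (y - x)" .
          have "B \<le> l\<^sup>2 / norm (y - x)"
            using elim(2) B(1) yx l by (simp add: dist_norm pos_less_divide_eq pos_le_divide_eq mult.commute)
          then have "w (inversion x l y) \<le> b * (l^4 / s)" using B(2)[of "inversion x l y"] ni in1 by simp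
          then have "s / l\<^sup>2 * w (inversion x l y) \<le> s / l\<^sup>2 * (b * (l^4 / s))"
            using s(1) by (intro mult_left_mono) auto
          also have "\<dots> = b * l\<^sup>2" using s(1) l by (simp add: power2_eq_square power4_eq_xxxx)
          finally have "kelvin x l w y \<le> w y" using elim(1) by (simp add: kelvin_def s_def)
          also have "\<dots> \<le> (1 + \<eta>) * w y" using eta w_pos[of y] by simp
          finally show "kelvin x l w y \<le> (1 + \<eta>) * w y" .
        qed
      qed
      then show ?thesis unfolding True eventually_at_filter by eventually_elim auto
    next
      case False
      have "frontier \<Omega> \<subseteq> insert x (sphere x l)"
      proof -
        have "closure \<Omega> \<subseteq> cball x l" unfolding \<Omega>_def by (rule closure_minimal) auto
        moreover have "interior \<Omega> = \<Omega>" unfolding \<Omega>_def by (intro interior_open open_Diff) auto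
        ultimately have "frontier \<Omega> \<subseteq> cball x l - \<Omega>" unfolding frontier_def by blast
        then show ?thesis unfolding \<Omega>_def by (auto simp: sphere_def)
      qed
      then have "\<zeta> \<in> sphere x l" using z False by blast
      then have "norm (\<zeta> - x) = l" by (simp add: dist_norm norm_minus_commute)
      then have s: "(\<zeta> - x) \<bullet> (\<zeta> - x) = l\<^sup>2" by (simp add: power2_norm_eq_inner[symmetric])
      then have "kelvin x l w \<zeta> = w \<zeta>" using l by (simp add: kelvin_def inversion_def)
      then have "kelvin x l w \<zeta> - (1 + \<eta>) * w \<zeta> < 0" using eta w_pos[of \<zeta>] by (simp add: algebra_simps)
      moreover have "isCont (\<lambda>y. kelvin x l w y - (1 + \<eta>) * w y) \<zeta>"
        by (intro continuous_intros kc False wc)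
      ultimately have "\<forall>\<^sub>F y in nhds \<zeta>. kelvin x l w y - (1 + \<eta>) * w y < 0"
        by (intro isCont_eventually_less)
      then show ?thesis unfolding eventually_at_filter by eventually_elim auto
    qed
  qed
qed

lemma le_kelvin_outside:
  assumes l: "l > 0" and b: "\<forall>\<^sub>F y in at_infinity. w y \<le> b * ((y - x) \<bullet> (y - x))" "b * l\<^sup>2 < w x"
    and y: "norm (y - x) > l"
  shows "w y \<le> kelvin x l w y"
proof -
  define z where "z = inversion x l y"
  define s where "s = (y - x) \<bullet> (y - x)"
  have yx: "y \<noteq> x" using y l by auto
  have s: "s > 0" "s > l\<^sup>2"
    using yx y l by (auto simp: s_def power2_norm_eq_inner[symmetric] power_strict_mono)
  have zz: "(z - x) \<bullet> (z - x) = l^4 / s" using inversion_inner[of l y x] l yx by (simp add: z_def s_def)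
  have "norm (z - x) < l"
  proof -
    have "(norm (z - x))\<^sup>2 < l\<^sup>2"
    proof -
      have "l^4 = l\<^sup>2 * l\<^sup>2" by (simp add: power4_eq_xxxx power2_eq_square)
      then have "l^4 < l\<^sup>2 * s" using mult_strict_left_mono[OF s(2), of "l\<^sup>2"] l by simp
      then show ?thesis unfolding power2_norm_eq_inner zz using s(1) by (simp add: divide_less_eq)
    qed
    then show ?thesis using l by (simp add: power2_less_imp_less)
  qed
  moreover have "z \<noteq> x" using inversion_ne[of l y x] l yx by (simp add: z_def)
  ultimately have "kelvin x l w z \<le> w z" by (intro kelvin_le_inside[OF l b])
  moreover have "inversion x l z = y" using inversion_inversion[of l y x] l yx by (simp add: z_def)
  ultimately have "l^4 / s / l\<^sup>2 * w y \<le> w z" using zz by (simp add: kelvin_def)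
  moreover have "l^4 / s / l\<^sup>2 = l\<^sup>2 / s" using l by (simp add: power2_eq_square power4_eq_xxxx)
  ultimately have "l\<^sup>2 / s * w y \<le> w z" by (simp only:)
  then have "s / l\<^sup>2 * (l\<^sup>2 / s * w y) \<le> s / l\<^sup>2 * w z"
    using s(1) by (intro mult_left_mono) auto
  then have "w y \<le> s / l\<^sup>2 * w z" using s(1) l by simp
  then show ?thesis by (simp add: kelvin_def z_def s_def)
qed

text \<open>For centres \<open>x = q + T (q - p)\<close> and the radius for which \<open>p\<close> and \<open>q\<close> are exchanged by the inversion, the comparison reads
  \<open>T/(T + 1) w p \<le> w q\<close>; now let \<open>T\<close> tend to infinity.\<close>
lemma constant_if_no_growth:
  assumes "\<And>b. b > 0 \<Longrightarrow> quadratic_growth w b"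
  shows "w p = w q"
proof -
  have le: "w p \<le> w q" for p q
  proof (cases "p = q")
    case False
    have k: "T / (T + 1) * w p \<le> w q" if T: "T > 0" for T :: real
    proof -
      define x where "x = q + T *\<^sub>R (q - p)"
      define D where "D = (q - p) \<bullet> (q - p)"
      have D: "D > 0" using False by (simp add: D_def)
      \<comment> \<open>the product of the distances of \<open>p\<close> and \<open>q\<close> from \<open>x\<close>\<close>
      define l where "l = sqrt (T * (T + 1) * D)"
      have l: "l > 0" "l\<^sup>2 = T * (T + 1) * D" using T D by (auto simp: l_def)
      have qx: "q - x = - T *\<^sub>R (q - p)" by (simp add: x_def)
      have s: "(q - x) \<bullet> (q - x) = T\<^sup>2 * D" by (simp add: qx D_def power2_eq_square)
      define b where "b = w x / (2 * l\<^sup>2)"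
      have b: "b > 0" "b * l\<^sup>2 < w x" using w_pos[of x] l(1) by (simp_all add: b_def)
      have "\<forall>\<^sub>F y in at_infinity. w y \<le> b * ((y - x) \<bullet> (y - x))"
        using assms[of "b / 2"] b(1) quadratic_growth_recentre[of w "b / 2" 0 b x] by (simp add: quadratic_growth_def)
      then have "kelvin x l w q \<le> w q"
      proof (rule kelvin_le_inside[OF l(1) _ b(2)])
        show "q \<noteq> x" using s D T by auto
        have "(norm (q - x))\<^sup>2 < l\<^sup>2" unfolding power2_norm_eq_inner s l(2)
          using T D by (simp add: power2_eq_square)
        then show "norm (q - x) < l" using l(1) by (simp add: power2_less_imp_less)
      qed
      moreover have "inversion x l q = p"
      proof -
        have "inversion x l q = x + ((T + 1) / T) *\<^sub>R (q - x)"
          using T D unfolding inversion_def s l(2) by (simp add: power2_eq_square)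
        also have "\<dots> = x - (T + 1) *\<^sub>R (q - p)" using T by (simp add: qx)
        also have "\<dots> = p" by (simp add: x_def algebra_simps)
        finally show ?thesis .
      qed
      ultimately show ?thesis using T D unfolding kelvin_def s l(2) by (simp add: power2_eq_square)
    qed
    show ?thesis
    proof (rule ccontr)
      assume "\<not> ?thesis"
      then have lt: "w p - w q > 0" by simp
      define T where "T = (w q + 1) / (w p - w q)"
      have T: "T > 0" "T * (w p - w q) = w q + 1" using lt w_pos[of q] by (auto simp: T_def)
      have "T * w p \<le> (T + 1) * w q" using k[OF T(1)] T(1) by (simp add: field_simps)
      then show False using T(2) by (simp add: algebra_simps)
    qed
  qed auto
  show ?thesis using le[of p q] le[of q p] by simp
qed

text \<open>At the critical radius \<open>l\<^sup>2 = w x/\<gamma>\<close> the inversion of \<open>w\<close> has leading coefficient exactly \<open>\<gamma>\<close> at infinity; its next terms come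
  from the first order expansion of \<open>w\<close> at the centre.\<close>
lemma asymptotic_expansion_bound:
  assumes \<gamma>: "\<gamma> > 0" "\<And>b. b > \<gamma> \<Longrightarrow> quadratic_growth w b"
  obtains C where "\<forall>\<^sub>F y in at_infinity. w y \<le> \<gamma> * ((y - x) \<bullet> (y - x)) + g x \<bullet> (y - x) + C"
proof -
  define \<Lambda> where "\<Lambda> = sqrt (w x / \<gamma>)"
  have \<Lambda>: "\<Lambda> > 0" "\<Lambda>\<^sup>2 = w x / \<gamma>" using \<gamma> w_pos[of x] by (auto simp: \<Lambda>_def)
  obtain B d where Bd: "B \<ge> 0" "d > 0" "\<And>h. norm h < d \<Longrightarrow> w (x + h) \<le> w x + g x \<bullet> h + B * (h \<bullet> h)"
    using quadratic_upper_bound[OF w_C1] by blast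
  have K: "w y \<le> kelvin x \<Lambda> w y" if y: "norm (y - x) > \<Lambda>" for y
  proof -
    have yx: "(y - x) \<bullet> (y - x) \<noteq> 0" using y \<Lambda> by auto
    have wc: "isCont w z" for z using C1lip_isCont(1)[OF w_C1] by simp
    have "isCont (\<lambda>l. (y - x) \<bullet> (y - x) / l\<^sup>2 * w (x + (l\<^sup>2 / ((y - x) \<bullet> (y - x))) *\<^sub>R (y - x))) \<Lambda>"
      using \<Lambda> yx by (intro continuous_intros isCont_o2[OF _ wc]) auto
    then have "isCont (\<lambda>l. kelvin x l w y) \<Lambda>" by (simp add: kelvin_def inversion_def)
    then have t: "((\<lambda>l. kelvin x l w y) \<longlongrightarrow> kelvin x \<Lambda> w y) (at_left \<Lambda>)"
      unfolding isCont_def by (rule tendsto_within_subset) simp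
    have "\<forall>\<^sub>F l in at_left \<Lambda>. l > 0 \<and> l < \<Lambda>"
      using \<Lambda>(1) eventually_at_left_field by blast
    then have "\<forall>\<^sub>F l in at_left \<Lambda>. w y \<le> kelvin x l w y"
    proof eventually_elim
      case (elim l)
      have "l\<^sup>2 < w x / \<gamma>" using elim \<Lambda>(2) by (metis less_imp_le power_strict_mono zero_less_numeral)
      then have "\<gamma> < w x / l\<^sup>2" using \<gamma> elim by (simp add: field_simps)
      then obtain b where b: "\<gamma> < b" "b < w x / l\<^sup>2" using dense by blast
      obtain b' where b': "\<gamma> < b'" "b' < b" using dense b by blast
      have "\<forall>\<^sub>F y in at_infinity. w y \<le> b * ((y - x) \<bullet> (y - x))"
        using \<gamma>(2)[OF b'(1)] b' \<gamma>(1) quadratic_growth_recentre[of w b' 0 b x] by (simp add: quadratic_growth_def)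
      then show ?case using elim y b by (intro le_kelvin_outside[of l b]) (auto simp: field_simps)
    qed
    then show ?thesis by (intro tendsto_lowerbound[OF t]) auto
  qed
  define C where "C = B * \<Lambda>\<^sup>2"
  have "w y \<le> \<gamma> * ((y - x) \<bullet> (y - x)) + g x \<bullet> (y - x) + C" if y: "norm (y - x) \<ge> \<Lambda> + \<Lambda>\<^sup>2 / d + 1" for y
  proof -
    define s where "s = (y - x) \<bullet> (y - x)"
    have d0: "\<Lambda>\<^sup>2 / d \<ge> 0" using Bd by simp
    have ny: "norm (y - x) > \<Lambda>" "norm (y - x) > \<Lambda>\<^sup>2 / d" using y \<Lambda>(1) d0 by linarith+
    then have n0: "norm (y - x) > 0" using \<Lambda>(1) by linarith
    moreover have "s = norm (y - x) * norm (y - x)"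
      by (simp add: s_def power2_norm_eq_inner[symmetric] power2_eq_square)
    ultimately have s: "s > 0" "norm (y - x) > 0" "s = norm (y - x) * norm (y - x)" by simp_all
    define h where "h = (\<Lambda>\<^sup>2 / s) *\<^sub>R (y - x)"
    have "norm h = \<Lambda>\<^sup>2 / norm (y - x)" using s by (simp add: h_def)
    also have "\<dots> < d" using ny(2) Bd(2) s(2) by (simp add: field_simps)
    finally have "w (x + h) \<le> w x + g x \<bullet> h + B * (h \<bullet> h)" by (rule Bd(3))
    moreover have "h \<bullet> h = \<Lambda>^4 / s" using s(1) by (simp add: h_def s_def power4_eq_xxxx power2_eq_square)
    moreover have "g x \<bullet> h = \<Lambda>\<^sup>2 / s * (g x \<bullet> (y - x))" by (simp add: h_def)
    ultimately have "s / \<Lambda>\<^sup>2 * w (x + h) \<le> s / \<Lambda>\<^sup>2 * (w x + \<Lambda>\<^sup>2 / s * (g x \<bullet> (y - x)) + B * (\<Lambda>^4 / s))"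
      using s(1) \<Lambda>(1) by (intro mult_left_mono) auto
    also have "\<dots> = s / \<Lambda>\<^sup>2 * w x + g x \<bullet> (y - x) + C"
      using s(1) \<Lambda>(1) by (simp add: C_def field_simps power4_eq_xxxx power2_eq_square)
    also have "s / \<Lambda>\<^sup>2 * w x = \<gamma> * s"
    proof -
      have "w x = \<gamma> * \<Lambda>\<^sup>2" using \<Lambda>(2) \<gamma>(1) by simp
      then show ?thesis using \<Lambda>(1) by simp
    qed
    finally show ?thesis using K[OF ny(1)] by (simp add: kelvin_def inversion_def s_def h_def)
  qed
  then have "\<forall>\<^sub>F y in at_infinity. w y \<le> \<gamma> * ((y - x) \<bullet> (y - x)) + g x \<bullet> (y - x) + C"
    using \<Lambda>(1) Bd(2) unfolding at_infinity_shift_iff[of _ x]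
    by (intro exI[of _ "\<Lambda> + \<Lambda>\<^sup>2 / d + 1"]) (auto intro!: add_nonneg_pos add_pos_nonneg)
  then show ?thesis by (rule that)
qed
end

section \<open>Superharmonic functions near infinity\<close>

definition superharmonic_AE :: "(real^'n) set \<Rightarrow> (real^'n::finite \<Rightarrow> real^'n) \<Rightarrow> bool" where
  "superharmonic_AE \<Omega> g \<longleftrightarrow> negligible {x\<in>\<Omega>. \<not> (\<exists>H. (g has_derivative (\<lambda>h. H *v h)) (at x) \<and> trace H \<le> 0)}"

lemma trace_eq_sum_inner: "trace (H :: real^'n::finite^'n) = (\<Sum>i\<in>UNIV. axis i 1 \<bullet> (H *v axis i 1))"
  by (simp add: trace_def inner_axis' matrix_vector_mul_component column_def matrix_vector_mult_basis)

text \<open>The function \<open>h\<close> is strictly subharmonic. So at an interior maximum of \<open>h - u\<close> the contact lemma contradicts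
  the sign of the Laplacians.\<close>
lemma superharmonic_comparison:
  fixes u h :: "real^'n::finite \<Rightarrow> real"
  assumes u: "C1lip \<Omega> u gu" "superharmonic_AE \<Omega> gu"
    and h: "C1lip \<Omega> h gh"
    and Hh: "\<And>x. x \<in> \<Omega> \<Longrightarrow> (gh has_derivative (\<lambda>k. Hh x *v k)) (at x)"
    and tr: "\<And>x. x \<in> \<Omega> \<Longrightarrow> trace (Hh x) > 0" "\<And>x. x \<in> \<Omega> \<Longrightarrow> isCont (\<lambda>x. trace (Hh x)) x"
    and \<Omega>: "open \<Omega>" and cpt: "\<And>\<eta>. \<eta> > 0 \<Longrightarrow> compact {x\<in>\<Omega>. h x - u x \<ge> \<eta>}"
    and x: "x \<in> \<Omega>"
  shows "h x \<le> u x"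
proof (rule ccontr)
  assume "\<not> h x \<le> u x"
  define \<eta> where "\<eta> = h x - u x"
  have eta: "\<eta> > 0" using \<open>\<not> h x \<le> u x\<close> by (simp add: \<eta>_def)
  define C where "C = {x\<in>\<Omega>. h x - u x \<ge> \<eta>}"
  define \<phi> where "\<phi> y = h y - u y" for y
  define g where "g y = gh y - gu y" for y
  have "continuous_on C \<phi>"
    unfolding \<phi>_def C_def
    by (intro continuous_at_imp_continuous_on ballI continuous_intros)
      (use C1lip_isCont(1)[OF u(1)] C1lip_isCont(1)[OF h] in auto)
  moreover have "compact C" unfolding C_def by (rule cpt[OF eta])
  moreover have "x \<in> C" using x by (simp add: C_def \<eta>_def)
  ultimately obtain y0 where y0: "y0 \<in> C" "\<forall>y\<in>C. \<phi> y \<le> \<phi> y0"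
    using continuous_attains_sup[of C \<phi>] by blast
  have y0\<Omega>: "y0 \<in> \<Omega>" using y0 by (simp add: C_def)
  have max: "\<phi> y \<le> \<phi> y0" if "y \<in> \<Omega>" for y
    using y0 that by (cases "y \<in> C") (auto simp: C_def \<phi>_def)
  have dphi: "(\<phi> has_derivative (\<lambda>k. g y \<bullet> k)) (at y)" if "y \<in> \<Omega>" for y
  proof -
    have "(h has_derivative (\<lambda>k. gh y \<bullet> k)) (at y)" "(u has_derivative (\<lambda>k. gu y \<bullet> k)) (at y)"
      using u(1) h that by (auto simp: C1lip_def)
    then show ?thesis unfolding \<phi>_def
      by (auto intro!: derivative_eq_intros simp: g_def fun_eq_iff inner_diff_left)
  qed
  have lipg: "lip_at g y" if "y \<in> \<Omega>" for y
  proof -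
    have "lip_at gh y" "lip_at gu y" using u(1) h that by (auto simp: C1lip_def)
    moreover have "lip_at (\<lambda>y::real^'n. - 1 :: real) y" by (auto intro!: differentiable_imp_lip_at)
    ultimately have "lip_at (\<lambda>y. gh y + (- 1) *\<^sub>R gu y) y"
      by (intro lip_at_add lip_at_scaleR[of "\<lambda>_. - 1" y gu])
    then show ?thesis by (simp add: g_def[abs_def])
  qed
  define c where "c = trace (Hh y0) / 2"
  have c: "c > 0" "c < trace (Hh y0)" using tr(1)[OF y0\<Omega>] by (auto simp: c_def)
  have "\<forall>\<^sub>F y in nhds y0. c < trace (Hh y)" by (rule isCont_eventually_greater[OF tr(2)[OF y0\<Omega>] c(2)])
  moreover have "\<forall>\<^sub>F y in nhds y0. y \<in> \<Omega>" using \<Omega> y0\<Omega> by (rule eventually_nhds_in_open)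
  ultimately have "\<forall>\<^sub>F y in nhds y0. c < trace (Hh y) \<and> y \<in> \<Omega>" by eventually_elim auto
  then obtain d where d: "d > 0" "\<And>y. dist y y0 < d \<Longrightarrow> c < trace (Hh y) \<and> y \<in> \<Omega>"
    unfolding eventually_nhds_metric by blast
  define e where "e = c / real CARD('n)"
  have e: "e > 0" using c by (simp add: e_def)
  have b\<Omega>: "ball y0 d \<subseteq> \<Omega>" using d(2) by (auto simp: dist_commute)
  define N where "N = {x\<in>\<Omega>. \<not> (\<exists>H. (gu has_derivative (\<lambda>h. H *v h)) (at x) \<and> trace H \<le> 0)}"
  have N: "negligible N" using u(2) by (simp add: N_def superharmonic_AE_def)
  obtain z where z: "z \<in> ball y0 d" "z \<notin> N"
    and zH: "\<And>H \<xi>. (g has_derivative H) (at z) \<Longrightarrow> \<xi> \<bullet> H \<xi> \<le> e * (\<xi> \<bullet> \<xi>)"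
    by (rule local_max_hessian_AE[OF d(1), of y0 \<phi> g N e])
      (use b\<Omega> dphi lipg max N e in \<open>auto simp: subset_iff\<close>)
  have z\<Omega>: "z \<in> \<Omega>" using z b\<Omega> by auto
  obtain Hu where Hu: "(gu has_derivative (\<lambda>h. Hu *v h)) (at z)" "trace Hu \<le> 0"
    using z z\<Omega> by (auto simp: N_def)
  have dg: "(g has_derivative (\<lambda>k. Hh z *v k - Hu *v k)) (at z)"
    unfolding g_def using Hu(1) Hh[OF z\<Omega>] by (auto intro!: derivative_eq_intros)
  have "trace (Hh z) - trace Hu = (\<Sum>i\<in>UNIV. axis i 1 \<bullet> (Hh z *v axis i 1 - Hu *v axis i 1))"
    by (simp add: trace_eq_sum_inner sum_subtractf inner_diff_right)
  also have "\<dots> \<le> (\<Sum>i\<in>(UNIV::'n set). e * (axis i 1 \<bullet> (axis i 1 :: real^'n)))"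
    by (intro sum_mono zH[OF dg])
  also have "\<dots> = c" by (simp add: inner_axis_axis e_def)
  finally show False using Hu(2) d(2)[of z] z by (auto simp: dist_commute)
qed

lemma trace_outer_prod: "trace (outer_prod v w) = v \<bullet> w"
  by (simp add: trace_def outer_prod_def inner_vec_def)

lemma trace_scaleR: "trace (c *\<^sub>R (A :: real^'n::finite^'n)) = c * trace A"
  by (simp add: trace_def sum_distrib_left)

text \<open>With \<open>s = \<bar>y - x0\<bar>\<^sup>2\<close> the first term is a multiple of the fundamental solution, and the bracket is the Kelvin transform of the quadratic polynomial
  \<open>(e \<bullet> z)\<^sup>2 - c \<bar>z\<bar>\<^sup>2\<close>, which is harmonic for \<open>n c = \<bar>e\<bar>\<^sup>2\<close> and strictly subharmonic for smaller \<open>c\<close>.\<close>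
definition barrier :: "real^'n \<Rightarrow> real^'n \<Rightarrow> real \<Rightarrow> real \<Rightarrow> real \<Rightarrow> real^'n::finite \<Rightarrow> real" where
  "barrier x0 e a \<kappa> c y = (let n = real CARD('n); s = (y - x0) \<bullet> (y - x0) in
     a * s powr (- ((n - 2) / 2)) + \<kappa> * ((e \<bullet> (y - x0))\<^sup>2 * s powr (- ((n + 2) / 2)) - c * s powr (1 - (n + 2) / 2)))"

text \<open>The gradient has the form \<open>A (y - x0) + B e\<close>, and the terms of the Laplacian cancel up to
  \<open>\<kappa> s powr (- m) (2 \<bar>e\<bar>\<^sup>2 - 2 n c)\<close>.\<close>
lemma exterior_barrier:
  fixes x0 e :: "real^'n::finite" and a \<kappa> c :: real
  defines "n \<equiv> real CARD('n)"
  defines "k \<equiv> (n - 2) / 2" and "m \<equiv> (n + 2) / 2"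
  defines "s \<equiv> \<lambda>y. (y - x0) \<bullet> (y - x0)" and "t \<equiv> \<lambda>y. e \<bullet> (y - x0)"
  assumes \<kappa>: "\<kappa> > 0" "n * c < e \<bullet> e"
  obtains gh Hh where "C1lip (- {x0}) (barrier x0 e a \<kappa> c) gh"
    "\<And>x. x \<noteq> x0 \<Longrightarrow> (gh has_derivative (\<lambda>k. Hh x *v k)) (at x)"
    "\<And>x. x \<noteq> x0 \<Longrightarrow> trace (Hh x) > 0" "\<And>x. x \<noteq> x0 \<Longrightarrow> isCont (\<lambda>x. trace (Hh x)) x"
proof -
  define h where "h y = a * s y powr (- k) + \<kappa> * ((t y)\<^sup>2 * s y powr (- m) - c * s y powr (1 - m))" for y
  have hb: "barrier x0 e a \<kappa> c = h"
    by (simp add: fun_eq_iff barrier_def h_def n_def k_def m_def s_def t_def Let_def)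
  define A where "A y = - 2 * k * a * s y powr (- k - 1)
      + \<kappa> * (- 2 * m * (t y)\<^sup>2 * s y powr (- m - 1) - 2 * (1 - m) * c * s y powr (- m))" for y
  define B where "B y = 2 * \<kappa> * t y * s y powr (- m)" for y
  define \<alpha>1 where "\<alpha>1 y = 4 * k * (k + 1) * a * s y powr (- k - 2)
      + \<kappa> * (4 * m * (m + 1) * (t y)\<^sup>2 * s y powr (- m - 2) + 4 * m * (1 - m) * c * s y powr (- m - 1))" for y
  define \<alpha>2 where "\<alpha>2 y = - 4 * \<kappa> * m * t y * s y powr (- m - 1)" for y
  define gh where "gh y = A y *\<^sub>R (y - x0) + B y *\<^sub>R e" for y
  define Hh where "Hh y = A y *\<^sub>R mat 1 + outer_prod (y - x0) (\<alpha>1 y *\<^sub>R (y - x0) + \<alpha>2 y *\<^sub>R e)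
      + outer_prod e (\<alpha>2 y *\<^sub>R (y - x0) + (2 * \<kappa> * s y powr (- m)) *\<^sub>R e)" for y
  have spos: "s y > 0" if "y \<noteq> x0" for y using that by (simp add: s_def)
  have ds: "(s has_derivative (\<lambda>h. 2 * ((y - x0) \<bullet> h))) (at y)" for y
    unfolding s_def by (auto intro!: derivative_eq_intros simp: inner_commute)
  have dt: "(t has_derivative (\<lambda>h. e \<bullet> h)) (at y)" for y
    unfolding t_def by (auto intro!: derivative_eq_intros)
  have dt2: "((\<lambda>y. (t y)\<^sup>2) has_derivative (\<lambda>h. 2 * t y * (e \<bullet> h))) (at y)" for y
    by (auto intro!: derivative_eq_intros dt simp: mult_ac)
  have dpow: "((\<lambda>y. s y powr p) has_derivative (\<lambda>h. 2 * p * s y powr (p - 1) * ((y - x0) \<bullet> h))) (at y)"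
    if "y \<noteq> x0" for y p
  proof -
    have "((\<lambda>z. z powr p) has_derivative (*) (p * s y powr (p - 1))) (at (s y))"
      using has_real_derivative_powr[OF spos[OF that], of p] by (simp add: has_field_derivative_def)
    from has_derivative_compose[OF ds this] show ?thesis
      by (rule has_derivative_eq_rhs) (auto simp: fun_eq_iff)
  qed
  have dh: "(h has_derivative (\<lambda>k. gh y \<bullet> k)) (at y)" if y: "y \<noteq> x0" for y
    unfolding h_def
  proof (rule has_derivative_eq_rhs, (rule dpow[OF y] dt2 derivative_intros)+, intro ext)
    fix h
    have "1 - m - 1 = - m" by simp
    then show "a * (2 * (- k) * s y powr (- k - 1) * ((y - x0) \<bullet> h)) +
         \<kappa> * ((t y)\<^sup>2 * (2 * (- m) * s y powr (- m - 1) * ((y - x0) \<bullet> h)) + 2 * t y * (e \<bullet> h) * s y powr (- m) -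
          c * (2 * (1 - m) * s y powr (1 - m - 1) * ((y - x0) \<bullet> h))) = gh y \<bullet> h"
      by (simp add: gh_def A_def B_def inner_add_left algebra_simps)
  qed
  have dA: "(A has_derivative (\<lambda>h. (\<alpha>1 y *\<^sub>R (y - x0) + \<alpha>2 y *\<^sub>R e) \<bullet> h)) (at y)" if y: "y \<noteq> x0" for y
    unfolding A_def
  proof (rule has_derivative_eq_rhs, (rule dpow[OF y] dt2 derivative_intros)+, intro ext)
    fix h
    have "- k - 1 - 1 = - k - 2" "- m - 1 - 1 = - m - 2" by auto
    then show "- 2 * k * a * (2 * (- k - 1) * s y powr (- k - 1 - 1) * ((y - x0) \<bullet> h)) +
         \<kappa> * (- 2 * m * (t y)\<^sup>2 * (2 * (- m - 1) * s y powr (- m - 1 - 1) * ((y - x0) \<bullet> h))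
             + - 2 * m * (2 * t y * (e \<bullet> h)) * s y powr (- m - 1) -
          2 * (1 - m) * c * (2 * (- m) * s y powr (- m - 1) * ((y - x0) \<bullet> h))) = (\<alpha>1 y *\<^sub>R (y - x0) + \<alpha>2 y *\<^sub>R e) \<bullet> h"
      by (simp add: \<alpha>1_def \<alpha>2_def inner_add_left algebra_simps)
  qed
  have dB: "(B has_derivative (\<lambda>h. (\<alpha>2 y *\<^sub>R (y - x0) + (2 * \<kappa> * s y powr (- m)) *\<^sub>R e) \<bullet> h)) (at y)" if y: "y \<noteq> x0" for y
    unfolding B_def
  proof (rule has_derivative_eq_rhs, (rule dpow[OF y] dt derivative_intros)+, intro ext)
    fix h
    show "2 * \<kappa> * t y * (2 * (- m) * s y powr (- m - 1) * ((y - x0) \<bullet> h)) + 2 * \<kappa> * (e \<bullet> h) * s y powr (- m)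
        = (\<alpha>2 y *\<^sub>R (y - x0) + (2 * \<kappa> * s y powr (- m)) *\<^sub>R e) \<bullet> h"
      by (simp add: \<alpha>2_def inner_add_left algebra_simps)
  qed
  have dgh: "(gh has_derivative (\<lambda>k. Hh y *v k)) (at y)" if y: "y \<noteq> x0" for y
    unfolding gh_def
  proof (rule has_derivative_eq_rhs, (rule dA[OF y] dB[OF y] derivative_intros)+, intro ext)
    fix h
    show "A y *\<^sub>R (h - 0) + ((\<alpha>1 y *\<^sub>R (y - x0) + \<alpha>2 y *\<^sub>R e) \<bullet> h) *\<^sub>R (y - x0)
        + ((\<alpha>2 y *\<^sub>R (y - x0) + (2 * \<kappa> * s y powr (- m)) *\<^sub>R e) \<bullet> h) *\<^sub>R e = Hh y *v h"
      by (simp add: Hh_def matrix_vector_mult_add_rdistrib scaleR_matrix_vector_assoc[symmetric] outer_prod_mult_vec)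
  qed
  have trace: "trace (Hh y) = \<kappa> * s y powr (- m) * (2 * (e \<bullet> e) - 2 * n * c)" if y: "y \<noteq> x0" for y
  proof -
    have sy: "s y > 0" by (rule spos[OF y])
    define P where "P = s y powr (- m - 1)"
    define Q where "Q = s y powr (- k - 1)"
    have pa: "s y powr p * s y = s y powr q" if "q = p + 1" for p q using sy that by (simp add: powr_add)
    have pw: "s y powr (- k - 2) * s y = Q" "s y powr (- m - 2) * s y = P" "s y powr (- m) = P * s y"
      unfolding P_def Q_def by (rule pa pa[symmetric]; simp)+
    have "trace (Hh y) = n * A y + (\<alpha>1 y * s y + \<alpha>2 y * t y) + (\<alpha>2 y * t y + 2 * \<kappa> * s y powr (- m) * (e \<bullet> e))"
      by (simp add: Hh_def trace_add trace_scaleR trace_I trace_outer_prod inner_add_right n_def s_def t_def inner_commute)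
    also have "\<alpha>1 y * s y = 4 * k * (k + 1) * a * (s y powr (- k - 2) * s y)
      + \<kappa> * (4 * m * (m + 1) * (t y)\<^sup>2 * (s y powr (- m - 2) * s y) + 4 * m * (1 - m) * c * (P * s y))"
      by (simp add: \<alpha>1_def P_def algebra_simps)
    also have "\<dots> = 4 * k * (k + 1) * a * Q + \<kappa> * (4 * m * (m + 1) * (t y)\<^sup>2 * P + 4 * m * (1 - m) * c * (P * s y))"
      unfolding pw(1,2) ..
    also have "n * A y + (\<dots> + \<alpha>2 y * t y) + (\<alpha>2 y * t y + 2 * \<kappa> * s y powr (- m) * (e \<bullet> e))
       = 2 * k * a * Q * (2 * k + 2 - n) + \<kappa> * ((t y)\<^sup>2 * P * (2 * m) * (2 * m - 2 - n)
         + P * s y * (2 * (1 - m) * c * (2 * m - n) + 2 * (e \<bullet> e)))"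
      unfolding A_def \<alpha>2_def P_def[symmetric] Q_def[symmetric] pw(3) by (simp add: algebra_simps power2_eq_square)
    also have "\<dots> = \<kappa> * (P * s y) * (2 * (e \<bullet> e) - 2 * n * c)"
      by (simp add: k_def m_def field_simps)
    finally show ?thesis using pw(3) by simp
  qed
  show ?thesis
  proof (rule that[of gh Hh])
    show "C1lip (- {x0}) (barrier x0 e a \<kappa> c) gh"
      unfolding hb C1lip_def using dh dgh by (auto intro!: differentiable_imp_lip_at intro: differentiableI)
    fix x assume x: "x \<noteq> x0"
    show "(gh has_derivative (\<lambda>k. Hh x *v k)) (at x)" by (rule dgh[OF x])
    show "trace (Hh x) > 0" unfolding trace[OF x] using \<kappa> spos[OF x] by simp
    have "isCont (\<lambda>y. \<kappa> * s y powr (- m) * (2 * (e \<bullet> e) - 2 * n * c)) x"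
      by (intro isCont_mult continuous_const has_derivative_continuous[OF dpow[OF x, of "- m"]])
    moreover have "\<forall>\<^sub>F y in nhds x. \<kappa> * s y powr (- m) * (2 * (e \<bullet> e) - 2 * n * c) = trace (Hh y)"
      using t1_space_nhds[OF x] by eventually_elim (simp add: trace)
    ultimately show "isCont (\<lambda>x. trace (Hh x)) x" using isCont_cong by fastforce
  qed
qed

text \<open>The barrier tends to \<open>0\<close> at infinity while \<open>u\<close> is positive, so the set where the barrier exceeds \<open>u\<close> by a
  fixed amount is compact.\<close>
lemma exterior_lower_bound:
  fixes u :: "real^'n::finite \<Rightarrow> real"
  assumes n: "CARD('n) \<ge> 3"
    and u: "C1lip UNIV u gu" "superharmonic_AE UNIV gu" "\<And>x. u x > 0"
    and \<kappa>: "\<kappa> > 0" "real CARD('n) * c < e \<bullet> e" and R: "R > 0"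
    and bd: "\<And>y. norm (y - x0) = R \<Longrightarrow> barrier x0 e a \<kappa> c y \<le> u y"
    and y: "norm (y - x0) \<ge> R"
  shows "barrier x0 e a \<kappa> c y \<le> u y"
proof (cases "norm (y - x0) = R")
  case False
  define \<Omega> where "\<Omega> = {y. norm (y - x0) > R}"
  let ?h = "barrier x0 e a \<kappa> c"
  obtain gh Hh where h: "C1lip (- {x0}) ?h gh"
    "\<And>x. x \<noteq> x0 \<Longrightarrow> (gh has_derivative (\<lambda>k. Hh x *v k)) (at x)"
    "\<And>x. x \<noteq> x0 \<Longrightarrow> trace (Hh x) > 0" "\<And>x. x \<noteq> x0 \<Longrightarrow> isCont (\<lambda>x. trace (Hh x)) x"
    using exterior_barrier[OF \<kappa>, of x0 a] by blast
  have ne: "x \<noteq> x0" if "x \<in> \<Omega>" for x using that R by (auto simp: \<Omega>_def)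
  define k where "k = (real CARD('n) - 2) / 2"
  have k: "k > 0" using n by (simp add: k_def)
  define C where "C = \<bar>a\<bar> + \<kappa> * (e \<bullet> e + \<bar>c\<bar>)"
  have hC: "?h z \<le> C * ((z - x0) \<bullet> (z - x0)) powr (- k)" if z: "(z - x0) \<bullet> (z - x0) \<ge> 1" for z
  proof -
    define s where "s = (z - x0) \<bullet> (z - x0)"
    have s1: "s \<ge> 1" using z by (simp add: s_def)
    have "(e \<bullet> (z - x0))\<^sup>2 \<le> (e \<bullet> e) * s" using Cauchy_Schwarz_ineq[of e "z - x0"] by (simp add: s_def)
    then have "(e \<bullet> (z - x0))\<^sup>2 * s powr (- ((real CARD('n) + 2) / 2)) \<le> (e \<bullet> e) * s * s powr (- ((real CARD('n) + 2) / 2))"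
      by (intro mult_right_mono) auto
    also have "\<dots> = (e \<bullet> e) * s powr (1 - (real CARD('n) + 2) / 2)"
      using s1 powr_add[of s 1 "- ((real CARD('n) + 2) / 2)"] by simp
    finally have 1: "(e \<bullet> (z - x0))\<^sup>2 * s powr (- ((real CARD('n) + 2) / 2)) - c * s powr (1 - (real CARD('n) + 2) / 2)
        \<le> (e \<bullet> e + \<bar>c\<bar>) * s powr (1 - (real CARD('n) + 2) / 2)"
      using mult_right_mono[OF abs_ge_minus_self[of c] powr_ge_zero[of s "1 - (real CARD('n) + 2) / 2"]]
      by (simp add: distrib_right)
    also have "\<dots> \<le> (e \<bullet> e + \<bar>c\<bar>) * s powr (- k)"
      using s1 by (intro mult_left_mono powr_mono) (auto simp: k_def field_simps)
    finally have "\<kappa> * ((e \<bullet> (z - x0))\<^sup>2 * s powr (- ((real CARD('n) + 2) / 2)) - c * s powr (1 - (real CARD('n) + 2) / 2))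
        \<le> \<kappa> * ((e \<bullet> e + \<bar>c\<bar>) * s powr (- k))" using \<kappa>(1) by simp
    moreover have "a * s powr (- k) \<le> \<bar>a\<bar> * s powr (- k)" by (intro mult_right_mono) auto
    ultimately show ?thesis
      unfolding barrier_def Let_def s_def[symmetric] k_def[symmetric] C_def by (simp only: distrib_right mult.assoc)
  qed
  have lim: "\<exists>B. \<forall>z. norm (z - x0) \<ge> B \<longrightarrow> ?h z < \<eta>" if eta: "\<eta> > 0" for \<eta>
  proof -
    have "((\<lambda>s. C * s powr (- k)) \<longlongrightarrow> C * 0) at_top"
      using k by (intro tendsto_intros tendsto_neg_powr filterlim_ident) auto
    then have "\<forall>\<^sub>F s in at_top. C * s powr (- k) < \<eta>" using eta by (intro order_tendstoD(2)) auto
    then obtain S where S: "\<And>s. s \<ge> S \<Longrightarrow> C * s powr (- k) < \<eta>" by (auto simp: eventually_at_top_linorder)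
    have "?h z < \<eta>" if z: "norm (z - x0) \<ge> \<bar>S\<bar> + 1" for z
    proof -
      have "norm (z - x0) * 1 \<le> norm (z - x0) * norm (z - x0)" using z by (intro mult_left_mono) auto
      then have "(z - x0) \<bullet> (z - x0) \<ge> \<bar>S\<bar> + 1"
        using z by (simp add: power2_norm_eq_inner[symmetric] power2_eq_square)
      then show ?thesis using S[of "(z - x0) \<bullet> (z - x0)"] hC[of z] by linarith
    qed
    then show ?thesis by blast
  qed
  show ?thesis
  proof (rule superharmonic_comparison[of \<Omega> u gu ?h gh Hh])
    show "C1lip \<Omega> u gu" using u(1) by (auto simp: C1lip_def)
    show "superharmonic_AE \<Omega> gu" using u(2) unfolding superharmonic_AE_def by (rule negligible_subset) auto
    show "C1lip \<Omega> ?h gh" using h(1) ne by (auto simp: C1lip_def)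
    show "open \<Omega>" unfolding \<Omega>_def by (intro open_Collect_less continuous_intros)
    show "y \<in> \<Omega>" using y False by (simp add: \<Omega>_def)
    fix \<eta> :: real assume eta: "\<eta> > 0"
    define S where "S = {y. norm (y - x0) \<ge> R}"
    have "closed S" unfolding S_def by (intro closed_Collect_le continuous_intros)
    moreover have "continuous_on S (\<lambda>x. ?h x - u x)"
    proof (intro continuous_at_imp_continuous_on ballI continuous_intros)
      fix z assume "z \<in> S"
      then have "z \<noteq> x0" using R by (auto simp: S_def)
      then show "isCont ?h z" using C1lip_isCont(1)[OF h(1)] by simp
      show "isCont u z" using C1lip_isCont(1)[OF u(1)] by simp
    qed
    ultimately have "closed (S \<inter> (\<lambda>x. ?h x - u x) -` {\<eta>..})"
      by (intro continuous_closed_preimage) auto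
    moreover have "S \<inter> (\<lambda>x. ?h x - u x) -` {\<eta>..} = {x\<in>\<Omega>. ?h x - u x \<ge> \<eta>}"
    proof -
      have "R < norm (z - x0)" if "?h z - u z \<ge> \<eta>" "R \<le> norm (z - x0)" for z
        using bd[of z] that eta by (cases "norm (z - x0) = R") auto
      then show ?thesis by (auto simp: S_def \<Omega>_def)
    qed
    moreover have "bounded {x\<in>\<Omega>. ?h x - u x \<ge> \<eta>}"
    proof -
      obtain B where B: "\<And>z. norm (z - x0) \<ge> B \<Longrightarrow> ?h z < \<eta>" using lim[OF eta] by blast
      have "z \<in> cball x0 B" if "?h z - u z \<ge> \<eta>" for z
        using B[of z] u(3)[of z] that by (force simp: dist_norm norm_minus_commute)
      then show ?thesis by (intro bounded_subset[OF bounded_cball[of x0 B]]) auto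
    qed
    ultimately show "compact {x\<in>\<Omega>. ?h x - u x \<ge> \<eta>}" by (simp add: compact_eq_bounded_closed)
  qed (use h ne in auto)
qed (use bd in auto)

section \<open>The growth of entire solutions\<close>

text \<open>Near infinity a positive superharmonic function is bounded below by a multiple of the fundamental solution. The term with \<open>s powr (- n/2)\<close> makes
  the comparison function strictly subharmonic.\<close>
lemma growth_finite:
  fixes u w :: "real^'n::finite \<Rightarrow> real"
  assumes n: "CARD('n) \<ge> 3"
    and u: "C1lip UNIV u gu" "superharmonic_AE UNIV gu" "\<And>x. u x > 0"
    and w: "\<And>x. w x = u x powr (- (2 / (real CARD('n) - 2)))"
  shows "\<exists>b>0. quadratic_growth w b"
proof -
  define k where "k = (real CARD('n) - 2) / 2"
  have k: "k > 0" using n by (simp add: k_def)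
  have "continuous_on (sphere 0 1) u"
    by (intro continuous_at_imp_continuous_on ballI) (use C1lip_isCont(1)[OF u(1)] in auto)
  then obtain z0 where z0: "\<forall>z\<in>sphere 0 1. u z0 \<le> u z"
    using continuous_attains_inf[of "sphere 0 1" u] by auto
  define a where "a = u z0 / 2"
  have a: "a > 0" using u(3)[of z0] by (simp add: a_def)
  define b where "b = a powr (- (1 / k))"
  have "w y \<le> b * (y \<bullet> y)" if y: "norm y \<ge> 1" for y
  proof -
    define s where "s = y \<bullet> y"
    have s: "s > 0" using y by (auto simp: s_def)
    have "barrier 0 0 a a (-1) y \<le> u y"
    proof (rule exterior_lower_bound[OF n u])
      fix y :: "real^'n" assume "norm (y - 0) = 1"
      then have "y \<bullet> y = 1" "y \<in> sphere 0 1" by (auto simp: norm_eq_1)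
      then show "barrier 0 0 a a (- 1) y \<le> u y" using z0 by (simp add: barrier_def a_def)
    qed (use a n y in auto)
    then have "a * s powr (- k) + a * s powr (1 - (real CARD('n) + 2) / 2) \<le> u y"
      by (simp add: barrier_def Let_def s_def k_def)
    moreover have "a * s powr (1 - (real CARD('n) + 2) / 2) \<ge> 0" using a by simp
    ultimately have "a * s powr (- k) \<le> u y" by linarith
    then have "u y powr (- (1 / k)) \<le> (a * s powr (- k)) powr (- (1 / k))"
      using a s k by (intro powr_mono2') auto
    also have "\<dots> = b * s" using a s k by (simp add: powr_mult powr_powr b_def)
    finally show ?thesis by (simp add: w k_def s_def)
  qed
  then have "quadratic_growth w b" unfolding quadratic_growth_def eventually_at_infinity by blast
  moreover have "b > 0" using a by (simp add: b_def)
  ultimately show ?thesis by blast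
qed

text \<open>Suppose the slopes differ by \<open>2 e\<close>. Centred at a suitable point \<open>x0\<close>, the smaller of the two bounds is
  \<open>\<gamma> \<bar>z\<bar>\<^sup>2 - \<bar>e \<bullet> z\<bar> + C\<close> with \<open>z = y - x0\<close>. On a large sphere of radius \<open>R\<close> the term \<open>\<bar>e \<bullet> z\<bar>\<close> lies above a multiple of
  \<open>(e \<bullet> z)\<^sup>2\<close>, whose mean over the sphere is of order \<open>R\<close> and thus outweighs \<open>C\<close>. This lets the leading coefficient of a
  barrier below \<open>u\<close> be larger than \<open>\<gamma> powr (- k)\<close>, \<open>k = (n - 2)/2\<close>, by a fixed factor \<open>1 + \<delta>\<close>.\<close>
lemma asymptotic_slope_unique:
  fixes u w :: "real^'n::finite \<Rightarrow> real"
  assumes n: "CARD('n) \<ge> 3"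
    and u: "C1lip UNIV u gu" "superharmonic_AE UNIV gu" "\<And>x. u x > 0"
    and w: "\<And>x. w x = u x powr (- (2 / (real CARD('n) - 2)))"
    and \<gamma>: "\<gamma> > 0" "\<And>b. 0 \<le> b \<Longrightarrow> b < \<gamma> \<Longrightarrow> \<not> quadratic_growth w b"
    and q1: "\<forall>\<^sub>F y in at_infinity. w y \<le> \<gamma> * (y \<bullet> y) + q1 \<bullet> y + C1"
    and q2: "\<forall>\<^sub>F y in at_infinity. w y \<le> \<gamma> * (y \<bullet> y) + q2 \<bullet> y + C2"
  shows "q1 = q2"
proof (rule ccontr)
  assume "q1 \<noteq> q2"
  define N where "N = real CARD('n)"
  have N: "N \<ge> 3" using n by (simp add: N_def)
  define k where "k = (N - 2) / 2"
  have k: "k > 0" "(N + 2) / 2 = k + 2" "1 - (N + 2) / 2 = - k - 1" "2 / (N - 2) = 1 / k"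
    using N by (auto simp: k_def field_simps)
  define e where "e = (1/2) *\<^sub>R (q1 - q2)"
  define p where "p = (1/2) *\<^sub>R (q1 + q2)"
  have q: "q1 = p + e" "q2 = p - e"
    by (simp_all add: p_def e_def scaleR_add_right[symmetric] scaleR_diff_right[symmetric] scaleR_2[symmetric])
  have e0: "norm e > 0" using \<open>q1 \<noteq> q2\<close> by (simp add: e_def)
  define x0 where "x0 = (- 1 / (2 * \<gamma>)) *\<^sub>R p"
  define C where "C = max 0 (max (C1 + q1 \<bullet> x0) (C2 + q2 \<bullet> x0) + \<gamma> * (x0 \<bullet> x0))"
  have px: "p = - (2 * \<gamma>) *\<^sub>R x0" using \<gamma>(1) by (simp add: x0_def)
  have ex: "\<gamma> * (y \<bullet> y) + q \<bullet> y = \<gamma> * ((y - x0) \<bullet> (y - x0)) + (q - p) \<bullet> (y - x0) + q \<bullet> x0 + \<gamma> * (x0 \<bullet> x0)" for y q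
    unfolding px by (simp add: inner_diff_left inner_diff_right inner_add_left inner_commute algebra_simps)
  have "\<forall>\<^sub>F y in at_infinity. w y \<le> \<gamma> * ((y - x0) \<bullet> (y - x0)) - \<bar>e \<bullet> (y - x0)\<bar> + C"
    using q1 q2
  proof eventually_elim
    case (elim y)
    have "w y \<le> \<gamma> * ((y - x0) \<bullet> (y - x0)) + e \<bullet> (y - x0) + C"
      using elim(1) ex[of y q1] q(1) by (simp add: C_def)
    moreover have "w y \<le> \<gamma> * ((y - x0) \<bullet> (y - x0)) - e \<bullet> (y - x0) + C"
      using elim(2) ex[of y q2] q(2) by (simp add: C_def)
    ultimately show ?case by (simp add: abs_if)
  qed
  then obtain R0 where R0: "R0 > 0"
    "\<And>y. norm (y - x0) \<ge> R0 \<Longrightarrow> w y \<le> \<gamma> * ((y - x0) \<bullet> (y - x0)) - \<bar>e \<bullet> (y - x0)\<bar> + C"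
    unfolding at_infinity_shift_iff[of _ x0] by blast
  define c where "c = (e \<bullet> e) / (2 * N)"
  have c: "c > 0" "N * c < e \<bullet> e" using e0 N by (auto simp: c_def)
  \<comment> \<open>so large that the gain of order \<open>R\<close> outweighs \<open>C\<close>\<close>
  define R where "R = max R0 (C * norm e / c + 1)"
  have R: "R > 0" "R \<ge> R0" using R0 by (auto simp: R_def)
  have Rc: "R * c / norm e - C > 0"
  proof -
    have "C * norm e / c < R" by (simp add: R_def)
    then show ?thesis using c(1) e0 by (simp add: field_simps)
  qed
  \<comment> \<open>the largest value for which the quadratic term stays below \<open>\<bar>e \<bullet> z\<bar>\<close> on the sphere of radius \<open>R\<close>\<close>
  define \<kappa> where "\<kappa> = k * R / (\<gamma> * norm e)"
  have kap: "\<kappa> > 0" using k \<gamma> R e0 by (simp add: \<kappa>_def)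
  \<comment> \<open>what remains after the quadratic term has compensated \<open>C\<close>\<close>
  define \<delta> where "\<delta> = k / (\<gamma> * R\<^sup>2) * (R * c / norm e - C)"
  have del: "\<delta> > 0" using k \<gamma> R Rc by (simp add: \<delta>_def)
  define a where "a = \<gamma> powr (- k)"
  have a: "a > 0" using \<gamma> by (simp add: a_def)
  have barrier_eq: "barrier x0 e (a * (1 + \<delta>)) (a * \<kappa>) c y =
      a * s powr (- k) * (1 + \<delta> + \<kappa> * ((e \<bullet> (y - x0))\<^sup>2 / s\<^sup>2 - c / s))"
    if s: "s = (y - x0) \<bullet> (y - x0)" "s > 0" for y s
  proof -
    have f1: "s powr (- (k + 2)) = s powr (- k) / s\<^sup>2"
      using s(2) by (simp add: powr_diff powr_minus powr_add field_simps)
    have "1 - (k + 2) = - k - 1" by simp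
    then have f2: "s powr (1 - (k + 2)) = s powr (- k) / s" using s(2) by (simp only:) (simp add: powr_diff)
    show ?thesis
      unfolding barrier_def Let_def N_def[symmetric] k(2) k_def[symmetric] s(1)[symmetric]
      unfolding f1 f2 by (simp add: algebra_simps)
  qed
  have lower: "barrier x0 e (a * (1 + \<delta>)) (a * \<kappa>) c y \<le> u y" if y: "norm (y - x0) \<ge> R" for y
  proof (rule exterior_lower_bound[OF n u _ _ R(1) _ y])
    show "a * \<kappa> > 0" using a kap by simp
    show "real CARD('n) * c < e \<bullet> e" using c(2) by (simp add: N_def)
    fix y assume y: "norm (y - x0) = R"
    define t where "t = \<bar>e \<bullet> (y - x0)\<bar>"
    have s: "(y - x0) \<bullet> (y - x0) = R\<^sup>2" using y by (simp add: power2_norm_eq_inner[symmetric])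
    have t: "t \<le> norm e * R" "t \<ge> 0" using Cauchy_Schwarz_ineq2[of e "y - x0"] y by (simp_all add: t_def)
    define X where "X = (t - C) / (\<gamma> * R\<^sup>2)"
    have gR: "\<gamma> * R\<^sup>2 > 0" using \<gamma> R by simp
    have wle: "w y \<le> \<gamma> * R\<^sup>2 * (1 - X)"
    proof -
      have "\<gamma> * R\<^sup>2 * X = t - C" using \<gamma>(1) R(1) unfolding X_def by simp
      then show ?thesis using R0(2)[of y] y R(2) unfolding s t_def[symmetric] by (simp add: right_diff_distrib)
    qed
    have wpos: "w y > 0" using u(3)[of y] by (simp add: w)
    then have X1: "1 - X > 0" using wle gR by (smt (verit) mult_nonneg_nonpos)
    have br: "1 + \<delta> + \<kappa> * (t\<^sup>2 / (R\<^sup>2)\<^sup>2 - c / R\<^sup>2) \<le> 1 + k * X"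
    proof -
      have "\<kappa> * t\<^sup>2 / (R\<^sup>2)\<^sup>2 \<le> \<kappa> * (t * (norm e * R)) / (R\<^sup>2)\<^sup>2"
        using t kap by (intro divide_right_mono mult_left_mono) (auto simp: power2_eq_square intro: mult_left_mono)
      also have "\<dots> = k * t / (\<gamma> * R\<^sup>2)"
        using e0 R \<gamma> by (simp add: \<kappa>_def field_simps power2_eq_square)
      finally have "\<kappa> * t\<^sup>2 / (R\<^sup>2)\<^sup>2 \<le> k * t / (\<gamma> * R\<^sup>2)" .
      moreover have "\<delta> - \<kappa> * c / R\<^sup>2 = - (k * C / (\<gamma> * R\<^sup>2))"
        using e0 R \<gamma> by (simp add: \<delta>_def \<kappa>_def field_simps power2_eq_square)
      moreover have "k * X = k * t / (\<gamma> * R\<^sup>2) - k * C / (\<gamma> * R\<^sup>2)"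
        by (simp add: X_def diff_divide_distrib right_diff_distrib)
      ultimately show ?thesis by (simp add: right_diff_distrib)
    qed
    also have "1 + k * X \<le> (1 - X) powr (- k)"
    proof -
      have "ln (1 - X) \<le> - X" using ln_le_minus_one[OF X1] by simp
      then have "k * X \<le> - k * ln (1 - X)" using mult_left_mono[of "ln (1 - X)" "- X" k] k(1) by simp
      moreover have "1 + (- k * ln (1 - X)) \<le> exp (- k * ln (1 - X))" by (rule exp_ge_add_one_self)
      ultimately show ?thesis using X1 by (simp add: powr_def)
    qed
    finally have "a * (R\<^sup>2) powr (- k) * (1 + \<delta> + \<kappa> * (t\<^sup>2 / (R\<^sup>2)\<^sup>2 - c / R\<^sup>2))
        \<le> a * (R\<^sup>2) powr (- k) * (1 - X) powr (- k)" using a by (intro mult_left_mono) auto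
    also have "\<dots> = (\<gamma> * R\<^sup>2 * (1 - X)) powr (- k)"
      using \<gamma> gR X1 by (simp add: a_def powr_mult)
    also have "\<dots> \<le> w y powr (- k)" using wle wpos k(1) by (intro powr_mono2') auto
    also have "\<dots> = u y" using u(3)[of y] k by (simp add: w N_def[symmetric] powr_powr)
    finally show "barrier x0 e (a * (1 + \<delta>)) (a * \<kappa>) c y \<le> u y"
      using barrier_eq[OF s[symmetric]] R(1) by (simp add: t_def)
  qed
  define b where "b = \<gamma> * (1 + \<delta> / 2) powr (- (1 / k))"
  have b: "b > 0" "b < \<gamma>"
  proof -
    show "b > 0" using \<gamma> del by (simp add: b_def)
    have "(1 + \<delta> / 2) powr (- (1 / k)) < (1 + \<delta> / 2) powr 0" using del k by (intro powr_less_mono) auto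
    then show "b < \<gamma>" using \<gamma> del by (simp add: b_def)
  qed
  have "w y \<le> b * ((y - x0) \<bullet> (y - x0))" if y: "norm (y - x0) \<ge> R + 2 * \<kappa> * c / \<delta> + 1" for y
  proof -
    define s where "s = (y - x0) \<bullet> (y - x0)"
    have pos: "2 * \<kappa> * c / \<delta> \<ge> 0" using kap c del by simp
    have y1: "norm (y - x0) \<ge> R" "norm (y - x0) \<ge> 1" "norm (y - x0) \<ge> 2 * \<kappa> * c / \<delta>"
      using y pos R(1) by linarith+
    have "norm (y - x0) * 1 \<le> norm (y - x0) * norm (y - x0)" using y1 by (intro mult_left_mono) auto
    then have s: "s \<ge> 1" "s \<ge> 2 * \<kappa> * c / \<delta>"
      using y1 by (simp_all add: s_def power2_norm_eq_inner[symmetric] power2_eq_square)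
    have "\<kappa> * c / s \<le> \<delta> / 2" using s del by (simp add: field_simps)
    then have "1 + \<delta> / 2 \<le> 1 + \<delta> + \<kappa> * ((e \<bullet> (y - x0))\<^sup>2 / s\<^sup>2 - c / s)"
    proof -
      have "\<kappa> * ((e \<bullet> (y - x0))\<^sup>2 / s\<^sup>2) \<ge> 0" using kap by simp
      moreover have "\<kappa> * (c / s) \<le> \<delta> / 2" using \<open>\<kappa> * c / s \<le> \<delta> / 2\<close> by simp
      ultimately show ?thesis unfolding right_diff_distrib by linarith
    qed
    then have "a * s powr (- k) * (1 + \<delta> / 2) \<le> a * s powr (- k) * (1 + \<delta> + \<kappa> * ((e \<bullet> (y - x0))\<^sup>2 / s\<^sup>2 - c / s))"
      using a by (intro mult_left_mono) auto
    also have "\<dots> = barrier x0 e (a * (1 + \<delta>)) (a * \<kappa>) c y" by (rule barrier_eq[OF s_def, symmetric]) (use s in simp)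
    also have "\<dots> \<le> u y" by (rule lower[OF y1(1)])
    finally have "u y powr (- (1 / k)) \<le> (a * s powr (- k) * (1 + \<delta> / 2)) powr (- (1 / k))"
      using a s del k by (intro powr_mono2') auto
    also have "\<dots> = b * s"
      using a s del k \<gamma> by (simp add: powr_mult powr_powr b_def a_def)
    finally show ?thesis by (simp add: w N_def[symmetric] k(4) s_def)
  qed
  moreover have "R + 2 * \<kappa> * c / \<delta> + 1 > 0" using R kap c del by (simp add: add_pos_nonneg)
  ultimately have ev: "\<forall>\<^sub>F y in at_infinity. w y \<le> b * ((y - x0) \<bullet> (y - x0))"
    unfolding at_infinity_shift_iff[of _ x0] by blast
  obtain b' where b': "b < b'" "b' < \<gamma>" using dense[OF b(2)] by blast
  have "quadratic_growth w b'" using quadratic_growth_recentre[OF ev b'(1), of 0] b(1) by (simp add: quadratic_growth_def)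
  then show False using \<gamma>(2)[of b'] b b' by simp
qed

context entire_solution
begin

text \<open>If \<open>\<gamma> > 0\<close>, the gradient of \<open>w\<close> is \<open>2 \<gamma> x\<close> plus a constant. Then \<open>A(w) = \<Phi> I\<close> with \<open>\<Phi> = 2 \<gamma> w - 1/2 \<bar>\<nabla>w\<bar>\<^sup>2\<close> constant,
  and \<open>\<Phi>\<close> is positive at the critical point of \<open>w\<close>.\<close>
theorem liouville:
  assumes n: "CARD('n) \<ge> 3"
    and u: "C1lip UNIV u gu" "superharmonic_AE UNIV gu" "\<And>x. u x > 0"
    and w: "\<And>x. w x = u x powr (- (2 / (real CARD('n) - 2)))"
    and id_U: "\<And>c. c > 0 \<Longrightarrow> c *\<^sub>R mat 1 \<in> U"
  shows "w p = w q"
proof -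
  define G where "G = {b. b > 0 \<and> quadratic_growth w b}"
  define \<gamma> where "\<gamma> = Inf G"
  have Gne: "G \<noteq> {}" using growth_finite[OF n u w] by (auto simp: G_def)
  have bdd: "bdd_below G" by (rule bdd_belowI[of _ 0]) (auto simp: G_def)
  have g0: "\<gamma> \<ge> 0" unfolding \<gamma>_def using Gne by (intro cInf_greatest) (auto simp: G_def)
  have above: "quadratic_growth w b" if b: "b > \<gamma>" for b
  proof -
    obtain b' where b': "b' \<in> G" "b' < b" using b Gne unfolding \<gamma>_def by (meson cInf_lessD)
    have "\<forall>\<^sub>F y in at_infinity. w y \<le> b' * (y \<bullet> y)" using b'(1) by (simp add: G_def quadratic_growth_def)
    then show ?thesis unfolding quadratic_growth_def
    proof eventually_elim
      case (elim y)
      have "b' * (y \<bullet> y) \<le> b * (y \<bullet> y)" using b'(2) by (intro mult_right_mono) auto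
      then show ?case using elim by simp
    qed
  qed
  have "\<gamma> = 0"
  proof (rule ccontr)
    assume "\<gamma> \<noteq> 0"
    then have gp: "\<gamma> > 0" using g0 by simp
    have below: "\<not> quadratic_growth w b" if b: "0 \<le> b" "b < \<gamma>" for b
    proof
      assume g: "quadratic_growth w b"
      obtain b' where b': "b < b'" "b' < \<gamma>" using dense[OF b(2)] by blast
      have "quadratic_growth w b'" using quadratic_growth_recentre[of w b 0 b' 0] g b' b by (simp add: quadratic_growth_def)
      then have "b' \<in> G" using b b' by (simp add: G_def)
      then have "\<gamma> \<le> b'" unfolding \<gamma>_def by (intro cInf_lower bdd)
      then show False using b' by simp
    qed
    have asy: "\<exists>C. \<forall>\<^sub>F y in at_infinity. w y \<le> \<gamma> * (y \<bullet> y) + (g x - (2 * \<gamma>) *\<^sub>R x) \<bullet> y + C" for x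
    proof -
      obtain C where "\<forall>\<^sub>F y in at_infinity. w y \<le> \<gamma> * ((y - x) \<bullet> (y - x)) + g x \<bullet> (y - x) + C"
        using asymptotic_expansion_bound[OF gp above] by blast
      then have "\<forall>\<^sub>F y in at_infinity. w y \<le> \<gamma> * (y \<bullet> y) + (g x - (2 * \<gamma>) *\<^sub>R x) \<bullet> y + (C + \<gamma> * (x \<bullet> x) - g x \<bullet> x)"
        by eventually_elim (simp add: inner_diff_left inner_diff_right inner_commute algebra_simps)
      then show ?thesis by blast
    qed
    have slope: "g x - (2 * \<gamma>) *\<^sub>R x = g 0 - (2 * \<gamma>) *\<^sub>R 0" for x
    proof -
      obtain C C' where A: "\<forall>\<^sub>F y in at_infinity. w y \<le> \<gamma> * (y \<bullet> y) + (g x - (2 * \<gamma>) *\<^sub>R x) \<bullet> y + C"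
        and B: "\<forall>\<^sub>F y in at_infinity. w y \<le> \<gamma> * (y \<bullet> y) + (g 0 - (2 * \<gamma>) *\<^sub>R 0) \<bullet> y + C'"
        using asy[of x] asy[of 0] by blast
      show ?thesis by (rule asymptotic_slope_unique[OF n u w gp _ A B]) (rule below)
    qed
    have gx: "g x = (2 * \<gamma>) *\<^sub>R x + g 0" for x
      using arg_cong[OF slope[of x], of "\<lambda>v. v + (2 * \<gamma>) *\<^sub>R x"] by (simp only: diff_add_cancel) simp
    have dw: "(w has_derivative (\<lambda>h. g x \<bullet> h)) (at x)" for x using w_C1 by (simp add: C1lip_def)
    have dg: "(g has_derivative (\<lambda>h. (2 * \<gamma>) *\<^sub>R h)) (at x)" for x
    proof -
      have "((\<lambda>x. (2 * \<gamma>) *\<^sub>R x + g 0) has_derivative (\<lambda>h. (2 * \<gamma>) *\<^sub>R h)) (at x)"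
        by (auto intro!: derivative_eq_intros)
      moreover have "(\<lambda>x. (2 * \<gamma>) *\<^sub>R x + g 0) = g" by (rule ext) (rule gx[symmetric])
      ultimately show ?thesis by (simp only:)
    qed
    \<comment> \<open>the scalar factor of the tensor of \<open>w\<close>, as the Hessian is \<open>2 \<gamma> I\<close>\<close>
    define \<Phi> where "\<Phi> x = 2 * \<gamma> * w x - (g x \<bullet> g x) / 2" for x
    have "(\<Phi> has_derivative (\<lambda>h. 0)) (at x within UNIV)" for x
    proof -
      have "((\<lambda>x. 2 * \<gamma> * w x - (1 / 2) * (g x \<bullet> g x)) has_derivative
          (\<lambda>h. 2 * \<gamma> * (g x \<bullet> h) - (1 / 2) * (g x \<bullet> ((2 * \<gamma>) *\<^sub>R h) + ((2 * \<gamma>) *\<^sub>R h) \<bullet> g x))) (at x)"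
        by (intro has_derivative_diff has_derivative_mult_right has_derivative_inner dw dg)
      then show ?thesis unfolding \<Phi>_def by (simp add: inner_commute)
    qed
    then obtain c where c: "\<And>x. \<Phi> x = c"
      using has_derivative_zero_constant[of UNIV \<Phi>] by blast
    define x1 where "x1 = (- 1 / (2 * \<gamma>)) *\<^sub>R g 0"
    have "g x1 = 0" unfolding gx[of x1] using gp by (simp add: x1_def)
    then have "\<Phi> x1 > 0" using gp w_pos[of x1] by (simp add: \<Phi>_def)
    then have "c > 0" by (simp only: c)
    have "\<exists>x H. (g has_derivative (\<lambda>h. H *v h)) (at x) \<and> schouten (w x) (g x) H \<in> K - U"
    proof (rule ccontr)
      assume "\<not> ?thesis"
      then have eq: "{x\<in>UNIV. \<not> (\<exists>H. (g has_derivative (\<lambda>h. H *v h)) (at x) \<and> schouten (w x) (g x) H \<in> K - U)} = UNIV"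
        by blast
      show False using w_sol unfolding schouten_AE_def eq by simp
    qed
    then obtain x H where H: "(g has_derivative (\<lambda>h. H *v h)) (at x)" "schouten (w x) (g x) H \<in> K - U" by blast
    have "(\<lambda>h. H *v h) = (\<lambda>h. (2 * \<gamma>) *\<^sub>R h)" by (rule has_derivative_unique[OF H(1) dg])
    then have "H *v h = ((2 * \<gamma>) *\<^sub>R mat 1) *v h" for h
      by (simp add: fun_eq_iff scaleR_matrix_vector_assoc[symmetric])
    then have "H = (2 * \<gamma>) *\<^sub>R mat 1" by (simp add: matrix_eq)
    then have "schouten (w x) (g x) H = \<Phi> x *\<^sub>R mat 1"
      by (simp add: schouten_def \<Phi>_def scaleR_diff_left mult.commute)
    then show False using H(2) id_U[OF \<open>c > 0\<close>] c by simp
  qed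
  then show ?thesis using above by (intro constant_if_no_growth) auto
qed
end

section \<open>Second derivatives of functions with Lipschitz gradient\<close>

lemma vec_axis_expansion: "(h :: real^'n::finite) = (\<Sum>i\<in>UNIV. (h $ i) *\<^sub>R axis i 1)"
  using basis_expansion[of h] by (simp add: scalar_mult_eq_scaleR)

lemma has_derivative_imp_grad:
  fixes u :: "real^'n::finite \<Rightarrow> real"
  assumes "u differentiable (at x)"
  shows "(u has_derivative (\<lambda>h. grad u x \<bullet> h)) (at x)"
proof -
  obtain D where D: "(u has_derivative D) (at x)" using assms by (auto simp: differentiable_def)
  have lin: "linear D" by (rule has_derivative_linear[OF D])
  have dd: "grad u x $ i = D (axis i 1)" for i
  proof -
    have "((\<lambda>t. u (x + t *\<^sub>R axis i 1)) has_derivative (\<lambda>t. D (t *\<^sub>R axis i 1))) (at 0)"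
      by (rule has_derivative_compose[of "\<lambda>t. x + t *\<^sub>R axis i 1" "\<lambda>t. t *\<^sub>R axis i 1" 0 UNIV u])
        (auto intro!: derivative_eq_intros simp: D)
    then have "((\<lambda>t. u (x + t *\<^sub>R axis i 1)) has_field_derivative D (axis i 1)) (at 0)"
      unfolding has_field_derivative_def
      by (rule has_derivative_eq_rhs) (auto simp: linear_cmul[OF lin])
    then show ?thesis by (simp add: grad_def partial_def dir_deriv_def DERIV_imp_deriv)
  qed
  have "D h = grad u x \<bullet> h" for h
  proof -
    have "D h = D (\<Sum>i\<in>UNIV. (h $ i) *\<^sub>R axis i 1)" by (rule arg_cong[OF vec_axis_expansion])
    also have "\<dots> = (\<Sum>i\<in>UNIV. h $ i * D (axis i 1))" by (simp add: linear_sum[OF lin] linear_cmul[OF lin])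
    finally show ?thesis by (simp add: inner_vec_def dd mult.commute)
  qed
  then have "D = (\<lambda>h. grad u x \<bullet> h)" by auto
  then show ?thesis using D by simp
qed

lemma C11_on_imp_C1lip:
  assumes "C11_on UNIV u" shows "C1lip UNIV u (grad u)"
  unfolding C1lip_def
proof (intro ballI conjI)
  fix x
  show "(u has_derivative (\<lambda>h. grad u x \<bullet> h)) (at x)"
    using assms by (intro has_derivative_imp_grad) (simp add: C11_on_def)
  obtain e L where e: "e > 0" "L-lipschitz_on (ball x e) (grad u)"
    using assms unfolding C11_on_def by blast
  have "\<forall>\<^sub>F y in nhds x. norm (grad u y - grad u x) \<le> L * norm (y - x)"
    unfolding eventually_nhds_metric
    using lipschitz_onD[OF e(2)] e(1) by (intro exI[of _ e]) (auto simp: dist_norm norm_minus_commute)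
  then show "lip_at (grad u) x" by (auto simp: lip_at_def)
qed

text \<open>On a small ball the map agrees with its composition with the nearest-point projection, which is globally Lipschitz.\<close>
lemma locally_lipschitz_AE_differentiable:
  fixes g :: "'a::euclidean_space \<Rightarrow> 'b::euclidean_space"
  assumes "\<And>x. \<exists>e>0. \<exists>L. L-lipschitz_on (ball x e) g"
  shows "negligible {x. \<not> g differentiable (at x)}"
proof -
  have loc: "\<exists>e>0. negligible ({x. \<not> g differentiable (at x)} \<inter> ball a e)" for a
  proof -
    obtain e L where e: "e > 0" "L-lipschitz_on (ball a e) g" using assms by blast
    define r where "r = e / 2"
    have r: "r > 0" "cball a r \<subseteq> ball a e" using e by (auto simp: r_def)
    define P where "P = closest_point (cball a r)"
    have P: "P x \<in> cball a r" "dist (P x) (P y) \<le> dist x y" for x y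
      using r(1) closest_point_in_set[of "cball a r"] closest_point_lipschitz[of "cball a r"]
      by (auto simp: P_def)
    have L0: "L \<ge> 0" using e(2) lipschitz_on_nonneg by blast
    have "negligible {x. \<not> (\<lambda>x. g (P x) \<bullet> i) differentiable (at x)}" if i: "i \<in> Basis" for i
    proof (rule lipschitz_AE_differentiable)
      show "L-lipschitz_on UNIV (\<lambda>x. g (P x) \<bullet> i)"
      proof (rule lipschitz_onI[OF _ L0])
        fix x y
        have "dist (g (P x) \<bullet> i) (g (P y) \<bullet> i) \<le> dist (g (P x)) (g (P y))"
          using Basis_le_norm[OF i, of "g (P x) - g (P y)"] by (simp add: dist_norm inner_diff_left)
        also have "\<dots> \<le> L * dist (P x) (P y)" using P(1) r(2) by (intro lipschitz_onD[OF e(2)]) blast+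
        also have "\<dots> \<le> L * dist x y" using P(2) L0 by (rule mult_left_mono)
        finally show "dist (g (P x) \<bullet> i) (g (P y) \<bullet> i) \<le> L * dist x y" .
      qed
    qed
    then have "negligible (\<Union>i\<in>Basis. {x. \<not> (\<lambda>x. g (P x) \<bullet> i) differentiable (at x)})"
      by (intro negligible_Union) auto
    moreover have "{x. \<not> g differentiable (at x)} \<inter> ball a r \<subseteq> (\<Union>i\<in>Basis. {x. \<not> (\<lambda>x. g (P x) \<bullet> i) differentiable (at x)})"
    proof
      fix x assume x: "x \<in> {x. \<not> g differentiable (at x)} \<inter> ball a r"
      show "x \<in> (\<Union>i\<in>Basis. {x. \<not> (\<lambda>x. g (P x) \<bullet> i) differentiable (at x)})"
      proof (rule ccontr)
        assume "x \<notin> (\<Union>i\<in>Basis. {x. \<not> (\<lambda>x. g (P x) \<bullet> i) differentiable (at x)})"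
        then have "(\<lambda>x. g (P x) \<bullet> i) differentiable (at x)" if "i \<in> Basis" for i using that by auto
        then have "(\<lambda>x. g (P x)) differentiable (at x)"
          using differentiable_componentwise_within[of "\<lambda>x. g (P x)" x UNIV] by simp
        then obtain D where D: "((\<lambda>x. g (P x)) has_derivative D) (at x)" by (auto simp: differentiable_def)
        have "(g has_derivative D) (at x)"
        proof (rule has_derivative_transform_within_open[OF D, of "ball a r"])
          fix y assume "y \<in> ball a r"
          then show "g (P y) = g y" using closest_point_self[of y "cball a r"] by (simp add: P_def)
        qed (use x in auto)
        then show False using x by (auto simp: differentiable_def)
      qed
    qed
    ultimately show ?thesis using r(1) negligible_subset by blast
  qed
  then obtain e where e: "\<And>a. e a > 0" "\<And>a. negligible ({x. \<not> g differentiable (at x)} \<inter> ball a (e a))" by metis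
  obtain F where F: "F \<subseteq> range (\<lambda>a. ball a (e a))" "countable F" "\<Union>F = \<Union>(range (\<lambda>a. ball a (e a)))"
    using Lindelof[of "range (\<lambda>a. ball a (e a))"] by blast
  have "\<Union>F = UNIV" using F(3) e(1) by (auto intro: centre_in_ball[THEN iffD2])
  then have "{x. \<not> g differentiable (at x)} = (\<Union>B\<in>F. {x. \<not> g differentiable (at x)} \<inter> B)" by auto
  moreover have "negligible (\<Union>B\<in>F. {x. \<not> g differentiable (at x)} \<inter> B)"
    using F(1,2) e(2) by (intro negligible_countable_Union) auto
  ultimately show ?thesis by simp
qed

text \<open>The gradient of the \<open>j\<close>-th component of \<open>grad u\<close> is the \<open>j\<close>-th column of \<open>hessian u x\<close>; by symmetry it is also the \<open>j\<close>-th row,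
  as the matrix of a derivative requires.\<close>
lemma hessian_derivative_grad:
  fixes u :: "real^'n::finite \<Rightarrow> real"
  assumes d: "grad u differentiable (at x)" and sym: "hessian u x \<in> sym_matrices"
  shows "(grad u has_derivative (\<lambda>h. hessian u x *v h)) (at x)"
proof -
  obtain D where D: "(grad u has_derivative D) (at x)" using d by (auto simp: differentiable_def)
  have "D h = hessian u x *v h" for h
  proof (rule vec_eq_iff[THEN iffD2], rule allI)
    fix j
    have Dj: "((\<lambda>y. grad u y $ j) has_derivative (\<lambda>h. D h $ j)) (at x)"
      by (rule bounded_linear.has_derivative[OF bounded_linear_vec_nth D])
    have "grad (\<lambda>y. grad u y $ j) x \<bullet> h = D h $ j"
      using has_derivative_unique[OF has_derivative_imp_grad[OF differentiableI[OF Dj]] Dj] by meson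
    moreover have "grad (\<lambda>y. grad u y $ j) x $ i = hessian u x $ j $ i" for i
      using sym unfolding sym_matrices_iff by (simp add: grad_def hessian_def)
    ultimately show "D h $ j = (hessian u x *v h) $ j"
      by (simp add: inner_vec_def matrix_vector_mult_def)
  qed
  then have "D = (\<lambda>h. hessian u x *v h)" by auto
  then show ?thesis using D by simp
qed

lemma outer_prod_sym: "outer_prod v v \<in> sym_matrices"
  by (simp add: sym_matrices_iff outer_prod_def mult.commute)

lemma mat_sym: "mat c \<in> sym_matrices"
  by (simp add: sym_matrices_iff mat_def)

lemma hessian_sym_if_conf_hessian_sym:
  fixes u :: "real^'n::finite \<Rightarrow> real"
  assumes "CARD('n) \<ge> 3" "u x > 0" "conf_hessian u x \<in> sym_matrices"
  shows "hessian u x \<in> sym_matrices"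
proof -
  define a where "a = 2 / (real CARD('n) - 2) * u x powr - ((real CARD('n) + 2) / (real CARD('n) - 2))"
  have a: "a > 0" using assms by (simp add: a_def)
  obtain b c where "conf_hessian u x = (- a) *\<^sub>R hessian u x + b *\<^sub>R outer_prod (grad u x) (grad u x) - c *\<^sub>R mat 1"
    unfolding conf_hessian_def Let_def a_def by auto
  then have "conf_hessian u x $ i $ j = - (a * hessian u x $ i $ j) + b * outer_prod (grad u x) (grad u x) $ i $ j - c * mat 1 $ i $ j" for i j
    by simp
  moreover have "outer_prod (grad u x) (grad u x) $ i $ j = outer_prod (grad u x) (grad u x) $ j $ i" for i j
    using outer_prod_sym unfolding sym_matrices_iff by blast
  moreover have "(mat 1 :: real^'n^'n) $ i $ j = mat 1 $ j $ i" for i j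
    using mat_sym unfolding sym_matrices_iff by blast
  ultimately have "a * hessian u x $ i $ j = a * hessian u x $ j $ i" for i j
    using assms(3) unfolding sym_matrices_iff by (metis add_right_cancel diff_add_cancel neg_equal_iff_equal)
  then show ?thesis using a by (simp add: sym_matrices_iff)
qed

section \<open>Symmetric matrices and the conformal Hessian\<close>

lemma sym_top_closure_of: "sym_top closure_of U = closure U \<inter> sym_matrices" if "U \<subseteq> sym_matrices"
  for U :: "(real^'n::finite^'n) set"
  using that by (simp add: closure_of_subtopology Int_absorb1 Int_commute)

lemma closed_sym_matrices: "closed (sym_matrices :: (real^'n::finite^'n) set)"
proof -
  have eq: "sym_matrices = (\<Inter>i. \<Inter>j. {M :: real^'n^'n. M $ i $ j = M $ j $ i})"
    by (auto simp: sym_matrices_iff)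
  have cl: "closed {M :: real^'n^'n. M $ i $ j = M $ j $ i}" for i j
    by (intro closed_Collect_eq continuous_intros)
  show ?thesis unfolding eq by (intro closed_INT ballI cl)
qed

text \<open>The quadratic form has a positive minimum on the unit sphere.\<close>
lemma posdef_perturb:
  fixes P :: "real^'n::finite^'n"
  assumes P: "posdef P"
  obtains d where "d > 0" "\<And>N. N \<in> sym_matrices \<Longrightarrow> norm N < d \<Longrightarrow> posdef (P + N)"
proof -
  have c: "continuous_on (sphere 0 1) (\<lambda>x. x \<bullet> (P *v x))"
    by (intro continuous_intros linear_continuous_on linear_linear[THEN iffD1] matrix_vector_mul_linear)
  have ne: "sphere (0::real^'n) 1 \<noteq> {}" by simp
  obtain x0 :: "real^'n" where x0: "x0 \<in> sphere 0 1" "\<And>x. x \<in> sphere 0 1 \<Longrightarrow> x0 \<bullet> (P *v x0) \<le> x \<bullet> (P *v x)"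
    using continuous_attains_inf[OF compact_sphere ne c] by blast
  define \<mu> where "\<mu> = x0 \<bullet> (P *v x0)"
  have "x0 \<noteq> 0" using x0(1) by auto
  then have mu: "\<mu> > 0" using P by (auto simp: posdef_def \<mu>_def)
  have low: "x \<bullet> (P *v x) \<ge> \<mu> * (x \<bullet> x)" for x
  proof (cases "x = 0")
    case False
    define y where "y = (1 / norm x) *\<^sub>R x"
    have "y \<in> sphere 0 1" using False by (simp add: y_def)
    then have "\<mu> \<le> y \<bullet> (P *v y)" unfolding \<mu>_def by (rule x0(2))
    also have "y \<bullet> (P *v y) = (x \<bullet> (P *v x)) / (norm x)\<^sup>2"
      by (simp add: y_def matrix_vector_mult_scaleR power2_eq_square)
    finally show ?thesis using False by (simp add: pos_le_divide_eq power2_norm_eq_inner)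
  qed auto
  have bil: "bounded_bilinear ((*v) :: real^'n^'n \<Rightarrow> real^'n \<Rightarrow> real^'n)"
    unfolding bilinear_conv_bounded_bilinear[symmetric] bilinear_def
    by (auto intro!: linearI simp: matrix_vector_mult_add_rdistrib matrix_vector_right_distrib
        matrix_vector_mult_scaleR scaleR_matrix_vector_assoc[symmetric])
  obtain K where K: "K > 0" "\<And>N x. norm ((N :: real^'n^'n) *v (x :: real^'n)) \<le> norm N * norm x * K"
    using bounded_bilinear.pos_bounded[OF bil] by blast
  show ?thesis
  proof (rule that[of "\<mu> / K"])
    show "\<mu> / K > 0" using mu K by simp
    fix N :: "real^'n^'n" assume N: "N \<in> sym_matrices" "norm N < \<mu> / K"
    show "posdef (P + N)" unfolding posdef_def
    proof (intro conjI allI impI)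
      show "P + N \<in> sym_matrices" using P N by (auto simp: posdef_def sym_matrices_iff)
      fix x :: "real^'n" assume x: "x \<noteq> 0"
      have "\<bar>x \<bullet> (N *v x)\<bar> \<le> norm x * norm (N *v x)" by (rule Cauchy_Schwarz_ineq2)
      also have "\<dots> \<le> norm x * (norm N * norm x * K)" by (intro mult_left_mono K) auto
      also have "\<dots> = norm N * K * (x \<bullet> x)" by (simp add: power2_norm_eq_inner[symmetric] power2_eq_square)
      also have "\<dots> < \<mu> * (x \<bullet> x)"
        using N(2) K(1) x by (intro mult_strict_right_mono) (auto simp: pos_less_divide_eq)
      finally show "x \<bullet> ((P + N) *v x) > 0"
        using low[of x] by (simp add: matrix_vector_mult_add_rdistrib inner_add_right)
    qed
  qed
qed

lemma trace_conj_orthogonal: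
  fixes M Q :: "real^'n::finite^'n"
  assumes "orthogonal_matrix Q"
  shows "trace (transpose Q ** M ** Q) = trace M"
proof -
  have "trace (transpose Q ** M ** Q) = trace (M ** Q ** transpose Q)"
    by (metis matrix_mul_assoc trace_mul_sym)
  also have "\<dots> = trace M" using assms by (simp add: matrix_mul_assoc[symmetric] orthogonal_matrix_def)
  finally show ?thesis .
qed

lemma matrix_inv_orthogonal:
  fixes Q :: "real^'n::finite^'n"
  assumes "orthogonal_matrix Q" shows "matrix_inv Q = transpose Q"
proof -
  have "\<exists>A. Q ** A = mat 1 \<and> A ** Q = mat 1" using assms by (auto simp: orthogonal_matrix_def)
  then have inv: "matrix_inv Q ** Q = mat 1" unfolding matrix_inv_def by (rule someI2_ex) simp
  have "matrix_inv Q = matrix_inv Q ** (Q ** transpose Q)" using assms by (simp add: orthogonal_matrix_def)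
  also have "\<dots> = transpose Q" by (simp add: matrix_mul_assoc inv)
  finally show ?thesis .
qed

text \<open>The element of minimal norm is unique by convexity, hence fixed by all reflections. A matrix commuting
  with all reflections has every vector as an eigenvector and is therefore scalar. This replaces averaging over the orthogonal group.\<close>
lemma invariant_convex_contains_scalar:
  fixes C :: "(real^'n::finite^'n) set"
  assumes C: "closed C" "convex C" "C \<noteq> {}"
    and inv: "\<And>M d. M \<in> C \<Longrightarrow> reflect_matrix d ** M ** reflect_matrix d \<in> C"
  obtains c where "c *\<^sub>R mat 1 \<in> C"
proof -
  define S where "S = closest_point C 0"
  have S: "S \<in> C" using C by (simp add: S_def closest_point_in_set)
  have uniq: "N = S" if N: "N \<in> C" "norm N = norm S" for N
    unfolding S_def
  proof (rule closest_point_unique[OF C(2,1) N(1)], rule ballI)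
    fix z assume "z \<in> C"
    then show "dist 0 N \<le> dist 0 z" using closest_point_le[OF C(1), of z 0] N(2) by (simp add: S_def)
  qed
  have nrm: "norm (reflect_matrix d ** M ** reflect_matrix d) = norm M" for d :: "real^'n" and M :: "real^'n^'n"
  proof -
    let ?R = "reflect_matrix d"
    have ip: "A \<bullet> B = trace (A ** transpose B)" for A B :: "real^'n^'n"
      by (simp add: inner_vec_def trace_def matrix_matrix_mult_def transpose_def)
    have "(?R ** M ** ?R) \<bullet> (?R ** M ** ?R) = trace (?R ** (M ** (?R ** ?R) ** transpose M) ** ?R)"
      unfolding ip by (simp add: matrix_transpose_mul transpose_reflect_matrix matrix_mul_assoc)
    also have "\<dots> = trace (transpose ?R ** (M ** transpose M) ** ?R)"
      by (simp add: reflect_matrix_reflect_matrix transpose_reflect_matrix)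
    also have "\<dots> = M \<bullet> M" unfolding ip by (rule trace_conj_orthogonal[OF orthogonal_reflect_matrix])
    finally show ?thesis by (simp add: norm_eq_sqrt_inner)
  qed
  have fix1: "reflect_matrix d ** S = S ** reflect_matrix d" for d
  proof -
    have "reflect_matrix d ** S ** reflect_matrix d = S" by (intro uniq inv S nrm)
    then have "reflect_matrix d ** S ** (reflect_matrix d ** reflect_matrix d) = S ** reflect_matrix d"
      by (simp add: matrix_mul_assoc)
    then show ?thesis by (simp add: reflect_matrix_reflect_matrix)
  qed
  have eig: "\<exists>c. S *v d = c *\<^sub>R d" for d
  proof -
    have "reflect d (S *v d) = S *v reflect d d"
      using arg_cong[OF fix1[of d], of "\<lambda>A. A *v d"]
      by (simp add: matrix_vector_mul_assoc[symmetric] reflect_matrix_mult_vec)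
    then have "S *v d - (2 * (d \<bullet> (S *v d)) / (d \<bullet> d)) *\<^sub>R d = - (S *v d)"
      by (simp add: reflect_self reflect_def linear_neg[OF matrix_vector_mul_linear])
    then have "2 *\<^sub>R (S *v d) = (2 * (d \<bullet> (S *v d)) / (d \<bullet> d)) *\<^sub>R d"
      by (simp add: scaleR_2 algebra_simps)
    then have "(1/2) *\<^sub>R (2 *\<^sub>R (S *v d)) = (1/2) *\<^sub>R ((2 * (d \<bullet> (S *v d)) / (d \<bullet> d)) *\<^sub>R d)" by simp
    then show ?thesis by auto
  qed
  then obtain f where f: "\<And>d. S *v d = f d *\<^sub>R d" by metis
  define c where "c i = f (axis i 1)" for i
  have cc: "c i = c j" for i j
  proof (cases "i = j")
    case False
    have "f (axis i 1 + axis j 1) *\<^sub>R (axis i 1 + axis j 1) = c i *\<^sub>R axis i 1 + c j *\<^sub>R (axis j 1 :: real^'n)"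
      unfolding f[symmetric] c_def by (simp add: matrix_vector_right_distrib)
    from arg_cong[OF this, of "\<lambda>v. v $ i"] arg_cong[OF this, of "\<lambda>v. v $ j"] False
    show ?thesis by (simp add: axis_def)
  qed auto
  obtain i0 :: 'n where True by simp
  have "S = c i0 *\<^sub>R mat 1"
  proof -
    have "S $ i $ j = (c i0 *\<^sub>R mat 1) $ i $ j" for i j
    proof -
      have "S $ i $ j = (S *v axis j 1) $ i" by (simp add: matrix_vector_mult_basis column_def)
      also have "\<dots> = c j * (if i = j then 1 else 0)" unfolding f c_def by (simp add: axis_def)
      finally show ?thesis using cc[of j i0] by (simp add: mat_def)
    qed
    then show ?thesis by (simp add: vec_eq_iff)
  qed
  then show ?thesis using S that by simp
qed

text \<open>The substitution \<open>w = u powr (- p)\<close> with \<open>p = 2/(n - 2)\<close> absorbs all powers of \<open>u\<close>.\<close>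
lemma conf_hessian_eq_schouten:
  fixes u :: "real^'n::finite \<Rightarrow> real"
  assumes n: "CARD('n) \<ge> 3" and pos: "\<And>y. u y > 0" and u: "(u has_derivative (\<lambda>h. grad u x \<bullet> h)) (at x)"
    and H: "(grad u has_derivative (\<lambda>h. hessian u x *v h)) (at x)"
  defines "p \<equiv> 2 / (real CARD('n) - 2)"
  defines "gw \<equiv> \<lambda>y. (- p * u y powr (- p - 1)) *\<^sub>R grad u y"
  obtains H' where "(gw has_derivative (\<lambda>h. H' *v h)) (at x)"
    "schouten (u x powr (- p)) (gw x) H' = conf_hessian u x"
proof -
  let ?G = "grad u x"
  define H' where "H' = (- p * u x powr (- p - 1)) *\<^sub>R hessian u x
      + (p * (p + 1) * u x powr (- p - 2)) *\<^sub>R outer_prod ?G ?G"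
  have dpow: "((\<lambda>y. - p * u y powr (- p - 1)) has_derivative
      (\<lambda>h. p * (p + 1) * u x powr (- p - 2) * (?G \<bullet> h))) (at x)"
  proof -
    have "((\<lambda>z. z powr (- p - 1)) has_derivative (*) ((- p - 1) * u x powr (- p - 1 - 1))) (at (u x))"
      using has_real_derivative_powr[OF pos, of "- p - 1" x] by (simp add: has_field_derivative_def)
    from has_derivative_mult_right[OF has_derivative_compose[OF u this], of "- p"] show ?thesis
      by (rule has_derivative_eq_rhs) (auto simp: fun_eq_iff algebra_simps)
  qed
  have 1: "(gw has_derivative (\<lambda>h. H' *v h)) (at x)"
    unfolding gw_def
    by (rule has_derivative_eq_rhs[OF has_derivative_scaleR[OF dpow H]])
      (simp add: fun_eq_iff H'_def matrix_vector_mult_add_rdistrib matrix_vector_mult_diff_rdistrib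
        scaleR_matrix_vector_assoc[symmetric] outer_prod_mult_vec)
  define N where "N = real CARD('n)"
  have N: "N - 2 > 0" using n by (simp add: N_def)
  have p: "p = 2 / (N - 2)" by (simp add: p_def N_def)
  have e1: "- p + (- p - 1) = - ((N + 2) / (N - 2))" and e2: "- p + (- p - 2) = - (2 * N / (N - 2))"
    and e3: "(- p - 1) + (- p - 1) = - (2 * N / (N - 2))"
    and e4: "p * (p + 1) = 2 * N / (N - 2)\<^sup>2" and e5: "p\<^sup>2 / 2 = 2 / (N - 2)\<^sup>2"
    using N by (simp_all add: p divide_simps power2_eq_square) (simp_all add: algebra_simps)
  have f1: "u x powr (- p) * u x powr (- p - 1) = u x powr (- ((N + 2) / (N - 2)))"
    and f2: "u x powr (- p) * u x powr (- p - 2) = u x powr (- (2 * N / (N - 2)))"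
    and f3: "u x powr (- p - 1) * u x powr (- p - 1) = u x powr (- (2 * N / (N - 2)))"
    unfolding powr_add[symmetric] e1 e2 e3 by simp_all
  have "gw x \<bullet> gw x = p\<^sup>2 * (u x powr (- p - 1) * u x powr (- p - 1)) * (?G \<bullet> ?G)"
    by (simp add: gw_def power2_eq_square)
  then have g: "gw x \<bullet> gw x / 2 = 2 / (N - 2)\<^sup>2 * u x powr (- (2 * N / (N - 2))) * (norm ?G)\<^sup>2"
    unfolding f3 e5[symmetric] power2_norm_eq_inner by simp
  have "u x powr (- p) *\<^sub>R H' = (- p * (u x powr (- p) * u x powr (- p - 1))) *\<^sub>R hessian u x
      + (p * (p + 1) * (u x powr (- p) * u x powr (- p - 2))) *\<^sub>R outer_prod ?G ?G"
    by (simp add: H'_def scaleR_add_right scaleR_diff_right mult_ac)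
  then have 2: "schouten (u x powr (- p)) (gw x) H' = conf_hessian u x"
    unfolding schouten_def conf_hessian_def Let_def N_def[symmetric] g f1 f2 e4 by (simp add: p)
  show ?thesis by (rule that[OF 1 2])
qed

lemma trace_conf_hessian:
  fixes u :: "real^'n::finite \<Rightarrow> real"
  assumes n: "CARD('n) \<ge> 3"
  shows "trace (conf_hessian u x) =
    - (2 / (real CARD('n) - 2) * u x powr (- ((real CARD('n) + 2) / (real CARD('n) - 2)))) * trace (hessian u x)"
  unfolding conf_hessian_def Let_def
  by (simp add: trace_add trace_sub trace_scaleR trace_outer_prod trace_I power2_norm_eq_inner)

section \<open>The Liouville theorem\<close>

lemma AE_lebesgue_imp_negligible:
  assumes "AE x in lebesgue. P x" shows "negligible {x. \<not> P x}"
proof -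
  obtain N where "{x \<in> space lebesgue. \<not> P x} \<subseteq> N" "emeasure lebesgue N = 0" "N \<in> sets lebesgue"
    using AE_E[OF assms] by blast
  then have "negligible N" "{x. \<not> P x} \<subseteq> N" by (auto simp: negligible_iff_null_sets intro: null_setsI)
  then show ?thesis by (rule negligible_subset)
qed

text \<open>The assumptions on \<open>U\<close>, with orthogonal conjugations restricted to reflections.\<close>
locale invariant_cone =
  fixes U :: "(real^'n::finite^'n) set"
  assumes open_U: "openin sym_top U" and convex_U: "convex U" and ne_U: "U \<noteq> {}"
    and add_U: "\<And>M N. M \<in> U \<Longrightarrow> posdef N \<Longrightarrow> M + N \<in> U"
    and scale_U: "\<And>M a. M \<in> U \<Longrightarrow> a > 0 \<Longrightarrow> a *\<^sub>R M \<in> U"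
    and reflect_U: "\<And>M d. M \<in> U \<Longrightarrow> reflect_matrix d ** M ** reflect_matrix d \<in> U"
    and proper_U: "U \<noteq> sym_matrices"
begin

definition K :: "(real^'n^'n) set" where "K = closure U"

lemma U_sym: "U \<subseteq> sym_matrices"
  using openin_imp_subset[OF open_U] by simp

lemma K_sym: "K \<subseteq> sym_matrices"
  unfolding K_def by (rule closure_minimal[OF U_sym closed_sym_matrices])

lemma closure_of_U: "sym_top closure_of U = K"
  using sym_top_closure_of[OF U_sym] K_sym by (auto simp: K_def)

lemma K_scale: assumes "M \<in> K" "c > 0" shows "c *\<^sub>R M \<in> K"
proof -
  have "(\<lambda>M. c *\<^sub>R M) ` closure U \<subseteq> closure U"
    using scale_U assms(2) closure_subset by (intro image_closure_subset) (auto intro!: continuous_intros)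
  then show ?thesis using assms(1) by (auto simp: K_def)
qed

lemma K_reflect: assumes "M \<in> K" shows "reflect_matrix d ** M ** reflect_matrix d \<in> K"
proof -
  have "linear (\<lambda>M :: real^'n^'n. reflect_matrix d ** M ** reflect_matrix d)"
    by (rule linearI) (simp_all add: matrix_eq matrix_vector_mul_assoc[symmetric] matrix_vector_mult_add_rdistrib
        matrix_vector_right_distrib scaleR_matrix_vector_assoc[symmetric] matrix_vector_mult_scaleR)
  then have "(\<lambda>M. reflect_matrix d ** M ** reflect_matrix d) ` closure U \<subseteq> closure U"
    using reflect_U closure_subset
    by (intro image_closure_subset linear_continuous_on) (auto simp: linear_conv_bounded_linear)
  then show ?thesis using assms by (auto simp: K_def)
qed

text \<open>The error made in approximating \<open>M\<close> by an element of \<open>U\<close> is absorbed by \<open>P\<close>.\<close>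
lemma K_add: assumes "M \<in> K" "posdef P" shows "M + P \<in> U"
proof -
  obtain d where d: "d > 0" "\<And>N. N \<in> sym_matrices \<Longrightarrow> norm N < d \<Longrightarrow> posdef (P + N)"
    using posdef_perturb[OF assms(2)] by blast
  obtain N where N: "N \<in> U" "dist N M < d"
    using assms(1) d(1) unfolding K_def closure_approachable by blast
  have "M - N \<in> sym_matrices" using assms(1) N(1) K_sym U_sym by (auto simp: sym_matrices_iff subset_iff)
  then have "posdef (P + (M - N))" using N(2) by (intro d(2)) (auto simp: dist_norm norm_minus_commute)
  from add_U[OF N(1) this] show ?thesis by (simp add: algebra_simps)
qed

text \<open>Write \<open>c I\<close> as the sum of a small multiple of an element of \<open>U\<close> and a positive definite matrix.\<close>
lemma scalar_in_U: assumes "c > 0" shows "c *\<^sub>R mat 1 \<in> U"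
proof -
  obtain M where M: "M \<in> U" using ne_U by blast
  obtain d where d: "d > 0" "\<And>N. N \<in> sym_matrices \<Longrightarrow> norm N < d \<Longrightarrow> posdef (c *\<^sub>R mat 1 + N :: real^'n^'n)"
    using posdef_perturb[OF posdef_scaleR_mat_1[OF assms]] by blast
  define e where "e = d / (norm M + 1)"
  have e: "e > 0" using d(1) by (simp add: e_def add_nonneg_pos)
  have "posdef (c *\<^sub>R mat 1 + (- e) *\<^sub>R M)"
  proof (rule d(2))
    show "(- e) *\<^sub>R M \<in> sym_matrices" using M U_sym by (auto simp: sym_matrices_iff subset_iff)
    show "norm ((- e) *\<^sub>R M) < d" using d(1) by (simp add: e_def divide_less_eq add_nonneg_pos)
  qed
  from add_U[OF scale_U[OF M e] this] show ?thesis by simp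
qed

text \<open>An open cone that contains \<open>0\<close> consists of all symmetric matrices.\<close>
lemma zero_notin_U: "0 \<notin> U"
proof
  assume "0 \<in> U"
  then obtain d where d: "d > 0" "\<And>N. N \<in> sym_matrices \<Longrightarrow> dist N 0 < d \<Longrightarrow> N \<in> U"
    using open_U unfolding openin_euclidean_subtopology_iff by blast
  have "M \<in> U" if M: "M \<in> sym_matrices" for M
  proof -
    define e where "e = d / (norm M + 1)"
    have e: "e > 0" using d(1) by (simp add: e_def add_nonneg_pos)
    have "e *\<^sub>R M \<in> U"
    proof (rule d(2))
      show "e *\<^sub>R M \<in> sym_matrices" using M by (auto simp: sym_matrices_iff)
      show "dist (e *\<^sub>R M) 0 < d" using d(1) by (simp add: e_def divide_less_eq add_nonneg_pos)
    qed
    from scale_U[OF this, of "1 / e"] show ?thesis using e by simp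
  qed
  then show False using U_sym proper_U by blast
qed

text \<open>Among the elements of \<open>K\<close> with the same trace as \<open>M\<close> there is a scalar matrix. If the trace is negative, adding a positive multiple of the identity
  to it would put \<open>0\<close> into \<open>U\<close>.\<close>
lemma trace_nonneg: assumes M: "M \<in> K" shows "trace M \<ge> 0"
proof (rule ccontr)
  assume neg: "\<not> ?thesis"
  define C where "C = K \<inter> {N. trace N = trace M}"
  have lin: "linear (trace :: real^'n^'n \<Rightarrow> real)"
    by (rule linearI) (simp_all add: trace_add trace_scaleR)
  have "closed C"
    unfolding C_def K_def using linear_continuous_on[OF linear_conv_bounded_linear[THEN iffD1, OF lin]]
    by (intro closed_Int closed_closure closed_Collect_eq continuous_on_const)
  moreover have "convex C"
    unfolding C_def K_def using convex_linear_vimage[OF lin, of "{trace M}"]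
    by (intro convex_Int convex_closure convex_U) (auto simp: vimage_def)
  moreover have "C \<noteq> {}" using M by (auto simp: C_def)
  moreover have "reflect_matrix d ** N ** reflect_matrix d \<in> C" if "N \<in> C" for N d
    using that K_reflect[of N d] trace_conj_orthogonal[OF orthogonal_reflect_matrix[of d], of N]
    by (auto simp: C_def transpose_reflect_matrix)
  ultimately obtain c where c: "c *\<^sub>R mat 1 \<in> C" by (rule invariant_convex_contains_scalar)
  then have "c * real CARD('n) = trace M" by (simp add: C_def trace_scaleR trace_I)
  then have "c < 0" using neg by (metis mult_nonneg_nonneg not_le of_nat_0_le_iff)
  then have "c *\<^sub>R mat 1 + (- c) *\<^sub>R mat 1 \<in> U" using c by (intro K_add posdef_scaleR_mat_1) (auto simp: C_def)
  then show False using zero_notin_U by simp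
qed

sublocale elliptic_cone U K
  using K_sym K_scale K_add scale_U by unfold_locales auto

end

theorem theorem1p3:
  fixes U :: "(real^'n::finite^'n) set"
    and F :: "real^'n^'n \<Rightarrow> real"
    and u :: "real^'n \<Rightarrow> real"
  assumes n: "CARD('n) \<ge> 3"
    and U_open: "openin sym_top U"
    and U_convex: "convex U"
    and F_C1: "C1_on_sym U F"
    and F_C0: "continuous_on (sym_top closure_of U) F"
    and U_inv: "\<forall>Q. orthogonal_matrix Q \<longrightarrow> (\<lambda>M. matrix_inv Q ** M ** Q) ` U = U"
    and U_add: "\<forall>M\<in>U. \<forall>N. posdef N \<longrightarrow> M + N \<in> U"
    and U_cone: "\<forall>M\<in>U. \<forall>a>0. a *\<^sub>R M \<in> U"
    and U_diag: "{a *\<^sub>R mat 1 | a. a > 0} \<inter> (sym_top frontier_of U) = {}"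
    and F_inv: "\<forall>M\<in>U. \<forall>Q. orthogonal_matrix Q \<longrightarrow> F (matrix_inv Q ** M ** Q) = F M"
    and F_elliptic: "\<forall>M\<in>U. posdef (sym_grad F M)"
    and F_pos: "\<forall>M\<in>U. F M > 0"
    and F_zero: "\<forall>M \<in> sym_top frontier_of U. F M = 0"
    and u_pos: "\<forall>x. u x > 0"
    and u_C11: "C11_on UNIV u"
    and u_superharmonic: "laplacian_le_0_distr u"
    and u_eq: "AE x in lebesgue.
                 conf_hessian u x \<in> sym_top closure_of U \<and> F (conf_hessian u x) = 0"
  shows "\<forall>x. u x = u 0"
proof -
  define bad where "bad = {x. \<not> (conf_hessian u x \<in> sym_top closure_of U \<and> F (conf_hessian u x) = 0)}"
  have neg_bad: "negligible bad" unfolding bad_def by (rule AE_lebesgue_imp_negligible[OF u_eq])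
  then have "bad \<noteq> UNIV" using non_negligible_UNIV by metis
  then obtain y where "y \<notin> bad" by blast
  then have y: "conf_hessian u y \<in> sym_top closure_of U" "F (conf_hessian u y) = 0" by (auto simp: bad_def)
  interpret invariant_cone U
  proof
    show "openin sym_top U" "convex U" by fact+
    show "U \<noteq> {}" using y(1) by auto
    show "M + N \<in> U" if "M \<in> U" "posdef N" for M N using U_add that by blast
    show "a *\<^sub>R M \<in> U" if "M \<in> U" "a > 0" for M a using U_cone that by blast
    show "reflect_matrix d ** M ** reflect_matrix d \<in> U" if M: "M \<in> U" for M d
    proof -
      have "matrix_inv (reflect_matrix d) = (reflect_matrix d :: real^'n^'n)"
        by (simp add: matrix_inv_orthogonal orthogonal_reflect_matrix transpose_reflect_matrix)
      moreover have "(\<lambda>M. matrix_inv (reflect_matrix d) ** M ** reflect_matrix d) ` U = U"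
        using U_inv orthogonal_reflect_matrix by blast
      ultimately have "(\<lambda>M. reflect_matrix d ** M ** reflect_matrix d) ` U = U" by (simp only:)
      then show ?thesis using M by blast
    qed
    show "U \<noteq> sym_matrices"
    proof
      assume "U = sym_matrices"
      then have "conf_hessian u y \<in> U" using y(1) closure_of_subset_topspace[of sym_top U] by auto
      then show False using F_pos y(2) by (metis less_irrefl)
    qed
  qed
  define p where "p = 2 / (real CARD('n) - 2)"
  define w where "w x = u x powr (- p)" for x
  define g where "g x = (- p * u x powr (- p - 1)) *\<^sub>R grad u x" for x
  have upos: "u x > 0" for x using u_pos by simp
  have u_C1: "C1lip UNIV u (grad u)" by (rule C11_on_imp_C1lip[OF u_C11])
  have du: "(u has_derivative (\<lambda>h. grad u x \<bullet> h)) (at x)" for x using u_C1 by (simp add: C1lip_def)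
  define nondiff where "nondiff = {x. \<not> grad u differentiable (at x)}"
  have "\<exists>e>0. \<exists>L. L-lipschitz_on (ball x e) (grad u)" for x
    using u_C11 unfolding C11_on_def by blast
  then have neg_nondiff: "negligible nondiff"
    unfolding nondiff_def by (rule locally_lipschitz_AE_differentiable)
  have good: "(grad u has_derivative (\<lambda>h. hessian u x *v h)) (at x)" "trace (hessian u x) \<le> 0"
      "\<exists>H. (g has_derivative (\<lambda>h. H *v h)) (at x) \<and> schouten (w x) (g x) H \<in> K - U"
    if x: "x \<notin> bad \<union> nondiff" for x
  proof -
    have A: "conf_hessian u x \<in> K" "F (conf_hessian u x) = 0" using x by (auto simp: bad_def closure_of_U)
    have sym: "hessian u x \<in> sym_matrices"
      using A(1) K_sym by (intro hessian_sym_if_conf_hessian_sym[OF n upos]) auto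
    show H: "(grad u has_derivative (\<lambda>h. hessian u x *v h)) (at x)"
      using x by (intro hessian_derivative_grad sym) (simp add: nondiff_def)
    define a where "a = 2 / (real CARD('n) - 2) * u x powr (- ((real CARD('n) + 2) / (real CARD('n) - 2)))"
    have "a > 0" using n upos[of x] by (simp add: a_def)
    moreover have "a * trace (hessian u x) \<le> 0"
      using trace_nonneg[OF A(1)] unfolding trace_conf_hessian[OF n] a_def[symmetric] by simp
    ultimately show "trace (hessian u x) \<le> 0" by (simp add: mult_le_0_iff)
    have "conf_hessian u x \<notin> U" using A(2) F_pos by (metis less_irrefl)
    then have "conf_hessian u x \<in> K - U" using A(1) by blast
    moreover obtain H' where
      "((\<lambda>y. (- p * u y powr (- p - 1)) *\<^sub>R grad u y) has_derivative (\<lambda>h. H' *v h)) (at x)"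
      "schouten (u x powr (- p)) ((- p * u x powr (- p - 1)) *\<^sub>R grad u x) H' = conf_hessian u x"
      unfolding p_def by (rule conf_hessian_eq_schouten[OF n upos du H])
    then have "(g has_derivative (\<lambda>h. H' *v h)) (at x)" "schouten (w x) (g x) H' = conf_hessian u x"
      by (simp_all only: g_def[abs_def] w_def)
    ultimately show "\<exists>H. (g has_derivative (\<lambda>h. H *v h)) (at x) \<and> schouten (w x) (g x) H \<in> K - U"
      by metis
  qed
  have neg: "negligible (bad \<union> nondiff)" using neg_bad neg_nondiff by simp
  have u_sh: "superharmonic_AE UNIV (grad u)"
    unfolding superharmonic_AE_def
  proof (rule negligible_subset[OF neg], rule subsetI, rule ccontr)
    fix x assume "x \<in> {x\<in>UNIV. \<not> (\<exists>H. (grad u has_derivative (\<lambda>h. H *v h)) (at x) \<and> trace H \<le> 0)}"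
      and "x \<notin> bad \<union> nondiff"
    then show False using good(1,2)[of x] by blast
  qed
  have dw: "(w has_derivative (\<lambda>h. g x \<bullet> h)) (at x)" for x
  proof -
    have "((\<lambda>z. z powr (- p)) has_derivative (*) (- p * u x powr (- p - 1))) (at (u x))"
      using has_real_derivative_powr[OF upos, of "- p" x] by (simp add: has_field_derivative_def)
    from has_derivative_compose[OF du this] show ?thesis
      unfolding w_def[abs_def] by (rule has_derivative_eq_rhs) (auto simp: fun_eq_iff g_def)
  qed
  have lg: "lip_at g x" for x
  proof -
    have "(\<lambda>x. - p * u x powr (- p - 1)) differentiable (at x)"
    proof -
      have "((\<lambda>z. - p * z powr (- p - 1)) has_derivative (*) (- p * ((- p - 1) * u x powr (- p - 1 - 1)))) (at (u x))"
        using DERIV_cmult[OF has_real_derivative_powr[OF upos, of "- p - 1" x], of "- p"]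
        by (simp add: has_field_derivative_def)
      from has_derivative_compose[OF du this] show ?thesis by (rule differentiableI)
    qed
    moreover have "lip_at (grad u) x" using u_C1 by (simp add: C1lip_def)
    ultimately show ?thesis
      unfolding g_def[abs_def] by (rule lip_at_scaleR[OF differentiable_imp_lip_at])
  qed
  interpret entire_solution U K w g
  proof
    show "reflect_matrix d ** M ** reflect_matrix d \<in> K" if "M \<in> K" for M d using K_reflect that .
    show "w x > 0" for x using upos[of x] by (simp add: w_def)
    show "C1lip UNIV w g" using dw lg by (simp add: C1lip_def)
    show "schouten_AE (K - U) UNIV w g"
      unfolding schouten_AE_def
    proof (rule negligible_subset[OF neg], rule subsetI, rule ccontr)
      fix x assume "x \<in> {x\<in>UNIV. \<not> (\<exists>H. (g has_derivative (\<lambda>h. H *v h)) (at x) \<and> schouten (w x) (g x) H \<in> K - U)}"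
        and "x \<notin> bad \<union> nondiff"
      then show False using good(3)[of x] by blast
    qed
  qed
  show ?thesis
  proof
    fix x
    have "w x = w 0"
      by (rule liouville[OF n u_C1 u_sh upos _ scalar_in_U]) (simp_all add: w_def p_def)
    then have "w x powr (- (1 / p)) = w 0 powr (- (1 / p))" by simp
    moreover have "p \<noteq> 0" using n by (simp add: p_def)
    ultimately show "u x = u 0" using upos[of x] upos[of 0] by (simp add: w_def powr_powr)
  qed
qed

end
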